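(* Let $n\ge1$ and $\mathbf i\in\Sigma_{n+1}$. The following are equivalent: (1) the string cone $C_{\mathbf i}$ is simplicial; (2) there exists $(\sigma_1,\dots,\sigma_n)\in\{A,D\}^n$ with $\mathrm{ind}_{\sigma_k}\big(C_{\sigma_{k+1}}\circ\cdots\circ C_{\sigma_n}(\mathbf i)\big)=0$ for all $k=n,\dots,1$; (3) $C_{\mathbf i}$ is unimodularly equivalent to the cone in $\mathbb R^N$ defined by $t_1\ge0$; $t_2\ge t_3\ge0$; $t_4\ge t_5\ge t_6\ge 0$; $\dots$; $t_{N-n+1}\ge t_{N-n+2}\ge\cdots\ge t_N\ge0$ (i.e. for each $k=1,\dots,n$: $t_{k(k-1)/2+1}\ge\cdots\ge t_{k(k-1)/2+k}\ge0$).
   Context: $N=n(n+1)/2$. $s_i=(i,i+1)\in\mathfrak S_{n+1}$; $\Sigma_{n+1}$ is the set of $\mathbf i=(i_1,\dots,i_N)\in[n]^N$ with $w_0=s_{i_1}\cdots s_{i_N}$ ($w_0$ the longest element). Wiring diagram $G(\mathbf i)$: $n+1$ wires $\ell_1,\dots,\ell_{n+1}$ run from top to bottom through positions $1,\dots,n+1$ (left to right); at the top $\ell_k$ is in position $k$. Reading from top to bottom, the $j$-th crossing (node) $t_j$ swaps the two wires currently in positions $i_j,i_j+1$ (column $i_j$). At the bottom $\ell_k$ is in position $n+2-k$ and ends at $L_k$. The symbol $t_j$ also denotes the $j$-th coordinate of $\mathbb R^N$. Rigorous paths: for $k\in[n]$, $G(\mathbf i,k)$ has $\ell_1,\dots,\ell_k$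 oriented upward, the rest downward. A rigorous path in $G(\mathbf i,k)$ starts at $L_k$, ends at $L_{k+1}$, moves along wires in their orientation, may switch wires only at their crossing node, passes each node at most once, and never passes straight through the node $\ell_a\cap\ell_b$ while on $\ell_a$ when both are downward with $a>b$ or both upward with $a<b$. $\mathcal{GP}(\mathbf i)$ is the set of all rigorous paths (all $k$). String inequality of $P$: $\sum_ja_jt_j\ge0$, $a_j=1$ (resp. $-1$) if $P$ switches at $t_j$ from $\ell_r$ to $\ell_s$ with $r<s$ (resp. $r>s$), $a_j=0$ if it does not switch at $t_j$. String cone $C_{\mathbf i}$: points satisfying all string inequalities; simplicial means it has exactly $N$ facets. Unimodular equivalence: an affine map $x\mapsto Mx+v$, $M\in GL_N(\mathbb Z)$, $v\in\mathbb Z^N$, mapping one onto the other. Indices/contractions: 2-moves exchange adjacent letters $i,j$ with $|i-j|>1$, generating $\sim$. $D_n=(n,\dots,1)$, $A_n=(1,\dots,n)$. Every $\mathbf i$ satisfies $\mathbf i\sim\mathbf i_D^-D_n\mathbf i_D^+\sim\mathbf i_A^-A_n\mathbf i_A^+$; $\mathrm{ind}_D(\mathbf i)=|\mathbf i_D^+|$, $\mathrm{ind}_A(\mathbf i)=|\mathbf i_A^+|$ (independent of choices, invariant under $\sim$). $C_D(\mathbf i)=\mathbf i_D^-(\mathbf i_D^+-1)\in\Sigma_n$, $C_A(\mathbf i)=(\mathbf i_A^--1)\mathbf i_A^+\in\Sigma_n$, where $\mathbf w\pm1$ adds $\pm1$ to each letter (well defined up to $\sim$). *)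

theory Defs
  imports "HOL-Analysis.Analysis"
begin

definition sw :: "nat \<Rightarrow> nat \<Rightarrow> nat" where
  "sw i p = (if p = i then i + 1 else if p = i + 1 then i else p)"

definition wprod :: "nat list \<Rightarrow> nat \<Rightarrow> nat" where
  "wprod w = foldr (\<lambda>i f. sw i \<circ> f) w id"

text \<open>Sigma m = reduced words of the longest element w_0 of S_m:
  words of length m(m-1)/2 in letters 1..m-1 whose product is w_0 (p \<mapsto> m+1-p).\<close>
definition Sigma :: "nat \<Rightarrow> nat list set" where
  "Sigma m = {w. length w = m * (m - 1) div 2 \<and> set w \<subseteq> {1..m - 1}
                 \<and> (\<forall>p\<in>{1..m}. wprod w p = m + 1 - p)}"

definition two_move :: "nat list \<Rightarrow> nat list \<Rightarrow> bool" where
  "two_move u v \<longleftrightarrow> (\<exists>x y a b. u = x @ [a, b] @ y \<and> v = x @ [b, a] @ y \<and> (b + 1 < a \<or> a + 1 < b))"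

definition comm_equiv :: "nat list \<Rightarrow> nat list \<Rightarrow> bool" where
  "comm_equiv u v \<longleftrightarrow> two_move\<^sup>*\<^sup>* u v"

definition Dword :: "nat \<Rightarrow> nat list" where "Dword m = rev [1..<m + 1]"
definition Aword :: "nat \<Rightarrow> nat list" where "Aword m = [1..<m + 1]"

definition decD :: "nat \<Rightarrow> nat list \<Rightarrow> nat list \<times> nat list" where
  "decD m w = (SOME (u, v). comm_equiv w (u @ Dword m @ v))"
definition decA :: "nat \<Rightarrow> nat list \<Rightarrow> nat list \<times> nat list" where
  "decA m w = (SOME (u, v). comm_equiv w (u @ Aword m @ v))"

datatype AD = A | D

definition ind :: "AD \<Rightarrow> nat \<Rightarrow> nat list \<Rightarrow> nat" where
  "ind s m w = (case s of D \<Rightarrow> length (snd (decD m w)) | A \<Rightarrow> length (snd (decA m w)))"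

definition contr :: "AD \<Rightarrow> nat \<Rightarrow> nat list \<Rightarrow> nat list" where
  "contr s m w = (case s of
      D \<Rightarrow> fst (decD m w) @ map (\<lambda>x. x - 1) (snd (decD m w))
    | A \<Rightarrow> map (\<lambda>x. x - 1) (fst (decA m w)) @ snd (decA m w))"

fun citer :: "(nat \<Rightarrow> AD) \<Rightarrow> nat \<Rightarrow> nat \<Rightarrow> nat list \<Rightarrow> nat list" where
  "citer \<sigma> n 0 w = w"
| "citer \<sigma> n (Suc r) w = contr (\<sigma> (n - r)) (n - r) (citer \<sigma> n r w)"

text \<open>Nodes are 0-indexed: node j (j < length w) is the paper's t_{j+1}.
  wire_at w j p = the wire in position p after the first j crossings.\<close>
fun wire_at :: "nat list \<Rightarrow> nat \<Rightarrow> nat \<Rightarrow> nat" where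
  "wire_at w 0 p = p"
| "wire_at w (Suc j) p = wire_at w j (sw (w ! j) p)"

definition lwire :: "nat list \<Rightarrow> nat \<Rightarrow> nat" where "lwire w j = wire_at w j (w ! j)"
definition rwire :: "nat list \<Rightarrow> nat \<Rightarrow> nat" where "rwire w j = wire_at w j (w ! j + 1)"

definition on_node :: "nat list \<Rightarrow> nat \<Rightarrow> nat \<Rightarrow> bool" where
  "on_node w a j \<longleftrightarrow> j < length w \<and> (a = lwire w j \<or> a = rwire w j)"

definition other :: "nat list \<Rightarrow> nat \<Rightarrow> nat \<Rightarrow> nat" where
  "other w j a = (if a = lwire w j then rwire w j else lwire w j)"

definition next_down :: "nat list \<Rightarrow> nat \<Rightarrow> nat \<Rightarrow> nat option" where
  "next_down w a j = (if \<exists>j'. j < j' \<and> on_node w a j' then Some (LEAST j'. j < j' \<and> on_node w a j') else None)"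
definition next_up :: "nat list \<Rightarrow> nat \<Rightarrow> nat \<Rightarrow> nat option" where
  "next_up w a j = (if \<exists>j'. j' < j \<and> on_node w a j' then Some (GREATEST j'. j' < j \<and> on_node w a j') else None)"

text \<open>In G(i,k) the wires 1..k are oriented upward, the others downward.\<close>
definition upw :: "nat \<Rightarrow> nat \<Rightarrow> bool" where "upw k a \<longleftrightarrow> a \<le> k"

definition next_on :: "nat list \<Rightarrow> nat \<Rightarrow> nat \<Rightarrow> nat \<Rightarrow> nat option" where
  "next_on w k a j = (if upw k a then next_up w a j else next_down w a j)"

text \<open>A path is encoded as the list of nodes it passes, each with the wire on which it
  arrives and the wire on which it leaves: (node, wire_in, wire_out).  It starts at L_k (bottom
  end of wire k, going up), follows wires in their orientation node by node, may switch only at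
  the crossing node, passes each node at most once, never passes straight through a forbidden
  node, and leaves the last node downward along wire k+1 to its bottom end L_{k+1}.\<close>
definition rigorous :: "nat list \<Rightarrow> nat \<Rightarrow> (nat \<times> nat \<times> nat) list \<Rightarrow> bool" where
  "rigorous w k P \<longleftrightarrow>
     P \<noteq> [] \<and> distinct (map fst P)
   \<and> next_up w k (length w) = Some (fst (hd P)) \<and> fst (snd (hd P)) = k
   \<and> (\<forall>r < length P. case P ! r of (j, a, b) \<Rightarrow>
          on_node w a j \<and> on_node w b j
        \<and> (a = b \<longrightarrow> \<not> ((\<not> upw k a \<and> \<not> upw k (other w j a) \<and> other w j a < a)
                         \<or> (upw k a \<and> upw k (other w j a) \<and> a < other w j a))))
   \<and> (\<forall>r. Suc r < length P \<longrightarrow>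
          next_on w k (snd (snd (P ! r))) (fst (P ! r)) = Some (fst (P ! Suc r))
        \<and> fst (snd (P ! Suc r)) = snd (snd (P ! r)))
   \<and> snd (snd (last P)) = k + 1 \<and> next_on w k (k + 1) (fst (last P)) = None"

definition GP :: "nat \<Rightarrow> nat list \<Rightarrow> (nat \<times> (nat \<times> nat \<times> nat) list) set" where
  "GP n w = {(k, P). k \<in> {1..n} \<and> rigorous w k P}"

definition step_coeff :: "nat \<times> nat \<times> nat \<Rightarrow> real" where
  "step_coeff s = (case s of (j, a, b) \<Rightarrow> if a < b then 1 else if b < a then -1 else 0)"

text \<open>R^N is modelled as real^'N with CARD('N) = N; the coordinate t_{j+1} is x $ coord j
  for a fixed enumeration coord of the index type.\<close>
definition coord :: "nat \<Rightarrow> 'N::finite" where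
  "coord = (SOME f. bij_betw f {..<CARD('N)} (UNIV :: 'N set))"

definition string_cone :: "nat \<Rightarrow> nat list \<Rightarrow> (real ^ 'N::finite) set" where
  "string_cone n w = {x. \<forall>(k, P) \<in> GP n w.
      (\<Sum>s\<leftarrow>P. step_coeff s * x $ coord (fst s)) \<ge> 0}"

definition simplicial :: "nat \<Rightarrow> 'a::euclidean_space set \<Rightarrow> bool" where
  "simplicial N C \<longleftrightarrow> card {F. F facet_of C} = N"

definition tri :: "nat \<Rightarrow> nat" where "tri k = k * (k - 1) div 2"

definition std_cone :: "nat \<Rightarrow> (real ^ 'N::finite) set" where
  "std_cone n = {x. \<forall>k\<in>{1..n}.
      (\<forall>r. r + 1 < k \<longrightarrow> x $ coord (tri k + r) \<ge> x $ coord (tri k + r + 1))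
    \<and> x $ coord (tri k + k - 1) \<ge> 0}"

definition int_matrix :: "real ^ 'N ^ 'N \<Rightarrow> bool" where
  "int_matrix M \<longleftrightarrow> (\<forall>i j. M $ i $ j \<in> \<int>)"

definition unimod_equiv :: "(real ^ 'N::finite) set \<Rightarrow> (real ^ 'N) set \<Rightarrow> bool" where
  "unimod_equiv S T \<longleftrightarrow> (\<exists>M v. int_matrix M \<and> (\<exists>B. int_matrix B \<and> M ** B = mat 1 \<and> B ** M = mat 1)
      \<and> (\<forall>i. v $ i \<in> \<int>) \<and> (\<lambda>x. M *v x + v) ` S = T)"

end

theory Submission
  imports Defs
begin

text \<open>A reduced word is replaced by the heights \<open>h a b\<close> of the nodes of its wiring diagram. The
  contractions then become restrictions to intervals \<open>[lo, hi]\<close> of wires: a straight passage through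
  the node of an outer wire is always allowed, so the rigorous paths of an iterated contraction are the
  rigorous paths of the whole diagram that use only wires of the interval, and the indices vanish along
  some sequence iff one can repeatedly remove an outer wire whose nodes all lie below the other nodes.
  Removing such a wire splits off a chain of inequalities from the cone, which gives the standard cone,
  and the standard cone is cut out by independent inequalities.

  Conversely, the path vectors span the whole space, so if the cone is simplicial then they are
  nonnegative combinations of a basis \<open>B\<close> of path vectors. Paths avoiding an outer wire form a face, so
  this property passes to intervals of wires. In a minimal bad interval both subintervals are good, and
  all their path vectors belong to \<open>B\<close>. Only few configurations of wires remain, and in each of them
  a relation between four path vectors contradicts the independence of \<open>B\<close>.\<close>

section \<open>Arrangements of wires and their paths\<close>

text \<open>Two families of linear functionals carry the argument. \<open>depth\<close> weights the
  nodes of an outer wire by their distance from the bottom. The orientation decides the order of the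
  heights at which a path enters and leaves such a wire, so each visit contributes a positive
  amount; this is why avoiding the wire cuts out a face. \<open>grade k\<close> is 1 on the paths
  that start on wire \<open>k\<close> and 0 on the others; hence the coefficients of a path vector
  over \<open>B\<close> sum to 1. In a good interval only one path for each \<open>k\<close> uses
  the removed wire, so the two functionals together leave no other vector from which it could be
  combined, and it must belong to \<open>B\<close>.

  Heights grow downwards. The only geometry is \<open>betw\<close>: the nodes of three wires come in
  one of the two orders given by the two reduced words of the longest permutation of three letters.
  Heights of unrelated nodes vary within a commutation class; \<open>dlast\<close> and
  \<open>alast\<close> compare nodes on a common wire, which is why 2-moves do not affect
  them.\<close>

locale arrangement =
  fixes h :: "nat \<Rightarrow> nat \<Rightarrow> nat" and M N :: nat
  assumes sym: "h a b = h b a"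
    and inj: "\<lbrakk>a \<in> {1..M}; b \<in> {1..M}; c \<in> {1..M}; d \<in> {1..M}; a \<noteq> b; c \<noteq> d; h a b = h c d\<rbrakk>
               \<Longrightarrow> {a, b} = {c, d}"
    and lt: "\<lbrakk>a \<in> {1..M}; b \<in> {1..M}; a \<noteq> b\<rbrakk> \<Longrightarrow> h a b < N"
    and betw: "\<lbrakk>1 \<le> a; a < b; b < c; c \<le> M\<rbrakk>
               \<Longrightarrow> h a b < h a c \<and> h a c < h b c \<or> h b c < h a c \<and> h a c < h a b"
begin

text \<open>Here \<open>a\<close> is the wire travelled and \<open>c\<close> the wire crossed. A
  forbidden \<open>c\<close> lies between \<open>k\<close> and \<open>a\<close>, hence in every
  interval that contains both; so \<open>walk\<close> may quantify over all wires without reference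
  to the interval.\<close>

definition forb :: "nat \<Rightarrow> nat \<Rightarrow> nat \<Rightarrow> bool" where
  "forb k a c \<longleftrightarrow> k < c \<and> c < a \<or> a < c \<and> c \<le> k"

text \<open>The start \<open>t\<close> is excluded and the end \<open>t'\<close> included, so that a
  switching node is counted only for the wire on which the path arrives. Visiting each node once
  then becomes disjointness of segments (\<open>nod\<close>).\<close>

definition seg :: "nat \<Rightarrow> nat \<Rightarrow> nat \<Rightarrow> nat \<Rightarrow> nat set" where
  "seg k a t t' = {h a c | c. c \<in> {1..M} \<and> c \<noteq> a \<and>
     (if a \<le> k then t' \<le> h a c \<and> h a c < t else t < h a c \<and> h a c \<le> t')}"

text \<open>A path is on wire \<open>a\<close>, has just left the node at height \<open>t\<close>, and then switches in turn to the
  wires in the list; the nodes that it passes straight are not recorded.\<close>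
fun walk :: "nat \<Rightarrow> nat \<Rightarrow> nat \<Rightarrow> nat list \<Rightarrow> bool" where
  "walk k a t [] \<longleftrightarrow> a = k + 1"
| "walk k a t (b # bs) \<longleftrightarrow> b \<in> {1..M} \<and> b \<noteq> a \<and> (if a \<le> k then h a b < t else t < h a b)
     \<and> (\<forall>c\<in>{1..M}. c \<noteq> a \<longrightarrow> h a c \<in> {min t (h a b)<..<max t (h a b)} \<longrightarrow> \<not> forb k a c)
     \<and> walk k b (h a b) bs"

text \<open>No wire has a node at height \<^term>\<open>N\<close> or below, so the last segment extends to \<^term>\<open>N\<close>.\<close>
fun vis :: "nat \<Rightarrow> nat \<Rightarrow> nat \<Rightarrow> nat list \<Rightarrow> nat set" where
  "vis k a t [] = seg k a t N"
| "vis k a t (b # bs) = seg k a t (h a b) \<union> vis k b (h a b) bs"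

fun nod :: "nat \<Rightarrow> nat \<Rightarrow> nat \<Rightarrow> nat list \<Rightarrow> bool" where
  "nod k a t [] \<longleftrightarrow> True"
| "nod k a t (b # bs) \<longleftrightarrow> seg k a t (h a b) \<inter> vis k b (h a b) bs = {} \<and> nod k b (h a b) bs"

text \<open>The string form sees only the switches, since a straight passage has coefficient 0. This
  is why walks need not record straight passages.\<close>

fun val :: "(nat \<Rightarrow> real) \<Rightarrow> nat \<Rightarrow> nat list \<Rightarrow> real" where
  "val x a [] = 0"
| "val x a (b # bs) = (if a < b then x (h a b) else - x (h a b)) + val x b bs"

definition GW :: "nat \<Rightarrow> nat \<Rightarrow> (nat \<times> nat list) set" where
  "GW lo hi = {(k, bs). lo \<le> k \<and> k < hi \<and> set bs \<subseteq> {lo..hi} \<and> walk k k N bs \<and> nod k k N bs}"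

text \<open>These say that \<open>ind\<^sub>D\<close>, respectively \<open>ind\<^sub>A\<close>, of the interval vanishes.\<close>
definition dlast :: "nat \<Rightarrow> nat \<Rightarrow> bool" where
  "dlast lo hi \<longleftrightarrow> (\<forall>a b. lo \<le> a \<and> a < b \<and> b < hi \<longrightarrow> h a b < h b hi)"

definition alast :: "nat \<Rightarrow> nat \<Rightarrow> bool" where
  "alast lo hi \<longleftrightarrow> (\<forall>b c. lo < b \<and> b < c \<and> c \<le> hi \<longrightarrow> h b c < h lo b)"

section \<open>Paths that use an outer wire whose nodes all come last\<close>

lemma dlast_less:
  assumes "dlast lo hi" "1 \<le> lo" "hi \<le> M" "lo \<le> a" "a < b" "b < hi"
  shows "h a b < h a hi" "h a hi < h b hi"
  using assms betw[of a b hi] unfolding dlast_def by force+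

lemma alast_less:
  assumes "alast lo hi" "1 \<le> lo" "hi \<le> M" "lo < b" "b < c" "c \<le> hi"
  shows "h b c < h lo c" "h lo c < h lo b"
  using assms betw[of lo b c] unfolding alast_def by force+

lemma dlast_lt:
  assumes "dlast lo hi" "1 \<le> lo" "hi \<le> M" "a \<in> {lo..<hi}" "b \<in> {lo..<hi}" "a \<noteq> b"
  shows "h a b < h b hi"
proof (cases "a < b")
  case True then show ?thesis using dlast_less[OF assms(1-3), of a b] assms by auto
next
  case False then show ?thesis using dlast_less[OF assms(1-3), of b a] sym[of a b] assms by auto
qed

text \<open>For \<open>a < b < hi\<close> the condition leaves only the order \<open>a b\<close>,
  \<open>a hi\<close>, \<open>b hi\<close> of the two allowed by \<open>betw\<close>. So a path
  running down \<open>hi\<close> meets larger and larger wires, which limits where it can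
  leave.\<close>

lemma dlast_mono:
  assumes "dlast lo hi" "1 \<le> lo" "hi \<le> M" "a \<in> {lo..<hi}" "b \<in> {lo..<hi}" "h a hi < h b hi"
  shows "a < b"
  using dlast_less(2)[OF assms(1-3), of b a] assms by (cases a b rule: linorder_cases) auto

lemma alast_lt:
  assumes "alast lo hi" "1 \<le> lo" "hi \<le> M" "b \<in> {lo<..hi}" "c \<in> {lo<..hi}" "b \<noteq> c"
  shows "h b c < h lo b"
proof (cases "b < c")
  case True then show ?thesis using alast_less[OF assms(1-3), of b c] assms by auto
next
  case False then show ?thesis using alast_less[OF assms(1-3), of c b] sym[of c b] assms by auto
qed

lemma alast_mono:
  assumes "alast lo hi" "1 \<le> lo" "hi \<le> M" "b \<in> {lo<..hi}" "c \<in> {lo<..hi}" "h lo b < h lo c"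
  shows "c < b"
  using alast_less(2)[OF assms(1-3), of b c] assms by (cases b c rule: linorder_cases) auto

lemma neq:
  assumes "a \<in> {1..M}" "b \<in> {1..M}" "c \<in> {1..M}" "a \<noteq> b" "a \<noteq> c" "b \<noteq> c"
  shows "h a b \<noteq> h a c"
  using inj[of a b a c] assms by (auto simp: doubleton_eq_iff)

text \<open>From above the node of \<open>a\<close> and \<open>hi\<close>, the wire
  \<open>hi\<close> can only be entered going down, so \<open>k < a\<close>. It would have to be
  left on a wire \<open>b'\<close> larger than \<open>a\<close>, which is not \<open>k + 1\<close>;
  and below \<open>hi\<close> such a wire has no node left in the interval. The path is
  stuck.\<close>

lemma dlast_walk_no_hi:
  assumes dl: "dlast lo hi" and lo: "1 \<le> lo" "hi \<le> M" and k: "lo \<le> k" "k < hi"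
  shows "walk k a t bs \<Longrightarrow> a \<in> {lo..<hi} \<Longrightarrow> set bs \<subseteq> {lo..hi} \<Longrightarrow> t < h a hi \<Longrightarrow> hi \<notin> set bs"
proof (induction bs arbitrary: a t)
  case (Cons b bs)
  show ?case
  proof (cases "b = hi")
    case True
    have ak: "k < a" using Cons True by (auto split: if_splits)
    have w: "walk k hi (h a hi) bs" using Cons True by auto
    have False
    proof (cases bs)
      case Nil then show False using w ak Cons.prems k by auto
    next
      case (Cons b' bs')
      have b': "b' \<in> {lo..hi}" "b' \<noteq> hi" "h a hi < h hi b'"
        using w Cons Cons.prems k by auto
      have ab': "a < b'" using dlast_mono[OF dl lo, of a b'] b' Cons.prems sym[of b' hi] by auto
      have w': "walk k b' (h hi b') bs'" using w Cons by auto
      show False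
      proof (cases bs')
        case Nil then show False using w' ak ab' by auto
      next
        case (Cons c cs)
        have c: "c \<in> {lo..hi}" "c \<noteq> b'" "h hi b' < h b' c"
          using w' Cons \<open>bs = b' # bs'\<close> Cons.prems ak ab' by auto
        have "c \<noteq> hi" using c sym[of hi b'] by auto
        then show False using dlast_lt[OF dl lo, of c b'] c b' sym[of b' c] sym[of hi b'] by auto
      qed
    qed
    then show ?thesis ..
  next
    case False
    have b: "b \<in> {lo..<hi}" "b \<noteq> a" using Cons.prems False by auto
    have "h a b < h b hi"
      using dlast_lt[OF dl lo, of a b] b Cons.prems by auto
    then have "hi \<notin> set bs" using Cons b by auto
    then show ?thesis using False by auto
  qed
qed auto

text \<open>Any other initial switch would bring the path above \<open>hi\<close>, from where it
  never gets there. On \<open>hi\<close> the downward wires come in increasing order, and passing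
  \<open>k + 1\<close> straight is forbidden unless the path leaves at \<open>k + 1\<close>. There
  it has to end, since below \<open>hi\<close> no node of the interval remains.\<close>

lemma dlast_class:
  assumes dl: "dlast lo hi" and lo: "1 \<le> lo" "hi \<le> M" and g: "(k, bs) \<in> GW lo hi" and u: "hi \<in> set bs"
  shows "bs = (if k + 1 = hi then [hi] else [hi, k + 1])"
proof -
  have k: "lo \<le> k" "k < hi" and s: "set bs \<subseteq> {lo..hi}" and w: "walk k k N bs"
    using g by (auto simp: GW_def)
  obtain b cs where bs: "bs = b # cs" using u by (cases bs) auto
  have bhi: "b = hi"
  proof (rule ccontr)
    assume "b \<noteq> hi"
    then have b: "b \<in> {lo..<hi}" "b \<noteq> k" using s w bs by auto
    have "h k b < h b hi"
      using dlast_lt[OF dl lo, of k b] b k by auto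
    then have "hi \<notin> set cs" using dlast_walk_no_hi[OF dl lo k, of b "h k b" cs] w s bs b by auto
    then show False using u bs \<open>b \<noteq> hi\<close> by auto
  qed
  have w1: "walk k hi (h k hi) cs" using w bs bhi by auto
  show ?thesis
  proof (cases cs)
    case Nil then show ?thesis using w1 bs bhi by auto
  next
    case (Cons b' bs')
    have b': "b' \<in> {lo..hi}" "b' \<noteq> hi" "h k hi < h hi b'"
      using w1 s bs Cons k by auto
    have kb': "k < b'" using dlast_mono[OF dl lo, of k b'] b' k sym[of b' hi] by auto
    have "b' = k + 1"
    proof (rule ccontr)
      assume ne: "b' \<noteq> k + 1"
      then have l: "k + 1 < b'" using kb' by auto
      have "h k hi < h (k+1) hi" "h (k+1) hi < h b' hi"
        using dlast_less[OF dl lo, of k "k+1"] dlast_less[OF dl lo, of "k+1" b'] k l b' by auto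
      then have "\<not> forb k hi (k+1)" using w1 Cons k l b' lo sym[of hi]
        by (auto simp: Ball_def)
      then show False using l b' unfolding forb_def by auto
    qed
    moreover have "bs' = []"
    proof (rule ccontr)
      assume "bs' \<noteq> []"
      then obtain c cs' where c0: "bs' = c # cs'" by (cases bs') auto
      have c: "c \<in> {lo..hi}" "c \<noteq> b'" "h hi b' < h b' c"
          using w1 c0 Cons s bs kb' by auto
      have "c \<noteq> hi" using c sym[of hi b'] by auto
      then show False using dlast_lt[OF dl lo, of c b'] c b' sym[of b' c] sym[of hi b'] by auto
    qed
    ultimately show ?thesis using bs bhi Cons b' by auto
  qed
qed

text \<open>Below its node with \<open>lo\<close> a downward wire meets no further wire of the
  interval.\<close>

lemma alast_walk_end:
  assumes al: "alast lo hi" and lo: "1 \<le> lo" "hi \<le> M" and b: "k < b" "b \<in> {lo<..hi}"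
    and w: "walk k b (h lo b) bs" and s: "set bs \<subseteq> {lo..hi}"
  shows "bs = []"
proof (cases bs)
  case (Cons c cs)
  have c: "c \<in> {lo..hi}" "c \<noteq> b" "h lo b < h b c" using w Cons s b by auto
  have "c \<noteq> lo" using c sym[of lo b] by auto
  then have False using c b alast_lt[OF al lo, of b c] by auto
  then show ?thesis ..
qed auto

text \<open>As for \<open>dlast_walk_no_hi\<close>: \<open>lo\<close> could only be entered from a
  downward wire \<open>a\<close>, and running up \<open>lo\<close> leads to wires larger than
  \<open>a\<close>. On such a wire no switch remains, although it is not
  \<open>k + 1\<close>.\<close>

lemma alast_walk_no_lo:
  assumes al: "alast lo hi" and lo: "1 \<le> lo" "hi \<le> M" and k: "lo < k" "k < hi"
  shows "walk k a t bs \<Longrightarrow> a \<in> {lo<..hi} \<Longrightarrow> set bs \<subseteq> {lo..hi} \<Longrightarrow> t < h lo a \<Longrightarrow> lo \<notin> set bs"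
proof (induction bs arbitrary: a t)
  case (Cons b bs)
  show ?case
  proof (cases "b = lo")
    case True
    have ak: "k < a" using Cons True sym[of lo a] by (auto split: if_splits)
    have w: "walk k lo (h a lo) bs" using Cons True by auto
    have False
    proof (cases bs)
      case Nil then show False using w ak Cons.prems k by auto
    next
      case (Cons b' bs')
      have b': "b' \<in> {lo..hi}" "b' \<noteq> lo" "h lo b' < h lo a"
        using w Cons Cons.prems k sym[of a lo] by auto
      have ab': "a < b'" using alast_mono[OF al lo, of b' a] b' Cons.prems by auto
      have w': "walk k b' (h lo b') bs'" using w Cons by auto
      have "bs' = []" using alast_walk_end[OF al lo _ _ w'] ak ab' b' Cons.prems Cons by auto
      then show False using w' ak ab' by auto
    qed
    then show ?thesis ..
  next
    case False
    have b: "b \<in> {lo<..hi}" "b \<noteq> a" using Cons.prems False by auto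
    have "h a b < h lo b"
      using alast_lt[OF al lo, of b a] b Cons.prems sym[of a b] by auto
    then have "lo \<notin> set bs" using Cons b by auto
    then show ?thesis using False by auto
  qed
qed auto

lemma alast_class:
  assumes al: "alast lo hi" and lo: "1 \<le> lo" "hi \<le> M" and g: "(k, bs) \<in> GW lo hi" and u: "lo = k \<or> lo \<in> set bs"
  shows "bs = (if k = lo then [k + 1] else [lo, k + 1])"
proof -
  have k: "lo \<le> k" "k < hi" and s: "set bs \<subseteq> {lo..hi}" and w: "walk k k N bs"
    using g by (auto simp: GW_def)
  obtain b cs where bs: "bs = b # cs" using w by (cases bs) auto
  have fin: "cs' = [] \<and> b' = k + 1" 
    if w': "walk k lo t (b' # cs')" and s': "set (b' # cs') \<subseteq> {lo..hi}" and kb: "k < b'" for t b' cs'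
  proof -
    have "cs' = []" using alast_walk_end[OF al lo kb] w' s' kb k by auto
    then show ?thesis using w' by auto
  qed
  show ?thesis
  proof (cases "k = lo")
    case True
    have "k < b" using w bs s True by auto
    then show ?thesis using fin[of N b cs] w bs s True by auto
  next
    case False
    have blo: "b = lo"
    proof (rule ccontr)
      assume "b \<noteq> lo"
      then have b: "b \<in> {lo<..hi}" "b \<noteq> k" using s w bs by auto
      have "h k b < h lo b"
        using alast_lt[OF al lo, of b k] b k False sym[of k b] by auto
      then have "lo \<notin> set cs" using alast_walk_no_lo[OF al lo _ k(2), of b "h k b" cs] w s bs b False k by auto
      then show False using u bs \<open>b \<noteq> lo\<close> False by auto
    qed
    have w1: "walk k lo (h k lo) cs" using w bs blo by auto
    then obtain b' bs' where cs: "cs = b' # bs'" using k by (cases cs) auto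
    have b': "b' \<in> {lo..hi}" "b' \<noteq> lo" "h lo b' < h lo k"
      using w1 s bs cs k sym[of k lo] by auto
    have "k < b'" using alast_mono[OF al lo, of b' k] b' k False by auto
    then show ?thesis using fin[of "h k lo" b' bs'] w1 cs s bs blo False by auto
  qed
qed

section \<open>Linear functionals evaluated on paths\<close>

lemma val_telescope:
  assumes x: "\<And>a b. 1 \<le> a \<Longrightarrow> a < b \<Longrightarrow> b \<le> M \<Longrightarrow> x (h a b) = g b - g a"
  shows "walk k a t bs \<Longrightarrow> a \<in> {1..M} \<Longrightarrow> val x a bs = g (k + 1) - g a"
proof (induction bs arbitrary: a t)
  case (Cons b bs)
  have "val x b bs = g (k + 1) - g b" using Cons by auto
  moreover have "(if a < b then x (h a b) else - x (h a b)) = g b - g a"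
    using x[of a b] x[of b a] sym[of a b] Cons.prems by auto
  ultimately show ?case by simp
qed auto

text \<open>A point supported on the nodes of wire \<open>p\<close>. The weight decreases with the
  height so that, for an outer wire, the gain of every visit exceeds the loss; \<open>depth\<close>
  thereby exposes the face of the paths avoiding \<open>p\<close>.\<close>

definition depth :: "nat \<Rightarrow> nat \<Rightarrow> nat \<Rightarrow> nat \<Rightarrow> real" where
  "depth lo hi p j = (if \<exists>a\<in>{lo..hi}. a \<noteq> p \<and> j = h a p then real N - real j else 0)"

lemma depth_h:
  assumes "1 \<le> lo" "hi \<le> M" "a \<in> {lo..hi}" "b \<in> {lo..hi}" "a \<noteq> b" "p \<in> {lo..hi}"
  shows "depth lo hi p (h a b) = (if a = p \<or> b = p then real N - real (h a b) else 0)"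
proof (cases "a = p \<or> b = p")
  case True
  then show ?thesis using assms sym[of a b] by (auto simp: depth_def)
next
  case False
  have "\<not> (\<exists>c\<in>{lo..hi}. c \<noteq> p \<and> h a b = h c p)"
  proof
    assume "\<exists>c\<in>{lo..hi}. c \<noteq> p \<and> h a b = h c p"
    then obtain c where "c \<in> {lo..hi}" "c \<noteq> p" "h a b = h c p" by auto
    then have "{a, b} = {c, p}" using assms by (intro inj) auto
    then show False using False by auto
  qed
  then have "depth lo hi p (h a b) = 0" unfolding depth_def by (simp only: if_False)
  then show ?thesis using False by simp
qed

text \<open>Entering \<open>hi\<close> at height \<open>s\<close> gains \<open>N - s\<close>;
  leaving it further down, at \<open>s'\<close>, loses the smaller amount \<open>N - s'\<close>. The
  induction therefore keeps, for a path that is on \<open>hi\<close> since height \<open>t\<close>,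
  the bound that less than \<open>N - t\<close> will still be lost.\<close>

lemma val_depth_hi:
  assumes lo: "1 \<le> lo" "hi \<le> M" and k: "lo \<le> k" "k < hi"
  shows "walk k a t bs \<Longrightarrow> a \<in> {lo..hi} \<Longrightarrow> set bs \<subseteq> {lo..hi} \<Longrightarrow> t \<le> N \<Longrightarrow>
    (if a = hi then t < N \<longrightarrow> val (depth lo hi hi) a bs > real t - real N
     else val (depth lo hi hi) a bs \<ge> 0 \<and> (hi \<in> set bs \<longrightarrow> val (depth lo hi hi) a bs > 0))"
proof (induction bs arbitrary: a t)
  case (Cons b bs)
  have b: "b \<in> {lo..hi}" "b \<noteq> a" using Cons.prems by auto
  have hN: "h a b < N" using lt[of a b] b Cons.prems lo by auto
  have IH: "if b = hi then val (depth lo hi hi) b bs > real (h a b) - real N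
     else val (depth lo hi hi) b bs \<ge> 0 \<and> (hi \<in> set bs \<longrightarrow> val (depth lo hi hi) b bs > 0)"
    using Cons.IH[of b "h a b"] Cons.prems b hN by (auto split: if_splits)
  have d: "depth lo hi hi (h a b) = (if a = hi \<or> b = hi then real N - real (h a b) else 0)"
    using depth_h[OF lo, of a b hi] b Cons.prems k by auto
  show ?case
  proof (cases "a = hi")
    case True
    then have "t < h a b" "b < a" using Cons.prems k b by auto
    then show ?thesis using IH d True b by auto
  next
    case False
    then show ?thesis using IH d b Cons.prems by auto
  qed
qed auto

text \<open>On \<open>lo\<close> the path moves up, so the gain at leaving exceeds the loss at
  entering. It must leave, because \<open>lo\<close> is not \<open>k + 1\<close>.\<close>

lemma val_depth_lo:
  assumes lo: "1 \<le> lo" "hi \<le> M" and k: "lo \<le> k" "k < hi"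
  shows "walk k a t bs \<Longrightarrow> a \<in> {lo..hi} \<Longrightarrow> set bs \<subseteq> {lo..hi} \<Longrightarrow> t \<le> N \<Longrightarrow>
    (if a = lo then val (depth lo hi lo) a bs > real N - real t
     else val (depth lo hi lo) a bs \<ge> 0 \<and> (lo \<in> set bs \<longrightarrow> val (depth lo hi lo) a bs > 0))"
proof (induction bs arbitrary: a t)
  case Nil
  then show ?case using k by auto
next
  case (Cons b bs)
  have b: "b \<in> {lo..hi}" "b \<noteq> a" using Cons.prems by auto
  have hN: "h a b < N" using lt[of a b] b Cons.prems lo by auto
  have IH: "if b = lo then val (depth lo hi lo) b bs > real N - real (h a b)
     else val (depth lo hi lo) b bs \<ge> 0 \<and> (lo \<in> set bs \<longrightarrow> val (depth lo hi lo) b bs > 0)"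
    using Cons.IH[of b "h a b"] Cons.prems b hN by (auto split: if_splits)
  have d: "depth lo hi lo (h a b) = (if a = lo \<or> b = lo then real N - real (h a b) else 0)"
    using depth_h[OF lo, of a b lo] b Cons.prems k by auto
  show ?case
  proof (cases "a = lo")
    case True
    then have "h a b < t" "a < b" using Cons.prems k b by auto
    then show ?thesis using IH d True b by auto
  next
    case False
    then show ?thesis using IH d b Cons.prems by auto
  qed
qed

definition rng :: "nat \<Rightarrow> nat \<Rightarrow> nat \<Rightarrow> nat \<Rightarrow> nat \<Rightarrow> bool" where
  "rng k a t t' s \<longleftrightarrow> (if a \<le> k then t' \<le> s \<and> s < t else t < s \<and> s \<le> t')"

text \<open>Two wires share only one node, so disjointness of their segments is decided at the
  height of that node.\<close>

lemma seg_disjoint: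
  assumes "a \<in> {1..M}" "a' \<in> {1..M}" "a \<noteq> a'" "\<not> (rng k a t t' (h a a') \<and> rng k a' u u' (h a a'))"
  shows "seg k a t t' \<inter> seg k a' u u' = {}"
proof (rule ccontr)
  assume "seg k a t t' \<inter> seg k a' u u' \<noteq> {}"
  then obtain s where "s \<in> seg k a t t'" "s \<in> seg k a' u u'" by auto
  then obtain c d where c: "c \<in> {1..M}" "c \<noteq> a" "rng k a t t' (h a c)" "d \<in> {1..M}" "d \<noteq> a'"
    "rng k a' u u' (h a' d)" "h a c = h a' d"
    unfolding seg_def rng_def[symmetric] by blast
  have "{a, c} = {a', d}" using assms c by (intro inj) auto
  then have "c = a'" using assms(3) by (auto simp: doubleton_eq_iff)
  then show False using c assms(4) by auto
qed

text \<open>With \<open>dlast_class\<close> this gives exactly one path through \<open>hi\<close>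
  for each \<open>k\<close>.\<close>

lemma dlast_path:
  assumes dl: "dlast lo hi" and lo: "1 \<le> lo" "hi \<le> M" and k: "lo \<le> k" "k < hi"
  shows "(k, if k + 1 = hi then [hi] else [hi, k + 1]) \<in> GW lo hi"
proof (cases "k + 1 = hi")
  case True
  have "seg k k N (h k hi) \<inter> seg k hi (h k hi) N = {}"
    using k lo by (intro seg_disjoint) (auto simp: rng_def)
  then show ?thesis using True k lo lt[of k hi] by (auto simp: GW_def forb_def)
next
  case False
  then have l: "k + 1 < hi" using k by auto
  have h1: "h k (k+1) < h k hi" "h k hi < h (k+1) hi" using dlast_less[OF dl lo, of k "k+1"] k l by auto
  have h2: "h (k+1) hi < h c hi" if "k + 1 < c" "c < hi" for c
    using dlast_less[OF dl lo, of "k+1" c] k that by auto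
  \<comment> \<open>Between its nodes with \<open>k\<close> and \<open>k + 1\<close> the wire
    \<open>hi\<close> meets only wires that are not in between: those larger than
    \<open>k + 1\<close> come later.\<close>
  have nf: "\<not> forb k hi c" if "c \<in> {1..M}" "c \<noteq> hi"
    "min (h k hi) (h hi (k+1)) < h hi c" "h hi c < max (h k hi) (h hi (k+1))" for c
  proof
    assume "forb k hi c"
    then have c: "k < c" "c < hi" using k by (auto simp: forb_def)
    then show False using h1 h2[of c] that sym[of hi "k+1"] sym[of hi c]
      by (cases "c = k + 1") auto
  qed
  have "seg k k N (h k hi) \<inter> seg k hi (h k hi) (h hi (k+1)) = {}"
    using k lo by (intro seg_disjoint) (auto simp: rng_def)
  moreover have "seg k k N (h k hi) \<inter> seg k (k+1) (h hi (k+1)) N = {}"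
    using k l lo h1 by (intro seg_disjoint) (auto simp: rng_def)
  moreover have "seg k hi (h k hi) (h hi (k+1)) \<inter> seg k (k+1) (h hi (k+1)) N = {}"
    using k l lo h1 by (intro seg_disjoint) (auto simp: rng_def)
  ultimately have "nod k k N [hi, k+1]" by auto
  moreover have "walk k k N [hi, k + 1]"
    using k lo l lt[of k hi] h1 nf sym[of hi "k+1"] by (auto simp: forb_def[of k k])
  ultimately show ?thesis using False k by (auto simp: GW_def)
qed

lemma alast_path:
  assumes al: "alast lo hi" and lo: "1 \<le> lo" "hi \<le> M" and k: "lo \<le> k" "k < hi"
  shows "(k, if k = lo then [k + 1] else [lo, k + 1]) \<in> GW lo hi"
proof (cases "k = lo")
  case True
  have "seg k k N (h k (k+1)) \<inter> seg k (k+1) (h k (k+1)) N = {}"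
    using k lo by (intro seg_disjoint) (auto simp: rng_def)
  then show ?thesis using True k lo lt[of k "k+1"] by (auto simp: GW_def forb_def)
next
  case False
  then have l: "lo < k" using k by auto
  have h1: "h k (k+1) < h lo (k+1)" "h lo (k+1) < h lo k" using alast_less[OF al lo, of k "k+1"] k l by auto
  have h2: "h lo k < h lo c" if "lo < c" "c < k" for c
    using alast_less[OF al lo, of c k] k that by auto
  have nf: "\<not> forb k lo c" if "c \<in> {1..M}" "c \<noteq> lo"
    "min (h k lo) (h lo (k+1)) < h lo c" "h lo c < max (h k lo) (h lo (k+1))" for c
  proof
    assume "forb k lo c"
    then have c: "lo < c" "c \<le> k" using k by (auto simp: forb_def)
    then show False using h1 h2[of c] that sym[of lo k]
      by (cases "c = k") auto
  qed
  have "seg k k N (h k lo) \<inter> seg k lo (h k lo) (h lo (k+1)) = {}"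
    using k l lo sym[of lo k] by (intro seg_disjoint) (auto simp: rng_def)
  moreover have "seg k k N (h k lo) \<inter> seg k (k+1) (h lo (k+1)) N = {}"
    using k l lo h1 sym[of lo k] by (intro seg_disjoint) (auto simp: rng_def)
  moreover have "seg k lo (h k lo) (h lo (k+1)) \<inter> seg k (k+1) (h lo (k+1)) N = {}"
    using k l lo h1 by (intro seg_disjoint) (auto simp: rng_def)
  ultimately have "nod k k N [lo, k+1]" by auto
  moreover have "walk k k N [lo, k + 1]"
    using k lo l lt[of k lo] h1 nf sym[of lo k] by (auto simp: forb_def[of k k])
  ultimately show ?thesis using False k by (auto simp: GW_def)
qed

section \<open>Greedy paths through the node of the two outer wires\<close>

lemma vis_subset: "vis k c t bs \<subseteq> {h c' y | c' y. c' \<in> set (c # bs) \<and> y \<in> {1..M} \<and> y \<noteq> c'}"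
  by (induction bs arbitrary: c t) (fastforce simp: seg_def)+

text \<open>Going down, always turn to the smaller of two wires directed downward.\<close>
lemma down_ext:
  assumes k: "1 \<le> lo" "lo \<le> k" "k < hi" "hi \<le> M"
  shows "c \<in> {k<..hi} \<Longrightarrow> c = k + 1 \<or> t < h c (k + 1) \<Longrightarrow>
    \<exists>bs. walk k c t bs \<and> set bs \<subseteq> {k<..hi} \<and> nod k c t bs \<and> vis k c t bs \<subseteq> {t<..}
      \<and> (\<forall>a t0. 1 \<le> a \<and> a \<le> k \<and> h a c \<le> t0 \<and> t0 \<le> t \<longrightarrow> (\<forall>c'\<in>set bs. h a c' \<le> t0))
      \<and> (\<forall>x. (\<forall>a\<in>{lo..hi}. \<forall>b\<in>{lo..hi}. a \<noteq> b \<longrightarrow> t < h a b \<longrightarrow> x (h a b) = 0) \<longrightarrow> val x c bs = 0)"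
proof (induction "N - t" arbitrary: c t rule: less_induct)
  case less
  show ?case
  proof (cases "\<exists>c'. k < c' \<and> c' < c \<and> t < h c c'")
    case False
    then have "c = k + 1" using less.prems by (metis Suc_eq_plus1 Suc_lessI greaterThanAtMost_iff less_add_one)
    then show ?thesis by (intro exI[of _ "[]"]) (auto simp: seg_def)
  next
    case True
    then obtain c' where c': "k < c'" "c' < c" "t < h c c'"
      and mi: "\<And>d. k < d \<Longrightarrow> d < c \<Longrightarrow> t < h c d \<Longrightarrow> h c c' \<le> h c d"
      using ex_has_least_nat[of "\<lambda>c'. k < c' \<and> c' < c \<and> t < h c c'" _ "h c"] by metis
    have W: "c \<in> {1..M}" "c' \<in> {1..M}" using c' less.prems k by auto
    have tN: "h c c' < N" using lt[of c c'] W c' by auto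
    \<comment> \<open>The new wire is \<open>k + 1\<close> or has not met \<open>k + 1\<close> yet,
      so the descent cannot miss its target.\<close>
    have inv: "c' = k + 1 \<or> h c c' < h c' (k + 1)"
    proof (cases "c' = k + 1")
      case False
      then have l: "k + 1 < c'" using c' by auto
      then have "t < h c (k+1)" using less.prems c' by auto
      then have "h c c' \<le> h c (k+1)" using mi[of "k+1"] l c' by auto
      then show ?thesis using betw[of "k+1" c' c] l c' W sym[of c "k+1"] sym[of c c'] sym[of c' "k+1"]
        by auto
    qed simp
    have m: "N - h c c' < N - t" using tN c' by auto
    have cc: "c' \<in> {k<..hi}" using c' less.prems by auto
    obtain bs where bs: "walk k c' (h c c') bs" "set bs \<subseteq> {k<..hi}" "nod k c' (h c c') bs"
      "vis k c' (h c c') bs \<subseteq> {h c c'<..}"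
      "\<forall>a t0. 1 \<le> a \<and> a \<le> k \<and> h a c' \<le> t0 \<and> t0 \<le> h c c' \<longrightarrow> (\<forall>c''\<in>set bs. h a c'' \<le> t0)"
      "\<forall>x. (\<forall>a\<in>{lo..hi}. \<forall>b\<in>{lo..hi}. a \<noteq> b \<longrightarrow> h c c' < h a b \<longrightarrow> x (h a b) = 0) \<longrightarrow> val x c' bs = 0"
      using less.hyps[OF m cc inv] by blast
    have nf: "\<not> forb k c d" if "t < h c d" "h c d < h c c'" for d
      using mi[of d] that less.prems by (auto simp: forb_def)
    have w: "walk k c t (c' # bs)"
      using bs(1) c' W less.prems(1) nf by auto
    have s: "seg k c t (h c c') \<subseteq> {t<..h c c'}" using c' by (auto simp: seg_def)
    then have "seg k c t (h c c') \<inter> vis k c' (h c c') bs = {}" using bs(4) by fastforce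
    then have n: "nod k c t (c' # bs)" using bs(3) by simp
    have v: "vis k c t (c' # bs) \<subseteq> {t<..}" using bs(4) s c'(3) by fastforce
    \<comment> \<open>An upward wire \<open>a\<close> that has crossed \<open>c\<close> above the
      turning point has, by \<open>betw\<close>, also crossed \<open>c'\<close> above it. This is
      what keeps the upward half of the final path away from the downward half.\<close>
    have q: "\<forall>d\<in>set (c' # bs). h a d \<le> t0" if a: "1 \<le> a" "a \<le> k" "h a c \<le> t0" "t0 \<le> t" for a t0
    proof -
      have "h a c' \<le> t0" using betw[of a c' c] a c' W sym[of c c'] by auto
      then show ?thesis using bs(5)[rule_format, of a t0] a c' by auto
    qed
    have x: "val x c (c' # bs) = 0"
      if "\<forall>a\<in>{lo..hi}. \<forall>b\<in>{lo..hi}. a \<noteq> b \<longrightarrow> t < h a b \<longrightarrow> x (h a b) = 0" for x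
    proof -
      have "x (h c c') = 0" using that c' k less.prems by auto
      moreover have "val x c' bs = 0" using bs(6)[rule_format, of x] that c' by auto
      ultimately show ?thesis by simp
    qed
    have "set (c' # bs) \<subseteq> {k<..hi}" using bs(2) cc by simp
    with w n v q x show ?thesis by (intro exI[of _ "c' # bs"]) blast
  qed
qed

text \<open>Prolongs a path backwards, always coming from the larger of two wires directed upward.\<close>
lemma up_ext:
  assumes k: "1 \<le> lo" "lo \<le> k" "k < hi" "hi \<le> M"
    and Vd: "Vd \<subseteq> {s. t0 < s \<and> (\<exists>c\<in>Dw. \<exists>y\<in>{1..M}. y \<noteq> c \<and> s = h c y)}" and Dw: "Dw \<subseteq> {k<..hi}"
  shows "a \<in> {lo..k} \<Longrightarrow> b \<noteq> a \<Longrightarrow> set (b # bs) \<subseteq> {lo..hi} \<Longrightarrow> a = k \<or> h a b < h a k \<Longrightarrow>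
    walk k b (h a b) bs \<Longrightarrow> nod k b (h a b) bs \<Longrightarrow> vis k b (h a b) bs \<subseteq> {..<h a b} \<union> Vd \<Longrightarrow>
    \<forall>c\<in>Dw. h a c \<le> t0 \<Longrightarrow> t0 \<le> h a b \<Longrightarrow>
    \<exists>cs. (k, cs) \<in> GW lo hi \<and> (\<forall>x. (\<forall>c\<in>{lo..hi}. \<forall>d\<in>{lo..hi}. c \<noteq> d \<longrightarrow> h a b < h c d \<longrightarrow> x (h c d) = 0)
       \<longrightarrow> val x k cs = val x a (b # bs))"
proof (induction "N - h a b" arbitrary: a b bs rule: less_induct)
  case less
  have W: "a \<in> {1..M}" "b \<in> {1..M}" using less.prems k by auto
  have tN: "h a b < N" using lt W less.prems by auto
  \<comment> \<open>A node shared with the downward half would be the node of \<open>a\<close> with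
    some wire of \<open>Dw\<close>. By assumption these have height at most \<open>t0\<close>,
    whereas all of \<open>Vd\<close> lies strictly below.\<close>
  have disj: "seg k a t (h a b) \<inter> vis k b (h a b) bs = {}" for t
  proof -
    have "s \<notin> Vd" if "s \<in> seg k a t (h a b)" for s
    proof
      assume "s \<in> Vd"
      then obtain c y where c: "c \<in> Dw" "y \<in> {1..M}" "y \<noteq> c" "s = h c y" "t0 < s" using Vd by auto
      obtain z where z: "z \<in> {1..M}" "z \<noteq> a" "s = h a z" using \<open>s \<in> seg k a t (h a b)\<close> unfolding seg_def by auto
      have cW: "c \<in> {1..M}" "c \<noteq> a" using c Dw k less.prems by auto
      have "{c, y} = {a, z}" using c z cW W by (intro inj) auto
      then have "y = a" using cW by (auto simp: doubleton_eq_iff)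
      then show False using less.prems c sym[of a c] by auto
    qed
    moreover have "s \<ge> h a b" if "s \<in> seg k a t (h a b)" for s
      using that less.prems by (auto simp: seg_def)
    ultimately show ?thesis using less.prems by fastforce
  qed
  show ?case
  proof (cases "\<exists>a'. a < a' \<and> a' \<le> k \<and> h a b < h a a'")
    case False
    then have ak: "a = k" using less.prems by force
    have "walk k k N (b # bs)" using less.prems ak W tN by (auto simp: forb_def)
    then have "(k, b # bs) \<in> GW lo hi" using less.prems ak k disj[of N] by (auto simp: GW_def)
    then show ?thesis using ak by auto
  next
    case True
    then obtain a' where a': "a < a'" "a' \<le> k" "h a b < h a a'"
      and mi: "\<And>d. a < d \<Longrightarrow> d \<le> k \<Longrightarrow> h a b < h a d \<Longrightarrow> h a a' \<le> h a d"
      using ex_has_least_nat[of "\<lambda>a'. a < a' \<and> a' \<le> k \<and> h a b < h a a'" _ "h a"] by metis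
    have W': "a' \<in> {1..M}" using a' k by auto
    have TN: "h a a' < N" using lt[of a a'] W W' a' by auto
    have inv: "a' = k \<or> h a a' < h a' k"
    proof (cases "a' = k")
      case False
      then have l: "a' < k" using a' by auto
      then have "h a b < h a k" using less.prems a' by auto
      then have "h a a' \<le> h a k" using mi[of k] l a' by auto
      then show ?thesis using betw[of a a' k] l a' W k by auto
    qed simp
    have w: "walk k a (h a' a) (b # bs)"
    proof -
      have nf: "\<not> forb k a d" if "h a b < h a d" "h a d < h a a'" for d
        using mi[of d] that less.prems(1) by (auto simp: forb_def)
      then show ?thesis using less.prems(1,2,5) W a' sym[of a' a] by auto
    qed
    have n: "nod k a (h a' a) (b # bs)" using less.prems(6) disj by simp
    have v: "vis k a (h a' a) (b # bs) \<subseteq> {..<h a' a} \<union> Vd"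
    proof -
      have "seg k a (h a' a) (h a b) \<subseteq> {..<h a' a}" using less.prems(1) by (auto simp: seg_def)
      then show ?thesis using less.prems(7) a'(3) sym[of a' a] by fastforce
    qed
    have Q: "\<forall>c\<in>Dw. h a' c \<le> t0"
    proof
      fix c assume "c \<in> Dw"
      then have c: "k < c" "c \<le> M" "h a c \<le> t0" using Dw k less.prems by auto
      then show "h a' c \<le> t0" using betw[of a a' c] a' less.prems W by auto
    qed
    have "\<exists>cs. (k, cs) \<in> GW lo hi \<and> (\<forall>x. (\<forall>c\<in>{lo..hi}. \<forall>d\<in>{lo..hi}. c \<noteq> d \<longrightarrow> h a' a < h c d \<longrightarrow> x (h c d) = 0)
       \<longrightarrow> val x k cs = val x a' (a # b # bs))"
      by (rule less.hyps) (use less.prems a' TN tN sym[of a' a] inv w n v Q k in auto)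
    then obtain cs where cs: "(k, cs) \<in> GW lo hi"
      "\<And>x. (\<forall>c\<in>{lo..hi}. \<forall>d\<in>{lo..hi}. c \<noteq> d \<longrightarrow> h a' a < h c d \<longrightarrow> x (h c d) = 0)
       \<Longrightarrow> val x k cs = val x a' (a # b # bs)" by blast
    have "val x k cs = val x a (b # bs)"
      if x: "\<forall>c\<in>{lo..hi}. \<forall>d\<in>{lo..hi}. c \<noteq> d \<longrightarrow> h a b < h c d \<longrightarrow> x (h c d) = 0" for x
    proof -
      have "x (h a' a) = 0" using x a' k less.prems sym[of a' a] by auto
      then show ?thesis using cs(2)[of x] x a' sym[of a' a] by fastforce
    qed
    then show ?thesis using cs(1) by blast
  qed
qed

text \<open>The two greedy extensions are joined by the switch from \<open>lo\<close> to
  \<open>hi\<close>. It remains to find a \<open>k\<close> from which the upward half can start and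
  at whose neighbour the downward half can end.\<close>

lemma path_through_outer_node:
  assumes lo: "1 \<le> lo" "lo < hi" "hi \<le> M"
  obtains k bs where "(k, bs) \<in> GW lo hi"
    "\<And>x. (\<And>a b. a \<in> {lo..hi} \<Longrightarrow> b \<in> {lo..hi} \<Longrightarrow> a \<noteq> b \<Longrightarrow> {a, b} \<noteq> {lo, hi} \<Longrightarrow> x (h a b) = 0)
       \<Longrightarrow> val x k bs = x (h lo hi)"
proof -
  \<comment> \<open>The largest \<open>k\<close> that \<open>lo\<close> meets below
    \<open>hi\<close>, or \<open>lo\<close> itself. By maximality \<open>lo\<close> meets
    \<open>k + 1\<close> above \<open>hi\<close>, and then \<open>betw\<close> puts the node of
    \<open>hi\<close> and \<open>k + 1\<close> below the node of \<open>lo\<close> and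
    \<open>hi\<close>, as the descent requires.\<close>
  define S where "S = {k\<in>{lo..<hi}. k = lo \<or> h lo hi < h lo k}"
  define k where "k = Max S"
  have fS: "finite S" "lo \<in> S" using lo by (auto simp: S_def)
  then have kS: "k \<in> S" unfolding k_def using Max_in by blast
  then have k: "lo \<le> k" "k < hi" "k = lo \<or> h lo hi < h lo k" by (auto simp: S_def)
  have k1: "k + 1 = hi \<or> h lo hi < h hi (k+1)"
  proof (rule ccontr)
    assume a: "\<not> ?thesis"
    then have "h lo hi < h lo (k+1)" using betw[of lo "k+1" hi] k lo sym[of hi "k+1"] by auto
    then have "k + 1 \<in> S" using a k by (auto simp: S_def)
    then show False using fS unfolding k_def by (metis Max_ge Suc_eq_plus1 Suc_n_not_le_n)
  qed
  have kk: "1 \<le> lo" "lo \<le> k" "k < hi" "hi \<le> M" using k lo by auto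
  obtain bs where bs: "walk k hi (h lo hi) bs" "set bs \<subseteq> {k<..hi}" "nod k hi (h lo hi) bs"
    "vis k hi (h lo hi) bs \<subseteq> {h lo hi<..}" "\<forall>c'\<in>set bs. h lo c' \<le> h lo hi"
    "\<And>x. (\<forall>a\<in>{lo..hi}. \<forall>b\<in>{lo..hi}. a \<noteq> b \<longrightarrow> h lo hi < h a b \<longrightarrow> x (h a b) = 0) \<Longrightarrow> val x hi bs = 0"
    using down_ext[OF kk, of hi "h lo hi"] k k1 lo by (auto 0 4)
  define Vd where "Vd = vis k hi (h lo hi) bs"
  have Vd: "Vd \<subseteq> {s. h lo hi < s \<and> (\<exists>c\<in>set (hi # bs). \<exists>y\<in>{1..M}. y \<noteq> c \<and> s = h c y)}"
    using bs(4) vis_subset[of k hi "h lo hi" bs] unfolding Vd_def by fast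
  have Dw: "set (hi # bs) \<subseteq> {k<..hi}" using bs k by auto
  have "\<exists>cs. (k, cs) \<in> GW lo hi \<and> (\<forall>x. (\<forall>c\<in>{lo..hi}. \<forall>d\<in>{lo..hi}. c \<noteq> d \<longrightarrow> h lo hi < h c d \<longrightarrow> x (h c d) = 0)
       \<longrightarrow> val x k cs = val x lo (hi # bs))"
    using up_ext[OF kk Vd Dw, of lo hi bs] bs k lo unfolding Vd_def[symmetric] by fastforce
  then obtain cs where cs: "(k, cs) \<in> GW lo hi"
    "\<And>x. (\<forall>c\<in>{lo..hi}. \<forall>d\<in>{lo..hi}. c \<noteq> d \<longrightarrow> h lo hi < h c d \<longrightarrow> x (h c d) = 0)
       \<Longrightarrow> val x k cs = val x lo (hi # bs)" by blast
  have "val x k cs = x (h lo hi)" 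
    if x: "\<And>a b. a \<in> {lo..hi} \<Longrightarrow> b \<in> {lo..hi} \<Longrightarrow> a \<noteq> b \<Longrightarrow> {a, b} \<noteq> {lo, hi} \<Longrightarrow> x (h a b) = 0" for x
  proof -
    have z: "\<forall>c\<in>{lo..hi}. \<forall>d\<in>{lo..hi}. c \<noteq> d \<longrightarrow> h lo hi < h c d \<longrightarrow> x (h c d) = 0"
    proof (intro ballI impI)
      fix c d assume c: "c \<in> {lo..hi}" "d \<in> {lo..hi}" "c \<noteq> d" "h lo hi < h c d"
      then have "{c, d} \<noteq> {lo, hi}" using sym[of lo hi] by (auto simp: doubleton_eq_iff)
      then show "x (h c d) = 0" using x c by auto
    qed
    show ?thesis using cs(2)[OF z] bs(6)[OF z] lo by simp
  qed
  then show ?thesis using that cs(1) by blast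
qed

section \<open>Explicit paths with two or three switches\<close>

lemma GW_intro3:
  assumes W: "1 \<le> lo" "hi \<le> M" and k: "lo \<le> k" "k < hi" and ab: "{a, b} \<subseteq> {lo..hi}"
    and d: "distinct [k, a, b, k + 1]"
    and up: "if a \<le> k then h a b < h k a else h k a < h a b"
      "if b \<le> k then h b (k + 1) < h a b else h a b < h b (k + 1)"
    and f: "\<And>c. c \<in> {1..M} \<Longrightarrow> c \<noteq> a \<Longrightarrow> min (h k a) (h a b) < h a c \<Longrightarrow> h a c < max (h k a) (h a b) \<Longrightarrow> \<not> forb k a c"
      "\<And>c. c \<in> {1..M} \<Longrightarrow> c \<noteq> b \<Longrightarrow> min (h a b) (h b (k+1)) < h b c \<Longrightarrow> h b c < max (h a b) (h b (k+1)) \<Longrightarrow> \<not> forb k b c"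
    and n: "\<not> (rng k k N (h k a) (h k b) \<and> rng k b (h a b) (h b (k+1)) (h k b))"
      "\<not> (rng k k N (h k a) (h k (k+1)) \<and> rng k (k+1) (h b (k+1)) N (h k (k+1)))"
      "\<not> (rng k a (h k a) (h a b) (h a (k+1)) \<and> rng k (k+1) (h b (k+1)) N (h a (k+1)))"
  shows "(k, [a, b, k + 1]) \<in> GW lo hi"
proof -
  have V: "k \<in> {1..M}" "a \<in> {1..M}" "b \<in> {1..M}" "k + 1 \<in> {1..M}" using W k ab by auto
  \<comment> \<open>Consecutive segments can only share the switching node, which the later one
    excludes. The three remaining pairs of segments are the hypotheses \<open>n\<close>.\<close>
  have r: "\<not> rng k x t t' t" for x t t' by (auto simp: rng_def)
  have "seg k k N (h k a) \<inter> seg k a (h k a) (h a b) = {}"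
    "seg k a (h k a) (h a b) \<inter> seg k b (h a b) (h b (k+1)) = {}"
    "seg k b (h a b) (h b (k+1)) \<inter> seg k (k+1) (h b (k+1)) N = {}"
    "seg k k N (h k a) \<inter> seg k b (h a b) (h b (k+1)) = {}"
    "seg k k N (h k a) \<inter> seg k (k+1) (h b (k+1)) N = {}"
    "seg k a (h k a) (h a b) \<inter> seg k (k+1) (h b (k+1)) N = {}"
    using V d n by (intro seg_disjoint; simp add: r)+
  then have nod: "nod k k N [a, b, k+1]" by auto
  have "walk k (k+1) (h b (k+1)) []" by simp
  moreover have "h k a < N" using lt[of k a] V d by auto
  ultimately have "walk k k N [a, b, k+1]"
    using V d up f by (auto simp: forb_def[of k k])
  then show ?thesis using nod k ab by (auto simp: GW_def)
qed

lemma GW_intro2: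
  assumes W: "1 \<le> lo" "hi \<le> M" and k: "lo \<le> k" "k < hi" and ab: "a \<in> {lo..hi}"
    and d: "distinct [k, a, k + 1]"
    and up: "if a \<le> k then h a (k + 1) < h k a else h k a < h a (k + 1)"
    and f: "\<And>c. c \<in> {1..M} \<Longrightarrow> c \<noteq> a \<Longrightarrow> min (h k a) (h a (k+1)) < h a c \<Longrightarrow> h a c < max (h k a) (h a (k+1)) \<Longrightarrow> \<not> forb k a c"
    and n: "\<not> (rng k k N (h k a) (h k (k+1)) \<and> rng k (k+1) (h a (k+1)) N (h k (k+1)))"
  shows "(k, [a, k + 1]) \<in> GW lo hi"
proof -
  have V: "k \<in> {1..M}" "a \<in> {1..M}" "k + 1 \<in> {1..M}" using W k ab by auto
  have r: "\<not> rng k x t t' t" for x t t' by (auto simp: rng_def)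
  have "seg k k N (h k a) \<inter> seg k a (h k a) (h a (k+1)) = {}"
    "seg k a (h k a) (h a (k+1)) \<inter> seg k (k+1) (h a (k+1)) N = {}"
    "seg k k N (h k a) \<inter> seg k (k+1) (h a (k+1)) N = {}"
    using V d n by (intro seg_disjoint; simp add: r)+
  then have nod: "nod k k N [a, k+1]" by auto
  have "walk k (k+1) (h a (k+1)) []" by simp
  moreover have "h k a < N" using lt[of k a] V d by auto
  ultimately have "walk k k N [a, k+1]"
    using V d up f by (auto simp: forb_def[of k k])
  then show ?thesis using nod k ab by (auto simp: GW_def)
qed

text \<open>This path and that of \<open>path_P4\<close> pass the node of \<open>lo\<close> and
  \<open>hi\<close> in opposite directions, so that it cancels in the sum of their vectors.\<close>

lemma path_P2:
  assumes W: "1 \<le> lo" "hi \<le> M" and m: "lo < m" "m + 1 < hi"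
    and o: "h lo hi < h lo m" "h lo hi < h (m+1) hi"
    and lw: "\<And>c. lo < c \<Longrightarrow> c < m \<Longrightarrow> h lo m < h lo c"
    and hw: "\<And>c. m + 1 < c \<Longrightarrow> c < hi \<Longrightarrow> h (m+1) hi < h c hi"
  shows "(m, [lo, hi, m + 1]) \<in> GW lo hi"
proof (rule GW_intro3[OF W])
  note s = sym[of m lo] sym[of hi "m+1"]
  show "\<not> forb m lo c" if "c \<in> {1..M}" "c \<noteq> lo" "min (h m lo) (h lo hi) < h lo c" "h lo c < max (h m lo) (h lo hi)" for c
    using that o s m lw[of c] by (cases "c = m") (auto simp: forb_def)
  show "\<not> forb m hi c" if "c \<in> {1..M}" "c \<noteq> hi" "min (h lo hi) (h hi (m+1)) < h hi c" "h hi c < max (h lo hi) (h hi (m+1))" for c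
    using that o s m hw[of c] sym[of hi c] by (cases "c = m+1") (auto simp: forb_def)
  have "h m hi < h lo hi" using betw[of lo m hi] W m o by auto
  then have mm: "h m (m+1) < h m hi" using betw[of m "m+1" hi] W m o by auto
  show "\<not> (rng m m N (h m lo) (h m hi) \<and> rng m hi (h lo hi) (h hi (m+1)) (h m hi))"
    using \<open>h m hi < h lo hi\<close> m by (auto simp: rng_def)
  show "\<not> (rng m m N (h m lo) (h m (m+1)) \<and> rng m (m+1) (h hi (m+1)) N (h m (m+1)))"
    using \<open>h m hi < h lo hi\<close> mm m o s by (auto simp: rng_def)
  have "h lo (m+1) < h lo hi" using betw[of lo "m+1" hi] W m o by auto
  then show "\<not> (rng m lo (h m lo) (h lo hi) (h lo (m+1)) \<and> rng m (m+1) (h hi (m+1)) N (h lo (m+1)))"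
    using m by (auto simp: rng_def)
qed (use m o sym[of m lo] sym[of hi "m+1"] in auto)

lemma path_P4:
  assumes W: "1 \<le> lo" "hi \<le> M" and m: "lo < m" "m + 1 < hi"
    and o: "h lo hi < h lo m" "h lo hi < h (m+1) hi"
    and lw: "\<And>c. lo < c \<Longrightarrow> c \<le> m \<Longrightarrow> h lo hi < h lo c"
    and hw: "\<And>c. m + 1 \<le> c \<Longrightarrow> c < hi \<Longrightarrow> h lo hi < h c hi"
  shows "(m, [hi, lo, m + 1]) \<in> GW lo hi"
proof (rule GW_intro3[OF W])
  note s = sym[of m lo] sym[of hi "m+1"] sym[of hi lo]
  have mh: "h m hi < h lo hi" using betw[of lo m hi] W m o by auto
  have ml: "h lo (m+1) < h lo hi" using betw[of lo "m+1" hi] W m o by auto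
  have mm: "h m (m+1) < h m hi" using betw[of m "m+1" hi] W m o mh by auto
  show "\<not> forb m hi c" if "c \<in> {1..M}" "c \<noteq> hi" "min (h m hi) (h hi lo) < h hi c" "h hi c < max (h m hi) (h hi lo)" for c
    using that s m mh hw[of c] sym[of hi c] by (auto simp: forb_def)
  show "\<not> forb m lo c" if "c \<in> {1..M}" "c \<noteq> lo" "min (h hi lo) (h lo (m+1)) < h lo c" "h lo c < max (h hi lo) (h lo (m+1))" for c
    using that ml s m lw[of c] by (auto simp: forb_def)
  show "\<not> (rng m m N (h m hi) (h m lo) \<and> rng m lo (h hi lo) (h lo (m+1)) (h m lo))"
    using o s m by (auto simp: rng_def)
  show "\<not> (rng m m N (h m hi) (h m (m+1)) \<and> rng m (m+1) (h lo (m+1)) N (h m (m+1)))"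
    using mm by (auto simp: rng_def)
  show "\<not> (rng m hi (h m hi) (h hi lo) (h hi (m+1)) \<and> rng m (m+1) (h lo (m+1)) N (h hi (m+1)))"
    using m o s by (auto simp: rng_def)
  show "if hi \<le> m then h hi lo < h m hi else h m hi < h hi lo" using mh m s by auto
  show "if lo \<le> m then h lo (m + 1) < h hi lo else h hi lo < h lo (m + 1)" using ml m s by auto
qed (use m in auto)

text \<open>This path and the next three supply the vectors outside the two subintervals for the
  relations in \<open>four_wires\<close>.\<close>

lemma path_Q3:
  assumes W: "1 \<le> a" "a + 3 \<le> M"
    and o: "h a (a+2) < h (a+2) (a+3)" "h (a+2) (a+3) < h (a+1) (a+3)" "h (a+1) (a+3) < h (a+1) (a+2)"
      "h a (a+1) < h (a+1) (a+2)" "h a (a+3) < h (a+2) (a+3)"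
  shows "(a, [a + 2, a + 3, a + 1]) \<in> GW a (a + 3)"
proof (rule GW_intro3)
  note s = sym[of "a+2" "a+1"] sym[of "a+3" "a+1"] sym[of "a+3" "a+2"]
  show "\<not> forb a (a+2) c" if "c \<in> {1..M}" "c \<noteq> a+2" "min (h a (a+2)) (h (a+2) (a+3)) < h (a+2) c" "h (a+2) c < max (h a (a+2)) (h (a+2) (a+3))" for c
    using that o s by (cases "c = a+1") (auto simp: forb_def)
  show "\<not> forb a (a+3) c" if "c \<in> {1..M}" "c \<noteq> a+3" "min (h (a+2) (a+3)) (h (a+3) (a+1)) < h (a+3) c" "h (a+3) c < max (h (a+2) (a+3)) (h (a+3) (a+1))" for c
    using that o s by (cases "c = a+1"; cases "c = a+2") (auto simp: forb_def)
  show "\<not> (rng a a N (h a (a+2)) (h a (a+3)) \<and> rng a (a+3) (h (a+2) (a+3)) (h (a+3) (a+1)) (h a (a+3)))"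
    using o by (auto simp: rng_def)
  have "h a (a+1) < h a (a+2)" using betw[of a "a+1" "a+2"] o W by auto
  then show "\<not> (rng a a N (h a (a+2)) (h a (a+1)) \<and> rng a (a+1) (h (a+3) (a+1)) N (h a (a+1)))"
    by (auto simp: rng_def)
  show "\<not> (rng a (a+2) (h a (a+2)) (h (a+2) (a+3)) (h (a+2) (a+1)) \<and> rng a (a+1) (h (a+3) (a+1)) N (h (a+2) (a+1)))"
    using o s by (auto simp: rng_def)
  show "if a + 3 \<le> a then h (a+3) (a+1) < h (a+2) (a+3) else h (a+2) (a+3) < h (a+3) (a+1)" using o s by auto
qed (use W o in auto)

lemma path_Q3':
  assumes W: "1 \<le> a" "a + 3 \<le> M"
    and o: "h (a+1) (a+3) < h a (a+1)" "h a (a+1) < h a (a+2)" "h a (a+2) < h (a+1) (a+2)"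
      "h (a+2) (a+3) < h (a+1) (a+3)" "h a (a+3) < h a (a+1)"
  shows "(a + 2, [a, a + 1, a + 3]) \<in> GW a (a + 3)"
proof -
  note s = sym[of "a+2" "a"] sym[of "a+2" "a+1"]
  have "h (a+2) (a+3) < h a (a+2)" using o by auto
  then have "h (a+2) (a+3) < h a (a+2)" by simp
  have "(a + 2, [a, a + 1, (a + 2) + 1]) \<in> GW a (a + 3)"
  proof (rule GW_intro3)
    have e: "a + 2 + 1 = a + 3" by simp
    show "\<not> forb (a+2) a c" if "c \<in> {1..M}" "c \<noteq> a" "min (h (a+2) a) (h a (a+1)) < h a c" "h a c < max (h (a+2) a) (h a (a+1))" for c
      using that o s by (cases "c = a+1"; cases "c = a+2") (auto simp: forb_def)
    show "\<not> forb (a+2) (a+1) c" if "c \<in> {1..M}" "c \<noteq> a+1" "min (h a (a+1)) (h (a+1) (a+2+1)) < h (a+1) c" "h (a+1) c < max (h a (a+1)) (h (a+1) (a+2+1))" for c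
      using that o s unfolding e by (cases "c = a+2") (auto simp: forb_def)
    show "\<not> (rng (a+2) (a+2) N (h (a+2) a) (h (a+2) (a+1)) \<and> rng (a+2) (a+1) (h a (a+1)) (h (a+1) (a+2+1)) (h (a+2) (a+1)))"
      using o s by (auto simp: rng_def)
    show "\<not> (rng (a+2) (a+2) N (h (a+2) a) (h (a+2) (a+2+1)) \<and> rng (a+2) (a+2+1) (h (a+1) (a+2+1)) N (h (a+2) (a+2+1)))"
      using o s unfolding e by (auto simp: rng_def)
    show "\<not> (rng (a+2) a (h (a+2) a) (h a (a+1)) (h a (a+2+1)) \<and> rng (a+2) (a+2+1) (h (a+1) (a+2+1)) N (h a (a+2+1)))"
      using o s unfolding e by (auto simp: rng_def)
    show "if a \<le> a + 2 then h a (a+1) < h (a+2) a else h (a+2) a < h a (a+1)" using o s by auto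
    show "if a + 1 \<le> a + 2 then h (a+1) (a+2+1) < h a (a+1) else h a (a+1) < h (a+1) (a+2+1)" using o unfolding e by auto
  qed (use W o in auto)
  then show ?thesis by (simp add: numeral_3_eq_3)
qed

lemma path_mid1:
  assumes W: "1 \<le> a" "a + 3 \<le> M"
    and o: "h a (a+3) < h (a+1) (a+3)" "h (a+2) (a+3) < h a (a+3)"
  shows "(a, [a + 3, a + 1]) \<in> GW a (a + 3)"
proof (rule GW_intro2)
  note s = sym[of "a+3" "a+1"] sym[of "a+3" "a+2"]
  show "\<not> forb a (a+3) c" if "c \<in> {1..M}" "c \<noteq> a+3" "min (h a (a+3)) (h (a+3) (a+1)) < h (a+3) c" "h (a+3) c < max (h a (a+3)) (h (a+3) (a+1))" for c
    using that o s by (cases "c = a+1"; cases "c = a+2") (auto simp: forb_def)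
  have "h a (a+1) < h a (a+3)" using betw[of a "a+1" "a+3"] o W by auto
  then show "\<not> (rng a a N (h a (a+3)) (h a (a+1)) \<and> rng a (a+1) (h (a+3) (a+1)) N (h a (a+1)))"
    by (auto simp: rng_def)
  show "if a + 3 \<le> a then h (a+3) (a+1) < h a (a+3) else h a (a+3) < h (a+3) (a+1)" using o s by auto
qed (use W o in auto)

lemma path_mid2:
  assumes W: "1 \<le> a" "a + 3 \<le> M"
    and o: "h a (a+1) < h a (a+3)" "h a (a+3) < h a (a+2)"
  shows "(a + 2, [a, a + 3]) \<in> GW a (a + 3)"
proof -
  note s = sym[of "a+2" a]
  have e: "a + 2 + 1 = a + 3" by simp
  have "(a + 2, [a, a + 2 + 1]) \<in> GW a (a + 3)"
  proof (rule GW_intro2)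
    show "\<not> forb (a+2) a c" if "c \<in> {1..M}" "c \<noteq> a" "min (h (a+2) a) (h a (a+2+1)) < h a c" "h a c < max (h (a+2) a) (h a (a+2+1))" for c
      using that o s unfolding e by (cases "c = a+1"; cases "c = a+2") (auto simp: forb_def)
    have "h (a+2) (a+3) < h a (a+3)" using betw[of a "a+2" "a+3"] o W by auto
    then show "\<not> (rng (a+2) (a+2) N (h (a+2) a) (h (a+2) (a+2+1)) \<and> rng (a+2) (a+2+1) (h a (a+2+1)) N (h (a+2) (a+2+1)))"
      using o s unfolding e by (auto simp: rng_def)
    show "if a \<le> a + 2 then h a (a+2+1) < h (a+2) a else h (a+2) a < h a (a+2+1)" using o s unfolding e by auto
  qed (use W o in auto)
  then show ?thesis by (simp add: numeral_3_eq_3)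
qed

section \<open>Removing outer wires one at a time; finiteness of the set of paths\<close>

fun good :: "nat \<Rightarrow> nat \<Rightarrow> bool" where
  "good 0 lo \<longleftrightarrow> True"
| "good (Suc d) lo \<longleftrightarrow> dlast lo (lo + Suc d) \<and> good d lo \<or> alast lo (lo + Suc d) \<and> good d (lo + 1)"

lemma GW_mono: "lo' \<le> lo \<Longrightarrow> hi \<le> hi' \<Longrightarrow> GW lo hi \<subseteq> GW lo' hi'"
  by (auto simp: GW_def)

lemma val_depth_unused:
  assumes "1 \<le> lo" "hi \<le> M" "p \<in> {lo..hi}"
  shows "walk k a t bs \<Longrightarrow> set (a # bs) \<subseteq> {lo..hi} \<Longrightarrow> p \<notin> set (a # bs) \<Longrightarrow> val (depth lo hi p) a bs = 0"
proof (induction bs arbitrary: a t)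
  case (Cons b bs)
  then show ?case using depth_h[OF assms(1,2), of a b p] assms(3) by auto
qed auto

lemma GW_last: "(k, bs) \<in> GW lo hi \<Longrightarrow> k + 1 \<in> set bs"
proof -
  have "walk k a t bs \<Longrightarrow> a = k + 1 \<or> k + 1 \<in> set bs" for a t
    by (induction bs arbitrary: a t) auto
  then show "(k, bs) \<in> GW lo hi \<Longrightarrow> k + 1 \<in> set bs" by (fastforce simp: GW_def)
qed

lemma GW_avoid_hi: "(k, bs) \<in> GW lo hi \<Longrightarrow> hi \<notin> set bs \<Longrightarrow> (k, bs) \<in> GW lo (hi - 1)"
proof -
  assume g: "(k, bs) \<in> GW lo hi" and h: "hi \<notin> set bs"
  then have "k + 1 \<noteq> hi" using GW_last[OF g] by auto
  moreover have "set bs \<subseteq> {lo..hi - 1}"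
  proof
    fix b assume "b \<in> set bs"
    then have "b \<noteq> hi" "b \<in> {lo..hi}" using h g by (auto simp: GW_def)
    then show "b \<in> {lo..hi-1}" by auto
  qed
  ultimately show "(k, bs) \<in> GW lo (hi - 1)" using g by (auto simp: GW_def)
qed

lemma GW_avoid_lo: "(k, bs) \<in> GW lo hi \<Longrightarrow> \<not> (lo = k \<or> lo \<in> set bs) \<Longrightarrow> (k, bs) \<in> GW (lo + 1) hi"
proof -
  assume g: "(k, bs) \<in> GW lo hi" and h: "\<not> (lo = k \<or> lo \<in> set bs)"
  have "set bs \<subseteq> {lo + 1..hi}"
  proof
    fix b assume "b \<in> set bs"
    then have "b \<noteq> lo" "b \<in> {lo..hi}" using h g by (auto simp: GW_def)
    then show "b \<in> {lo+1..hi}" by auto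
  qed
  then show "(k, bs) \<in> GW (lo + 1) hi" using g h by (auto simp: GW_def)
qed

lemma seg_sub:
  assumes "a \<in> {1..M}"
  shows "seg k a t t' \<subseteq> {..<N}"
proof
  fix s assume "s \<in> seg k a t t'"
  then obtain c where "c \<in> {1..M}" "c \<noteq> a" "s = h a c" unfolding seg_def by blast
  then show "s \<in> {..<N}" using lt[OF assms, of c] by simp
qed

lemma vis_sub: "walk k a t bs \<Longrightarrow> a \<in> {1..M} \<Longrightarrow> vis k a t bs \<subseteq> {..<N}"
proof (induction bs arbitrary: a t)
  case (Cons b bs)
  have "walk k b (h a b) bs" "b \<in> {1..M}" using Cons.prems(1) by auto
  then have "vis k b (h a b) bs \<subseteq> {..<N}" by (rule Cons.IH)
  then show ?case using seg_sub[OF Cons.prems(2)] by simp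
qed (simp add: seg_sub)

text \<open>Each switch lies in its own segment and the segments are disjoint, so the number of
  nodes bounds the number of switches.\<close>

lemma length_le_vis:
  "walk k a t bs \<Longrightarrow> a \<in> {1..M} \<Longrightarrow> nod k a t bs \<Longrightarrow> length bs \<le> card (vis k a t bs)"
proof (induction bs arbitrary: a t)
  case (Cons b bs)
  have wk: "walk k b (h a b) bs" and b: "b \<in> {1..M}" and nd: "nod k b (h a b) bs" using Cons.prems by auto
  have IH: "length bs \<le> card (vis k b (h a b) bs)" by (rule Cons.IH[OF wk b nd])
  have f: "finite (seg k a t (h a b))" "finite (vis k b (h a b) bs)"
    by (rule finite_subset[OF seg_sub[OF Cons.prems(2)]], simp, rule finite_subset[OF vis_sub[OF wk b]], simp)
  have "b \<noteq> a" "if a \<le> k then h a b < t else t < h a b" using Cons.prems(1) by simp_all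
  then have "h a b \<in> seg k a t (h a b)" unfolding seg_def using b by (intro CollectI exI[of _ b]) simp
  then have "card (seg k a t (h a b)) > 0" using f(1) by (auto simp: card_gt_0_iff)
  moreover have "card (vis k a t (b # bs)) = card (seg k a t (h a b)) + card (vis k b (h a b) bs)"
    unfolding vis.simps by (rule card_Un_disjoint[OF f]) (use Cons.prems(3) in simp)
  ultimately show ?case using IH by (simp del: vis.simps)
qed simp

lemma finite_GW: "1 \<le> lo \<Longrightarrow> hi \<le> M \<Longrightarrow> finite (GW lo hi)"
proof -
  assume l: "1 \<le> lo" "hi \<le> M"
  have "GW lo hi \<subseteq> {lo..<hi} \<times> {bs. set bs \<subseteq> {lo..hi} \<and> length bs \<le> N}"
  proof
    fix p assume "p \<in> GW lo hi"
    moreover obtain k bs where pk: "p = (k, bs)" by (cases p)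
    ultimately have p: "lo \<le> k" "k < hi" "set bs \<subseteq> {lo..hi}" "walk k k N bs" "nod k k N bs"
      unfolding GW_def by simp_all
    have k: "k \<in> {1..M}" using p l by auto
    have "length bs \<le> card (vis k k N bs)" by (rule length_le_vis[OF p(4) k p(5)])
    also have "\<dots> \<le> card {..<N}" by (rule card_mono[OF _ vis_sub[OF p(4) k]]) simp
    finally show "p \<in> {lo..<hi} \<times> {bs. set bs \<subseteq> {lo..hi} \<and> length bs \<le> N}" using p(1-3) pk by simp
  qed
  moreover have "finite ({lo..<hi} \<times> {bs. set bs \<subseteq> {lo..hi} \<and> length bs \<le> N})"
    by (intro finite_cartesian_product finite_lists_length_le) simp_all
  ultimately show "finite (GW lo hi)" by (rule finite_subset)
qed

end

section \<open>Path vectors\<close>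

locale arrangement_basis = arrangement +
  fixes e :: "nat \<Rightarrow> 'v::euclidean_space"
  assumes orth: "i < N \<Longrightarrow> j < N \<Longrightarrow> e i \<bullet> e j = (if i = j then 1 else 0)"
begin

fun pvec :: "nat \<Rightarrow> nat list \<Rightarrow> 'v" where
  "pvec a [] = 0"
| "pvec a (b # bs) = (if a < b then 1 else -1) *\<^sub>R e (h a b) + pvec b bs"

definition GV :: "nat \<Rightarrow> nat \<Rightarrow> 'v set" where
  "GV lo hi = (\<lambda>(k, bs). pvec k bs) ` GW lo hi"

definition point :: "(nat \<Rightarrow> real) \<Rightarrow> 'v" where
  "point x = (\<Sum>j<N. x j *\<^sub>R e j)"

lemma inner_vec: "pvec a bs \<bullet> y = val (\<lambda>j. e j \<bullet> y) a bs"
  by (induction bs arbitrary: a) (auto simp: inner_left_distrib)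

lemma inner_point: "j < N \<Longrightarrow> e j \<bullet> point x = x j"
  by (simp add: point_def inner_sum_right orth if_distrib cong: if_cong)

lemma vec_point: "walk k a t bs \<Longrightarrow> a \<in> {1..M} \<Longrightarrow> pvec a bs \<bullet> point x = val x a bs"
  by (induction bs arbitrary: a t) (auto simp: inner_left_distrib inner_diff_left inner_point lt)

lemma vec_point_GW: "(k, bs) \<in> GW lo hi \<Longrightarrow> 1 \<le> lo \<Longrightarrow> hi \<le> M \<Longrightarrow> pvec k bs \<bullet> point x = val x k bs"
  by (auto simp: GW_def intro: vec_point)

lemma GV_mono: "lo' \<le> lo \<Longrightarrow> hi \<le> hi' \<Longrightarrow> GV lo hi \<subseteq> GV lo' hi'"
  using GW_mono unfolding GV_def by blast

lemma e_inner:
  assumes "a \<in> {1..M}" "b \<in> {1..M}" "c \<in> {1..M}" "d \<in> {1..M}" "a \<noteq> b" "c \<noteq> d"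
  shows "e (h a b) \<bullet> e (h c d) = (if a = c \<and> b = d \<or> a = d \<and> b = c then 1 else 0)"
proof -
  have "h a b = h c d \<longleftrightarrow> a = c \<and> b = d \<or> a = d \<and> b = c"
    using inj[OF assms] sym by (auto simp: doubleton_eq_iff)
  then show ?thesis using orth lt assms by auto
qed

text \<open>On the node of \<open>a < b\<close> its value is a difference of the potential that is 1
  beyond \<open>k\<close> and 0 up to \<open>k\<close>. By \<open>val_telescope\<close> its value on
  a path therefore depends only on the two ends, and it recognises the paths that start on wire
  \<open>k\<close>.\<close>

definition grade :: "nat \<Rightarrow> nat \<Rightarrow> real" where
  "grade k j = (if \<exists>a b. 1 \<le> a \<and> a \<le> k \<and> k < b \<and> b \<le> M \<and> j = h a b then 1 else 0)"

lemma vec_grade: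
  assumes "(k, bs) \<in> GW 1 M"
  shows "pvec k bs \<bullet> point (grade k') = (if k = k' then 1 else 0)"
proof -
  have g: "grade k' (h a b) = (if b > k' then 1 else 0) - (if a > k' then 1 else 0)"
    if ab: "1 \<le> a" "a < b" "b \<le> M" for a b
  proof -
    have "(\<exists>c d. 1 \<le> c \<and> c \<le> k' \<and> k' < d \<and> d \<le> M \<and> h a b = h c d) \<longleftrightarrow> a \<le> k' \<and> k' < b"
    proof
      assume "\<exists>c d. 1 \<le> c \<and> c \<le> k' \<and> k' < d \<and> d \<le> M \<and> h a b = h c d"
      then obtain c d where c: "1 \<le> c" "c \<le> k'" "k' < d" "d \<le> M" "h a b = h c d" by auto
      have "{a, b} = {c, d}" using c ab by (intro inj) auto
      then show "a \<le> k' \<and> k' < b" using c ab by (auto simp: doubleton_eq_iff)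
    qed (use ab in auto)
    then show ?thesis using ab by (auto simp: grade_def)
  qed
  have w: "walk k k N bs" "k \<in> {1..M}" using assms by (auto simp: GW_def)
  have "val (grade k') k bs = (if k + 1 > k' then 1 else 0) - (if k > k' then 1 else 0)"
    by (rule val_telescope[OF _ w]) (rule g)
  then show ?thesis using vec_point_GW[OF assms] by auto
qed

text \<open>Places all path vectors on one affine hyperplane, so coefficients of a path vector in
  terms of path vectors always sum to 1.\<close>

definition gsum :: 'v where "gsum = (\<Sum>k\<in>{1..<M}. point (grade k))"

lemma inner_gsum: "p \<in> GV 1 M \<Longrightarrow> p \<bullet> gsum = 1"
proof -
  assume "p \<in> GV 1 M"
  then obtain k bs where kb: "(k, bs) \<in> GW 1 M" "p = pvec k bs" by (auto simp: GV_def)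
  then have "k \<in> {1..<M}" by (auto simp: GW_def)
  then show ?thesis by (simp add: gsum_def inner_sum_right kb(2) vec_grade[OF kb(1)])
qed

text \<open>The path vectors of an interval of wires span the coordinates of its nodes: after removing
  an outer wire on either side, only the node of the two outer wires remains.\<close>
lemma GV_orthogonal:
  assumes "1 \<le> lo" "lo + d \<le> M" "\<And>p. p \<in> GV lo (lo + d) \<Longrightarrow> p \<bullet> y = 0"
    "a \<in> {lo..lo + d}" "b \<in> {lo..lo + d}" "a \<noteq> b"
  shows "e (h a b) \<bullet> y = 0"
  using assms
proof (induction d arbitrary: lo a b)
  case (Suc d)
  have sub: "GV lo (lo + d) \<subseteq> GV lo (lo + Suc d)" "GV (lo+1) (lo + 1 + d) \<subseteq> GV lo (lo + Suc d)"
    by (intro GV_mono; simp)+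
  have z: "e (h a b) \<bullet> y = 0" if "a \<in> {lo..lo + Suc d}" "b \<in> {lo..lo + Suc d}" "a \<noteq> b" "{a, b} \<noteq> {lo, lo + Suc d}" for a b
  proof -
    have "a \<in> {lo..lo+d} \<and> b \<in> {lo..lo+d} \<or> a \<in> {lo+1..lo+1+d} \<and> b \<in> {lo+1..lo+1+d}"
      using that by (auto simp: doubleton_eq_iff)
    then show ?thesis using Suc.IH[of lo a b] Suc.IH[of "lo+1" a b] Suc.prems(1,2,3) sub that by auto
  qed
  obtain k bs where kb: "(k, bs) \<in> GW lo (lo + Suc d)"
    "\<And>x. (\<And>a b. a \<in> {lo..lo + Suc d} \<Longrightarrow> b \<in> {lo..lo + Suc d} \<Longrightarrow> a \<noteq> b \<Longrightarrow> {a, b} \<noteq> {lo, lo + Suc d} \<Longrightarrow> x (h a b) = 0)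
       \<Longrightarrow> val x k bs = x (h lo (lo + Suc d))"
    by (rule path_through_outer_node[of lo "lo + Suc d"]) (use Suc.prems in auto)
  have "e (h lo (lo + Suc d)) \<bullet> y = pvec k bs \<bullet> y"
    using kb(2)[of "\<lambda>j. e j \<bullet> y"] z inner_vec by auto
  also have "\<dots> = 0" using Suc.prems(3) kb(1) by (force simp: GV_def)
  finally have "e (h lo (lo + Suc d)) \<bullet> y = 0" .
  then show ?case
    using z[of a b] Suc.prems(4-6) sym[of "lo + Suc d" lo]
    by (cases "{a, b} = {lo, lo + Suc d}") (auto simp: doubleton_eq_iff simp del: add_Suc_right)
qed auto

end

section \<open>A basis of path vectors that generates all others with nonnegative
  coefficients\<close>

locale arrangement_simplicial = arrangement_basis h M N e
  for h :: "nat \<Rightarrow> nat \<Rightarrow> nat" and M N :: nat and e :: "nat \<Rightarrow> 'v::euclidean_space" +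
  fixes B :: "'v set"
  assumes indep: "independent B"
    and B_sub: "B \<subseteq> GV 1 M"
    and comb: "p \<in> GV 1 M \<Longrightarrow> \<exists>c. (\<forall>b\<in>B. 0 \<le> c b) \<and> p = (\<Sum>b\<in>B. c b *\<^sub>R b)"
begin

lemma fin: "finite B"
  using indep by (rule independent_imp_finite)

lemma coeff_unique:
  assumes "(\<Sum>b\<in>B. c b *\<^sub>R b) = (\<Sum>b\<in>B. d b *\<^sub>R b)" "b \<in> B"
  shows "c b = d b"
proof -
  have "(\<Sum>b\<in>B. (c b - d b) *\<^sub>R b) = 0"
    using assms by (simp add: scaleR_left_diff_distrib sum_subtractf)
  then have "c b - d b = 0" by (rule independentD[OF indep fin order_refl _ assms(2)])
  then show ?thesis by simp
qed

lemma unit_sum: "r \<in> B \<Longrightarrow> r = (\<Sum>b\<in>B. (if b = r then 1 else 0) *\<^sub>R b)"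
  using fin by (simp add: if_distrib[of "\<lambda>c. c *\<^sub>R _"] cong: if_cong)

text \<open>Only path vectors of the interval contribute to its path vectors.\<close>
definition closed :: "nat \<Rightarrow> nat \<Rightarrow> bool" where
  "closed lo hi \<longleftrightarrow> (\<forall>p\<in>GV lo hi. \<forall>c. (\<forall>b\<in>B. 0 \<le> c b) \<longrightarrow> p = (\<Sum>b\<in>B. c b *\<^sub>R b) \<longrightarrow>
      (\<forall>b\<in>B. 0 < c b \<longrightarrow> b \<in> GV lo hi))"

text \<open>On the face \<open>y = 0\<close> a sum of nonnegative terms
  \<open>c b * (b \<bullet> y)\<close> vanishes, hence each term does, and only vectors of the face
  have positive coefficients.\<close>

lemma closed_face:
  assumes cl: "closed lo hi" and sub: "GV lo' hi' \<subseteq> GV lo hi"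
    and y: "\<And>p. p \<in> GV lo hi \<Longrightarrow> p \<bullet> y \<ge> 0" "\<And>p. p \<in> GV lo' hi' \<Longrightarrow> p \<bullet> y = 0"
      "\<And>p. p \<in> GV lo hi \<Longrightarrow> p \<bullet> y = 0 \<Longrightarrow> p \<in> GV lo' hi'"
  shows "closed lo' hi'"
  unfolding closed_def
proof (intro ballI allI impI)
  fix p c b assume p: "p \<in> GV lo' hi'" and c: "\<forall>b\<in>B. 0 \<le> c b" "p = (\<Sum>b\<in>B. c b *\<^sub>R b)" and b: "b \<in> B" "0 < c b"
  have m: "d \<in> GV lo hi" if "d \<in> B" "0 < c d" for d using cl p c that sub unfolding closed_def by blast
  have "0 = (\<Sum>b\<in>B. c b * (b \<bullet> y))" using y(2)[OF p] c(2) by (simp add: inner_sum_left)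
  moreover have nn: "\<forall>d\<in>B. 0 \<le> c d * (d \<bullet> y)"
    using m y(1) c(1) by (metis less_eq_real_def mult_nonneg_nonneg mult_zero_left)
  ultimately have "c b * (b \<bullet> y) = 0"
    using sum_nonneg_eq_0_iff[OF fin, of "\<lambda>b. c b * (b \<bullet> y)"] b by auto
  then show "b \<in> GV lo' hi'" using b y(3) m by auto
qed

text \<open>The claims concern vectors, which might come from several paths; since
  \<open>depth\<close> is a functional of the vector, it decides for all these paths alike whether
  they use \<open>hi\<close>.\<close>

lemma GV_split_hi:
  assumes "1 \<le> lo" "hi \<le> M" "p \<in> GV lo hi" "lo < hi"
  shows "p \<bullet> point (depth lo hi hi) \<ge> 0" "p \<bullet> point (depth lo hi hi) = 0 \<longleftrightarrow> p \<in> GV lo (hi - 1)"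
    "p \<bullet> point (depth lo hi hi) > 0 \<Longrightarrow> \<exists>k bs. (k, bs) \<in> GW lo hi \<and> hi \<in> set bs \<and> p = pvec k bs"
proof -
  have kb: "pvec k bs \<bullet> point (depth lo hi hi) \<ge> 0 \<and> (hi \<in> set bs \<longrightarrow> pvec k bs \<bullet> point (depth lo hi hi) > 0)
     \<and> (hi \<notin> set bs \<longrightarrow> pvec k bs \<bullet> point (depth lo hi hi) = 0 \<and> (k, bs) \<in> GW lo (hi - 1))"
    if g: "(k, bs) \<in> GW lo hi" for k bs
  proof -
    have k: "lo \<le> k" "k < hi" "set bs \<subseteq> {lo..hi}" "walk k k N bs" "nod k k N bs" using g by (auto simp: GW_def)
    have "hi \<notin> set bs \<Longrightarrow> (k, bs) \<in> GW lo (hi - 1)" by (rule GW_avoid_hi[OF g])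
    then show ?thesis
      using val_depth_hi[OF assms(1,2) k(1,2) k(4)] val_depth_unused[OF assms(1,2) _ k(4), of hi] k assms
        vec_point_GW[OF g assms(1,2), of "depth lo hi hi"] by auto
  qed
  obtain k bs where p: "(k, bs) \<in> GW lo hi" "p = pvec k bs" using assms(3) by (auto simp: GV_def)
  show "p \<bullet> point (depth lo hi hi) \<ge> 0" using kb p by auto
  show "p \<bullet> point (depth lo hi hi) > 0 \<Longrightarrow> \<exists>k bs. (k, bs) \<in> GW lo hi \<and> hi \<in> set bs \<and> p = pvec k bs"
    using kb[OF p(1)] p by (cases "hi \<in> set bs") auto
  show "p \<bullet> point (depth lo hi hi) = 0 \<longleftrightarrow> p \<in> GV lo (hi - 1)"
  proof
    assume "p \<bullet> point (depth lo hi hi) = 0"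
    then show "p \<in> GV lo (hi - 1)" using kb[OF p(1)] p by (force simp: GV_def)
  next
    assume "p \<in> GV lo (hi - 1)"
    then obtain k' bs' where p': "(k', bs') \<in> GW lo (hi - 1)" "p = pvec k' bs'" by (auto simp: GV_def)
    then have "hi \<notin> set bs'" using assms(4) by (auto simp: GW_def)
    moreover have "(k', bs') \<in> GW lo hi" using p' GW_mono[of lo lo "hi - 1" hi] by auto
    ultimately show "p \<bullet> point (depth lo hi hi) = 0" using kb p' by auto
  qed
qed

lemma GV_split_lo:
  assumes "1 \<le> lo" "hi \<le> M" "p \<in> GV lo hi" "lo < hi"
  shows "p \<bullet> point (depth lo hi lo) \<ge> 0" "p \<bullet> point (depth lo hi lo) = 0 \<longleftrightarrow> p \<in> GV (lo + 1) hi"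
    "p \<bullet> point (depth lo hi lo) > 0 \<Longrightarrow> \<exists>k bs. (k, bs) \<in> GW lo hi \<and> (lo = k \<or> lo \<in> set bs) \<and> p = pvec k bs"
proof -
  have kb: "pvec k bs \<bullet> point (depth lo hi lo) \<ge> 0 \<and> (lo = k \<or> lo \<in> set bs \<longrightarrow> pvec k bs \<bullet> point (depth lo hi lo) > 0)
     \<and> (\<not> (lo = k \<or> lo \<in> set bs) \<longrightarrow> pvec k bs \<bullet> point (depth lo hi lo) = 0 \<and> (k, bs) \<in> GW (lo + 1) hi)"
    if g: "(k, bs) \<in> GW lo hi" for k bs
  proof -
    have k: "lo \<le> k" "k < hi" "set bs \<subseteq> {lo..hi}" "walk k k N bs" "nod k k N bs" using g by (auto simp: GW_def)
    have "\<not> (lo = k \<or> lo \<in> set bs) \<Longrightarrow> (k, bs) \<in> GW (lo + 1) hi" by (rule GW_avoid_lo[OF g])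
    then show ?thesis
      using val_depth_lo[OF assms(1,2) k(1,2) k(4)] val_depth_unused[OF assms(1,2) _ k(4), of lo] k assms
        vec_point_GW[OF g assms(1,2), of "depth lo hi lo"] by (cases "lo = k") auto
  qed
  obtain k bs where p: "(k, bs) \<in> GW lo hi" "p = pvec k bs" using assms(3) by (auto simp: GV_def)
  show "p \<bullet> point (depth lo hi lo) \<ge> 0" using kb p by auto
  show "p \<bullet> point (depth lo hi lo) > 0 \<Longrightarrow> \<exists>k bs. (k, bs) \<in> GW lo hi \<and> (lo = k \<or> lo \<in> set bs) \<and> p = pvec k bs"
    using kb[OF p(1)] p by (cases "lo = k \<or> lo \<in> set bs") auto
  show "p \<bullet> point (depth lo hi lo) = 0 \<longleftrightarrow> p \<in> GV (lo + 1) hi"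
  proof
    assume "p \<bullet> point (depth lo hi lo) = 0"
    then show "p \<in> GV (lo + 1) hi" using kb[OF p(1)] p by (force simp: GV_def)
  next
    assume "p \<in> GV (lo + 1) hi"
    then obtain k' bs' where p': "(k', bs') \<in> GW (lo + 1) hi" "p = pvec k' bs'" by (auto simp: GV_def)
    then have "\<not> (lo = k' \<or> lo \<in> set bs')" by (auto simp: GW_def)
    moreover have "(k', bs') \<in> GW lo hi" using p' GW_mono[of lo "lo + 1" hi hi] by auto
    ultimately show "p \<bullet> point (depth lo hi lo) = 0" using kb p' by auto
  qed
qed

lemma closed_hi:
  assumes "1 \<le> lo" "hi \<le> M" "lo < hi" "closed lo hi"
  shows "closed lo (hi - 1)"
  by (rule closed_face[OF assms(4), of _ _ "point (depth lo hi hi)"])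
    (use GV_split_hi[OF assms(1,2) _ assms(3)] GV_mono[of lo lo "hi - 1" hi] in auto)

lemma closed_lo:
  assumes "1 \<le> lo" "hi \<le> M" "lo < hi" "closed lo hi"
  shows "closed (lo + 1) hi"
  by (rule closed_face[OF assms(4), of _ _ "point (depth lo hi lo)"])
    (use GV_split_lo[OF assms(1,2) _ assms(3)] GV_mono[of lo "lo + 1" hi hi] in auto)

text \<open>Some basis vector of positive coefficient is positive on \<open>y\<close>, hence is the
  listed vector for some \<open>k'\<close>. Then \<open>grade k'\<close> is positive on the whole
  combination, which forces \<open>k' = k\<close>; so that basis vector is the given one.\<close>

lemma member_B:
  assumes p: "(k, bs) \<in> GW lo hi" and lo: "1 \<le> lo" "hi \<le> M" and cl: "closed lo hi"
    and y: "pvec k bs \<bullet> y > 0"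
    and u: "\<And>q. q \<in> GV lo hi \<Longrightarrow> q \<bullet> y > 0 \<Longrightarrow> \<exists>k'. lo \<le> k' \<and> k' < hi \<and> q = pvec k' (f k') \<and> (k', f k') \<in> GW lo hi"
    and f: "bs = f k"
  shows "pvec k bs \<in> B"
proof -
  have sub: "GW lo hi \<subseteq> GW 1 M" using GW_mono lo by auto
  have pG: "pvec k bs \<in> GV 1 M" "pvec k bs \<in> GV lo hi" using p sub by (force simp: GV_def)+
  obtain c where c: "\<forall>b\<in>B. 0 \<le> c b" "pvec k bs = (\<Sum>b\<in>B. c b *\<^sub>R b)" using comb[OF pG(1)] by auto
  have "0 < (\<Sum>b\<in>B. c b * (b \<bullet> y))" using y c(2) by (simp add: inner_sum_left)
  then obtain b where b: "b \<in> B" "0 < c b * (b \<bullet> y)"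
    by (meson not_less sum_nonpos)
  then have b1: "0 < c b" "0 < b \<bullet> y" using c(1) by (auto simp: zero_less_mult_iff)
  then have "b \<in> GV lo hi" using cl c pG b unfolding closed_def by blast
  then obtain k' where k': "b = pvec k' (f k')" "(k', f k') \<in> GW lo hi" using u b1 by blast
  have gB: "q \<bullet> point (grade k') \<ge> 0" if "q \<in> B" for q
    using B_sub that vec_grade by (fastforce simp: GV_def)
  have "0 < c b * (b \<bullet> point (grade k'))" using b1 vec_grade[of k' "f k'" k'] k' sub by auto
  also have "\<dots> \<le> (\<Sum>b\<in>B. c b * (b \<bullet> point (grade k')))"
    using b(1) fin gB c(1) by (intro member_le_sum) auto
  also have "\<dots> = pvec k bs \<bullet> point (grade k')" using c(2) by (simp add: inner_sum_left)
  finally have "k = k'" using vec_grade[of k bs k'] p sub by (auto split: if_splits)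
  then show ?thesis using k' f b by auto
qed

text \<open>A path that uses the removable wire is the only such path for its \<open>k\<close>, so
  \<open>member_B\<close> applies with \<open>depth\<close>; any other path lives in the smaller
  interval, which is closed as a face.\<close>

lemma good_sub_B:
  "good d lo \<Longrightarrow> 1 \<le> lo \<Longrightarrow> lo + d \<le> M \<Longrightarrow> closed lo (lo + d) \<Longrightarrow> GV lo (lo + d) \<subseteq> B"
proof (induction d arbitrary: lo)
  case 0
  then show ?case by (auto simp: GV_def GW_def)
next
  case (Suc d)
  let ?hi = "lo + Suc d"
  have l: "lo < ?hi" "?hi \<le> M" "1 \<le> lo" using Suc.prems by auto
  show ?case
  proof
    fix p assume p: "p \<in> GV lo ?hi"
    from Suc.prems(1) consider "dlast lo ?hi" "good d lo" | "alast lo ?hi" "good d (lo + 1)" by auto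
    then show "p \<in> B"
    proof cases
      case 1
      let ?f = "\<lambda>k. if k + 1 = ?hi then [?hi] else [?hi, k + 1]"
      let ?y = "point (depth lo ?hi ?hi)"
      have u: "\<exists>k'. lo \<le> k' \<and> k' < ?hi \<and> q = pvec k' (?f k') \<and> (k', ?f k') \<in> GW lo ?hi"
        if q: "q \<in> GV lo ?hi" "q \<bullet> ?y > 0" for q
      proof -
        obtain k bs where kb: "(k, bs) \<in> GW lo ?hi" "?hi \<in> set bs" "q = pvec k bs"
          using GV_split_hi(3)[OF l(3,2) q(1) l(1) q(2)] by blast
        have "bs = ?f k" using dlast_class[OF 1(1) l(3,2) kb(1,2)] .
        then show ?thesis using kb by (intro exI[of _ k]) (auto simp: GW_def)
      qed
      show ?thesis
      proof (cases "p \<bullet> ?y > 0")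
        case True
        then obtain k where k: "p = pvec k (?f k)" "(k, ?f k) \<in> GW lo ?hi" using u[OF p] by blast
        show ?thesis using member_B[OF k(2) l(3,2) Suc.prems(4) _ u refl] True k(1) by simp
      next
        case False
        then have "p \<in> GV lo (?hi - 1)" using GV_split_hi(1,2)[OF l(3,2) p l(1)] by linarith
        moreover have "closed lo (?hi - 1)" using closed_hi[OF l(3,2,1) Suc.prems(4)] .
        ultimately show ?thesis using Suc.IH[OF 1(2)] l by auto
      qed
    next
      case 2
      let ?f = "\<lambda>k. if k = lo then [k + 1] else [lo, k + 1]"
      let ?y = "point (depth lo ?hi lo)"
      have u: "\<exists>k'. lo \<le> k' \<and> k' < ?hi \<and> q = pvec k' (?f k') \<and> (k', ?f k') \<in> GW lo ?hi"
        if q: "q \<in> GV lo ?hi" "q \<bullet> ?y > 0" for q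
      proof -
        obtain k bs where kb: "(k, bs) \<in> GW lo ?hi" "lo = k \<or> lo \<in> set bs" "q = pvec k bs"
          using GV_split_lo(3)[OF l(3,2) q(1) l(1) q(2)] by blast
        have "bs = ?f k" using alast_class[OF 2(1) l(3,2) kb(1,2)] .
        then show ?thesis using kb by (intro exI[of _ k]) (auto simp: GW_def)
      qed
      show ?thesis
      proof (cases "p \<bullet> ?y > 0")
        case True
        then obtain k where k: "p = pvec k (?f k)" "(k, ?f k) \<in> GW lo ?hi" using u[OF p] by blast
        show ?thesis using member_B[OF k(2) l(3,2) Suc.prems(4) _ u refl] True k(1) by simp
      next
        case False
        then have "p \<in> GV (lo + 1) ?hi" using GV_split_lo(1,2)[OF l(3,2) p l(1)] by linarith
        moreover have "closed (lo + 1) ?hi" using closed_lo[OF l(3,2,1) Suc.prems(4)] .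
        ultimately show ?thesis using Suc.IH[OF 2(2)] l by auto
      qed
    qed
  qed
qed

section \<open>Relations between four path vectors and the exclusion of bad intervals\<close>

lemma exchange:
  assumes "p \<in> GV 1 M" "q \<in> GV 1 M" "r \<in> B" "s \<in> B" "p + r = q + s" "r \<noteq> s"
  shows "p = s"
proof -
  obtain c where c: "\<forall>b\<in>B. 0 \<le> c b" "p = (\<Sum>b\<in>B. c b *\<^sub>R b)" using comb assms by blast
  obtain d where d: "\<forall>b\<in>B. 0 \<le> d b" "q = (\<Sum>b\<in>B. d b *\<^sub>R b)" using comb assms by blast
  have "(\<Sum>b\<in>B. (c b + (if b = r then 1 else 0)) *\<^sub>R b) = (\<Sum>b\<in>B. (d b + (if b = s then 1 else 0)) *\<^sub>R b)"
    using assms(5) c(2) d(2) unit_sum[OF assms(3)] unit_sum[OF assms(4)]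
    by (simp add: scaleR_left_distrib sum.distrib)
  \<comment> \<open>Since \<open>r \<noteq> s\<close>, comparing the coefficients of
    \<open>s\<close> gives \<open>c s = d s + 1\<close>.\<close>
  from coeff_unique[OF this assms(4)] have cs: "c s \<ge> 1" using d assms by auto
  \<comment> \<open>The coefficients of \<open>p\<close> sum to 1, and \<open>s\<close> already uses
    up all of it.\<close>
  have "(\<Sum>b\<in>B. c b) = (\<Sum>b\<in>B. c b * (b \<bullet> gsum))" using inner_gsum B_sub by (intro sum.cong) auto
  also have "\<dots> = p \<bullet> gsum" using c(2) by (simp add: inner_sum_left)
  also have "\<dots> = 1" using inner_gsum assms by auto
  finally have s1: "c s + (\<Sum>b\<in>B - {s}. c b) = 1" using sum.remove[OF fin assms(4), of c] by simp
  moreover have "(\<Sum>b\<in>B - {s}. c b) \<ge> 0" using c by (intro sum_nonneg) auto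
  ultimately have "c s = 1" "(\<Sum>b\<in>B - {s}. c b) = 0" using cs by auto
  then have "\<forall>b\<in>B - {s}. c b = 0" using sum_nonneg_eq_0_iff[of "B - {s}" c] fin c by auto
  then have "p = (\<Sum>b\<in>B. (if b = s then 1 else 0) *\<^sub>R b)" using c(2) \<open>c s = 1\<close> by (auto intro: sum.cong)
  then show ?thesis using unit_sum[OF assms(4)] by simp
qed

text \<open>The nonnegative coefficients of \<open>p\<close> and \<open>q\<close> add up to those of
  \<open>r + s\<close>, so nothing can cancel and \<open>p\<close> involves no basis vector besides
  \<open>r\<close> and \<open>s\<close>.\<close>

lemma sum_of_two:
  assumes "p \<in> GV 1 M" "q \<in> GV 1 M" "r \<in> B" "s \<in> B" "p + q = r + s" "r \<bullet> y = 0" "s \<bullet> y = 0"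
  shows "p \<bullet> y = 0"
proof -
  obtain c where c: "\<forall>b\<in>B. 0 \<le> c b" "p = (\<Sum>b\<in>B. c b *\<^sub>R b)" using comb assms by blast
  obtain d where d: "\<forall>b\<in>B. 0 \<le> d b" "q = (\<Sum>b\<in>B. d b *\<^sub>R b)" using comb assms by blast
  have eq: "(\<Sum>b\<in>B. (c b + d b) *\<^sub>R b) = (\<Sum>b\<in>B. ((if b = r then 1 else 0) + (if b = s then 1 else 0)) *\<^sub>R b)"
    using assms(5) c(2) d(2) unit_sum[OF assms(3)] unit_sum[OF assms(4)]
    by (simp add: scaleR_left_distrib sum.distrib)
  have "c b * (b \<bullet> y) = 0" if b: "b \<in> B" for b
  proof (cases "b = r \<or> b = s")
    case False
    then have "c b + d b = 0" using coeff_unique[OF eq b] by auto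
    then show ?thesis using c d b by (metis add_nonneg_eq_0_iff mult_zero_left)
  qed (use assms in auto)
  then have "(\<Sum>b\<in>B. c b * (b \<bullet> y)) = 0" by (intro sum.neutral) blast
  then show ?thesis using c(2) by (simp add: inner_sum_left)
qed

lemma GW_GV: "(k, bs) \<in> GW lo hi \<Longrightarrow> lo' \<le> lo \<Longrightarrow> hi \<le> hi' \<Longrightarrow> pvec k bs \<in> GV lo' hi'"
  using GW_mono[of lo' lo hi hi'] by (force simp: GV_def)

text \<open>Here \<open>lo\<close> meets \<open>hi\<close> below some wires and above others. At the
  boundary \<open>m\<close> between them, a path may use \<open>lo\<close> and \<open>hi\<close> in
  either order; the sum of these two vectors equals the sum of the two that use only one of these
  wires, which are known to be in \<open>B\<close>.\<close>

lemma not_alast_case: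
  assumes W: "1 \<le> lo" "hi \<le> M" "lo + 2 \<le> hi"
    and B: "GV lo (hi - 1) \<subseteq> B" "GV (lo + 1) hi \<subseteq> B"
    and al: "alast lo (hi - 1)" and D: "dlast (lo + 1) hi \<or> alast (lo + 1) hi"
    and nd: "\<not> dlast lo hi" and na: "\<not> alast lo hi"
  shows False
proof -
  have W': "hi - 1 \<le> M" using W by auto
  obtain b0 where b0: "lo < b0" "b0 < hi" "\<not> h b0 hi < h lo b0"
  proof -
    obtain b c where bc: "lo < b" "b < c" "c \<le> hi" "\<not> h b c < h lo b" using na unfolding alast_def by blast
    then have "c = hi" using al unfolding alast_def by fastforce
    then show ?thesis using that bc by auto
  qed
  then have b0U: "h lo b0 < h lo hi" using betw[of lo b0 hi] W by auto
  have mono: "h lo c < h lo b" if "lo < b" "b < c" "c < hi" for b c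
    using alast_less(2)[OF al W(1) W', of b c] that by auto
  have ex: "\<exists>c. lo < c \<and> c < hi \<and> h lo hi < h lo c"
  proof (rule ccontr)
    assume ne: "\<nexists>c. lo < c \<and> c < hi \<and> h lo hi < h lo c"
    have U: "h lo b < h lo hi" "h lo hi < h b hi" if "lo < b" "b < hi" for b
      using betw[of lo b hi] that W ne by force+
    have "dlast lo hi"
      unfolding dlast_def
    proof (intro allI impI)
      fix a b assume ab: "lo \<le> a \<and> a < b \<and> b < hi"
      have "h a b \<le> h lo b"
        using alast_less[OF al W(1) W', of a b] ab by (cases "a = lo") force+
      then show "h a b < h b hi" using U[of b] ab by linarith
    qed
    then show False using nd by simp
  qed
  \<comment> \<open>By \<open>mono\<close> the wires that \<open>lo\<close> meets below
    \<open>hi\<close> form an initial block, of which \<open>m\<close> is the end.\<close>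
  define S where "S = {c. lo < c \<and> c < hi \<and> h lo hi < h lo c}"
  define m where "m = Max S"
  have "finite S" "S \<noteq> {}" using ex by (auto simp: S_def)
  then have mS: "m \<in> S" and mx: "\<And>c. c \<in> S \<Longrightarrow> c \<le> m" unfolding m_def by auto
  then have m: "lo < m" "m < hi" "h lo hi < h lo m" by (auto simp: S_def)
  have "m < b0" using mono[of b0 m] m b0 b0U by (cases m b0 rule: linorder_cases) auto
  then have mh: "m + 1 < hi" using b0 by auto
  have U: "h lo c < h lo hi" "h lo hi < h c hi" if "m < c" "c < hi" for c
    using mx[of c] betw[of lo c hi] that m W by (auto simp: S_def)
  \<comment> \<open>The alternative would make heights grow strictly around a cycle:
    \<open>hi - 1\<close> with \<open>hi\<close>, with \<open>lo + 1\<close>, with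
    \<open>lo\<close>, then \<open>lo\<close> with \<open>hi\<close>, and \<open>hi - 1\<close> with
    \<open>hi\<close> again.\<close>
  have dl: "dlast (lo + 1) hi"
  proof (rule ccontr)
    assume "\<not> dlast (lo + 1) hi"
    then have al': "alast (lo + 1) hi" using D by simp
    have l: "lo + 1 < hi - 1" "1 \<le> lo + 1" using m mh by auto
    have "h (hi-1) hi < h (lo+1) (hi-1)"
      using al' l unfolding alast_def by auto
    moreover have "h (lo+1) (hi-1) < h lo (hi-1)"
      using alast_less(1)[OF al W(1) W', of "lo+1" "hi-1"] l by auto
    moreover have "m < hi - 1" "hi - 1 < hi" using mh by auto
    ultimately show False using U[of "hi-1"] by linarith
  qed
  have hw: "h (m+1) hi < h c hi" if "m + 1 < c" "c < hi" for c
    using dlast_less(2)[OF dl _ W(2), of "m+1" c] that m W by auto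
  have P2: "(m, [lo, hi, m + 1]) \<in> GW lo hi"
    by (rule path_P2[OF W(1,2) m(1) mh m(3)]) (use U mono hw m mh in auto)
  have P4: "(m, [hi, lo, m + 1]) \<in> GW lo hi"
  proof (rule path_P4[OF W(1,2) m(1) mh m(3)])
    show "h lo hi < h lo c" if "lo < c" "c \<le> m" for c
      using mono[of c m] that m by (cases "c = m") auto
  qed (use U mh in auto)
  have P1: "(m, [lo, m + 1]) \<in> GW lo (hi - 1)"
    using alast_path[OF al W(1) W', of m] m mh by auto
  have P3: "(m, [hi, m + 1]) \<in> GW (lo + 1) hi"
    using dlast_path[OF dl _ W(2), of m] m mh by auto
  have eq: "pvec m [lo, hi, m + 1] + pvec m [hi, lo, m + 1] = pvec m [lo, m + 1] + pvec m [hi, m + 1]"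
    using m mh sym[of lo hi] by (simp add: algebra_simps)
  have V: "lo \<in> {1..M}" "hi \<in> {1..M}" "m \<in> {1..M}" "m + 1 \<in> {1..M}" using W m mh by auto
  have hr: "pvec m [lo, m + 1] \<in> B" "pvec m [hi, m + 1] \<in> B"
    using GW_GV[OF P1, of lo "hi-1"] GW_GV[OF P3, of "lo+1" hi] B by auto
  have hp: "pvec m [lo, hi, m + 1] \<in> GV 1 M" "pvec m [hi, lo, m + 1] \<in> GV 1 M"
    using GW_GV[OF P2 W(1,2)] GW_GV[OF P4 W(1,2)] by auto
  note ip = inner_left_distrib inner_diff_left e_inner
  \<comment> \<open>Neither of the two basis vectors has a component at the node of
    \<open>lo\<close> and \<open>hi\<close>, but this vector has component 1 there.\<close>
  have "pvec m [lo, hi, m + 1] \<bullet> e (h lo hi) = 0"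
    by (rule sum_of_two[OF hp hr eq]) (use m mh V in \<open>simp_all add: ip\<close>)
  then show False using m mh V by (simp add: ip)
qed

text \<open>The triples without \<open>a\<close> or without \<open>a + 3\<close> are ordered by
  hypothesis. What is left is the position of the node of \<open>a\<close> and \<open>a + 3\<close>
  on the wire \<open>a + 3\<close>: above \<open>a + 2\<close>, between \<open>a + 2\<close> and
  \<open>a + 1\<close>, or below \<open>a + 1\<close>. Each position admits a relation that
  \<open>exchange\<close> turns into a false equality of two vectors.\<close>

lemma four_wires:
  assumes W: "1 \<le> a" "a + 3 \<le> M"
    and B: "GV a (a + 2) \<subseteq> B" "GV (a + 1) (a + 3) \<subseteq> B"
    and dl: "dlast a (a + 2)" and al: "alast (a + 1) (a + 3)"
  shows False
proof -
  have e3: "a + 2 + 1 = a + 3" by simp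
  have o1: "h a (a+1) < h a (a+2)" "h a (a+2) < h (a+1) (a+2)"
    using dlast_less[OF dl, of a "a+1"] W by auto
  have o2: "h (a+2) (a+3) < h (a+1) (a+3)" "h (a+1) (a+3) < h (a+1) (a+2)"
    using alast_less[OF al, of "a+2" "a+3"] W by auto
  have S1: "(a + 2, [a + 1, a + 3]) \<in> GW (a + 1) (a + 3)"
    using alast_path[OF al, of "a+2"] W by (auto simp: numeral_eq_Suc)
  have Q2: "(a, [a + 2, a + 1]) \<in> GW a (a + 2)"
    using dlast_path[OF dl, of a] W by auto
  have "dlast (a + 2) (a + 3)" by (auto simp: dlast_def)
  from dlast_path[OF this, of "a+2"] have S2: "(a + 2, [a + 3]) \<in> GW (a + 2) (a + 3)"
    using W by (auto simp: numeral_eq_Suc)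
  have "dlast a (a + 1)" by (auto simp: dlast_def)
  from dlast_path[OF this, of a] have S2': "(a, [a + 1]) \<in> GW a (a + 1)"
    using W by auto
  note V = GW_GV[OF S1, of "a+1" "a+3"] GW_GV[OF Q2, of a "a+2"] GW_GV[OF S2, of "a+1" "a+3"] GW_GV[OF S2', of a "a+2"]
  have VB: "pvec (a + 2) [a + 1, a + 3] \<in> B" "pvec a [a + 2, a + 1] \<in> B" "pvec (a + 2) [a + 3] \<in> B" "pvec a [a + 1] \<in> B"
    using V B by auto
  note s0 = sym[of "a+1" a] sym[of "a+2" a] sym[of "a+3" a] sym[of "a+2" "a+1"] sym[of "a+3" "a+1"] sym[of "a+3" "a+2"]
  note s = s0 s0[simplified]
  have ne: "p \<noteq> q" if "p \<bullet> y \<noteq> q \<bullet> y" for p q y :: 'v using that by auto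
  consider "h a (a+3) < h (a+2) (a+3)" | "h (a+2) (a+3) < h a (a+3)" "h a (a+3) < h (a+1) (a+3)"
    | "h (a+2) (a+3) < h a (a+3)" "h (a+1) (a+3) < h a (a+3)"
    using betw[of a "a+2" "a+3"] betw[of a "a+1" "a+3"] W by force
  then show False
  proof cases
    case 1
    then have o3: "h a (a+2) < h a (a+3)" using betw[of a "a+2" "a+3"] W by auto
    have Q3: "(a, [a + 2, a + 3, a + 1]) \<in> GW a (a + 3)"
      by (rule path_Q3[OF W]) (use 1 o1 o2 o3 in auto)
    have "pvec a [a + 2, a + 3, a + 1] = pvec (a + 2) [a + 3]"
    proof (rule exchange[OF _ _ VB(1,3)])
      show "pvec (a + 2) [a + 1, a + 3] \<noteq> pvec (a + 2) [a + 3]"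
        by (rule ne[of _ "e (h (a+2) (a+3))"]) (use W in \<open>simp add: inner_left_distrib inner_diff_left e_inner\<close>)
      show "pvec a [a + 2, a + 3, a + 1] + pvec (a + 2) [a + 1, a + 3] = pvec a [a + 2, a + 1] + pvec (a + 2) [a + 3]"
        by (simp add: s algebra_simps)
    qed (use GW_GV[OF Q3, of 1 M] VB B_sub W in auto)
    moreover have "pvec a [a + 2, a + 3, a + 1] \<noteq> pvec (a + 2) [a + 3]"
      by (rule ne[of _ "e (h a (a+2))"]) (use W in \<open>simp add: inner_left_distrib inner_diff_left e_inner\<close>)
    ultimately show False by simp
  next
    case 2
    then have o3: "h a (a+3) < h a (a+2)" "h a (a+1) < h a (a+3)"
      using betw[of a "a+2" "a+3"] betw[of a "a+1" "a+3"] W by auto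
    have P: "(a, [a + 3, a + 1]) \<in> GW a (a + 3)" by (rule path_mid1[OF W 2(2,1)])
    have Q: "(a + 2, [a, a + 3]) \<in> GW a (a + 3)" by (rule path_mid2[OF W o3(2,1)])
    have "pvec a [a + 3, a + 1] = pvec a [a + 2, a + 1]"
    proof (rule exchange[OF _ _ VB(1,2)])
      show "pvec (a + 2) [a + 1, a + 3] \<noteq> pvec a [a + 2, a + 1]"
        by (rule ne[of _ "e (h a (a+2))"]) (use W in \<open>simp add: inner_left_distrib inner_diff_left e_inner\<close>)
      show "pvec a [a + 3, a + 1] + pvec (a + 2) [a + 1, a + 3] = pvec (a + 2) [a, a + 3] + pvec a [a + 2, a + 1]"
        by (simp add: s algebra_simps)
    qed (use GW_GV[OF P, of 1 M] GW_GV[OF Q, of 1 M] W in auto)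
    moreover have "pvec a [a + 3, a + 1] \<noteq> pvec a [a + 2, a + 1]"
      by (rule ne[of _ "e (h a (a+2))"]) (use W in \<open>simp add: inner_left_distrib inner_diff_left e_inner\<close>)
    ultimately show False by simp
  next
    case 3
    then have o3: "h a (a+3) < h a (a+1)" "h (a+1) (a+3) < h a (a+1)"
      using betw[of a "a+1" "a+3"] W by auto
    have Q3: "(a + 2, [a, a + 1, a + 3]) \<in> GW a (a + 3)"
      by (rule path_Q3'[OF W]) (use 3 o1 o2 o3 in auto)
    have "pvec (a + 2) [a, a + 1, a + 3] = pvec a [a + 1]"
    proof (rule exchange[OF _ _ VB(2,4)])
      show "pvec a [a + 2, a + 1] \<noteq> pvec a [a + 1]"
        by (rule ne[of _ "e (h a (a+1))"]) (use W in \<open>simp add: inner_left_distrib inner_diff_left e_inner\<close>)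
      show "pvec (a + 2) [a, a + 1, a + 3] + pvec a [a + 2, a + 1] = pvec (a + 2) [a + 1, a + 3] + pvec a [a + 1]"
        by (simp add: s algebra_simps)
    qed (use GW_GV[OF Q3, of 1 M] VB B_sub W in auto)
    moreover have "pvec (a + 2) [a, a + 1, a + 3] \<noteq> pvec a [a + 1]"
      by (rule ne[of _ "e (h a (a+2))"]) (use W in \<open>simp add: inner_left_distrib inner_diff_left e_inner\<close>)
    ultimately show False by simp
  qed
qed

text \<open>For three wires \<open>betw\<close> makes one of the two conditions true. If
  \<open>hi\<close> is last in the upper interval as well, only \<open>hi - 1\<close> could violate
  \<open>dlast lo hi\<close>, but then \<open>lo + 1\<close> does so too. If \<open>lo + 1\<close>
  is last in the upper interval, five wires would force both orders on \<open>lo + 1\<close>,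
  \<open>lo + 2\<close>, \<open>hi - 1\<close>; so there are four.\<close>

lemma not_dlast_case:
  assumes W: "1 \<le> lo" "hi \<le> M" "lo + 2 \<le> hi"
    and B: "GV lo (hi - 1) \<subseteq> B" "GV (lo + 1) hi \<subseteq> B"
    and dl: "dlast lo (hi - 1)" and D: "dlast (lo + 1) hi \<or> alast (lo + 1) hi"
    and nd: "\<not> dlast lo hi" and na: "\<not> alast lo hi"
  shows False
proof -
  have W': "hi - 1 \<le> M" using W by auto
  have three: "hi \<noteq> lo + 2"
  proof
    assume hi: "hi = lo + 2"
    have "\<not> h lo (lo+1) < h (lo+1) hi" 
    proof
      assume "h lo (lo+1) < h (lo+1) hi"
      moreover have "a = lo \<and> b = lo + 1" if "lo \<le> a" "a < b" "b < hi" for a b using that hi by auto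
      ultimately have "dlast lo hi" unfolding dlast_def by blast
      then show False using nd by simp
    qed
    then have "h (lo+1) hi < h lo (lo+1)" using betw[of lo "lo+1" hi] hi W by auto
    moreover have "b = lo + 1 \<and> c = hi" if "lo < b" "b < c" "c \<le> hi" for b c using that hi by auto
    ultimately have "alast lo hi" unfolding alast_def by blast
    then show False using na by simp
  qed
  show False
  proof (cases "dlast (lo + 1) hi")
    case True
    obtain b where b: "lo < b" "b < hi" "\<not> h lo b < h b hi"
    proof -
      obtain a b where ab: "lo \<le> a" "a < b" "b < hi" "\<not> h a b < h b hi" using nd unfolding dlast_def by blast
      then have "a = lo" using True unfolding dlast_def by (metis Suc_eq_plus1 Suc_leI le_neq_implies_less)
      then show ?thesis using that ab by auto
    qed
    have no: "\<not> (lo < b \<and> b < hi - 1 \<and> \<not> h lo b < h b hi)" for b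
    proof
      assume b: "lo < b \<and> b < hi - 1 \<and> \<not> h lo b < h b hi"
      have "h lo b < h b (hi - 1)" using dl b unfolding dlast_def by auto
      moreover have "h b (hi - 1) < h b hi" using dlast_less(1)[OF True _ W(2), of b "hi - 1"] b by auto
      ultimately show False using b by auto
    qed
    then have bh: "b = hi - 1" using b no[of b] by linarith
    have "h (lo+1) hi < h b hi" using dlast_less(2)[OF True _ W(2), of "lo+1" b] bh b three by auto
    also have "h b hi < h lo hi" using betw[of lo b hi] b W by auto
    finally have "\<not> h lo (lo+1) < h (lo+1) hi" using betw[of lo "lo+1" hi] W by auto
    then show False using no[of "lo+1"] three W by auto
  next
    case False
    then have al: "alast (lo + 1) hi" using D by simp
    have "hi = lo + 3"
    proof (rule ccontr)
      assume "hi \<noteq> lo + 3"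
      then have l: "lo + 3 < hi" using three W by auto
      have "h (lo+1) (lo+2) < h (lo+2) (hi-1)" using dl l unfolding dlast_def by auto
      moreover have "h (lo+2) (hi-1) < h (lo+1) (lo+2)" using al l unfolding alast_def by auto
      ultimately show False by simp
    qed
    then show False using four_wires[of lo] W B dl al by simp
  qed
qed

theorem good_if_closed:
  "closed lo (lo + d) \<Longrightarrow> 1 \<le> lo \<Longrightarrow> lo + d \<le> M \<Longrightarrow> good d lo"
proof (induction d arbitrary: lo)
  case (Suc d)
  let ?hi = "lo + Suc d"
  have cl: "closed lo (?hi - 1)" "closed (lo + 1) ?hi"
    using closed_hi[of lo ?hi] closed_lo[of lo ?hi] Suc.prems by auto
  have g: "good d lo" "good d (lo + 1)"
    using Suc.IH[of lo] Suc.IH[of "lo + 1"] cl Suc.prems by auto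
  have sub: "GV lo (?hi - 1) \<subseteq> B" "GV (lo + 1) ?hi \<subseteq> B"
    using good_sub_B[OF g(1)] good_sub_B[OF g(2)] cl Suc.prems by auto
  have "dlast lo ?hi \<or> alast lo ?hi"
  proof (cases d)
    case 0
    then show ?thesis by (auto simp: dlast_def)
  next
    case (Suc d')
    have "dlast lo (?hi - 1) \<or> alast lo (?hi - 1)" "dlast (lo + 1) ?hi \<or> alast (lo + 1) ?hi"
      using g Suc by auto
    then show ?thesis
      using not_alast_case[of lo ?hi] not_dlast_case[of lo ?hi] Suc.prems sub Suc by auto
  qed
  then show ?case using g by auto
qed auto

lemma closed_all: "closed 1 M"
  using B_sub by (auto simp: closed_def)

end

section \<open>Cones and facets\<close>

lemma tri_Suc: "tri (Suc k) = tri k + k"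
proof (cases k)
  case (Suc j)
  have "Suc k * k = k * (k - 1) + 2 * k" using Suc by (simp add: algebra_simps)
  then show ?thesis by (simp add: tri_def)
qed (simp add: tri_def)

lemma tri_mono: "k \<le> l \<Longrightarrow> tri k \<le> tri l"
  by (rule lift_Suc_mono_le[of tri]) (auto simp: tri_Suc)

text \<open>The inequalities of \<open>std_cone\<close> with the coordinates renamed by
  \<open>f\<close>; counted from 0, block \<open>k\<close> starts at \<open>tri k\<close>.\<close>

definition chains :: "(nat \<Rightarrow> nat) \<Rightarrow> nat \<Rightarrow> (nat \<Rightarrow> real) \<Rightarrow> bool" where
  "chains f d x \<longleftrightarrow> (\<forall>k\<in>{1..d}. (\<forall>r. r + 1 < k \<longrightarrow> x (f (tri k + r)) \<ge> x (f (tri k + r + 1)))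
     \<and> x (f (tri k + k - 1)) \<ge> 0)"

lemma chains_cong:
  assumes "\<And>j. j < tri (Suc d) \<Longrightarrow> x (f j) = x' (f' j)"
  shows "chains f d x \<longleftrightarrow> chains f' d x'"
proof -
  have eq: "x (f (tri k + r)) = x' (f' (tri k + r))" if "k \<in> {1..d}" "r < k" for k r
    using tri_mono[of "Suc k" "Suc d"] that by (intro assms) (auto simp: tri_Suc[of k])
  have "(\<forall>r. r + 1 < k \<longrightarrow> x (f (tri k + r)) \<ge> x (f (tri k + r + 1))) \<and> x (f (tri k + k - 1)) \<ge> 0 \<longleftrightarrow>
     (\<forall>r. r + 1 < k \<longrightarrow> x' (f' (tri k + r)) \<ge> x' (f' (tri k + r + 1))) \<and> x' (f' (tri k + k - 1)) \<ge> 0"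
    if k: "k \<in> {1..d}" for k
  proof -
    have "x (f (tri k + k - 1)) = x' (f' (tri k + k - 1))" using eq[OF k, of "k - 1"] k by simp
    moreover have "x (f (tri k + r)) = x' (f' (tri k + r)) \<and> x (f (tri k + r + 1)) = x' (f' (tri k + r + 1))" if "r + 1 < k" for r
      using eq[OF k, of r] eq[OF k, of "r + 1"] that by simp
    ultimately show ?thesis by auto
  qed
  then show ?thesis unfolding chains_def by (intro ball_cong refl) blast
qed

lemma chains_Suc:
  assumes "F = (\<lambda>j. if j < tri (Suc d) then f j else g (j - tri (Suc d)))"
  shows "chains F (Suc d) x \<longleftrightarrow> chains f d x \<and> (\<forall>r<d. x (g r) \<ge> x (g (r + 1))) \<and> x (g d) \<ge> 0"
proof -
  have 1: "chains F d x \<longleftrightarrow> chains f d x" by (rule chains_cong) (simp add: assms)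
  have F: "F (tri (Suc d) + r) = g r" for r by (simp add: assms)
  have s: "{1..Suc d} = insert (Suc d) {1..d}" by auto
  have "chains F (Suc d) x \<longleftrightarrow> chains F d x \<and>
    (\<forall>r. r + 1 < Suc d \<longrightarrow> x (F (tri (Suc d) + r)) \<ge> x (F (tri (Suc d) + (r + 1)))) \<and> x (F (tri (Suc d) + d)) \<ge> 0"
    unfolding chains_def s ball_insert add.assoc by auto
  then show ?thesis unfolding 1 F by auto
qed

lemma bij_betw_append:
  fixes T m :: nat
  assumes "bij_betw f {..<T} S" "bij_betw g {..<m} S'" "S \<inter> S' = {}"
  shows "bij_betw (\<lambda>j. if j < T then f j else g (j - T)) {..<T + m} (S \<union> (S' :: nat set))"
proof -
  let ?f = "\<lambda>j. if j < T then f j else g (j - T)"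
  have 1: "bij_betw ?f {..<T} S" by (rule bij_betw_cong[THEN iffD1, OF _ assms(1)]) auto
  have "bij_betw (\<lambda>j. j - T) {T..<T+m} {..<m}"
    by (rule bij_betw_byWitness[where f' = "\<lambda>j. j + T"]) auto
  then have "bij_betw (g \<circ> (\<lambda>j. j - T)) {T..<T+m} S'" using assms(2) by (rule bij_betw_trans)
  then have "bij_betw ?f {T..<T+m} S'" by (rule bij_betw_cong[THEN iffD1, rotated]) auto
  then have "bij_betw ?f ({..<T} \<union> {T..<T+m}) (S \<union> S')" using bij_betw_combine[OF 1 _ assms(3)] by auto
  moreover have "{..<T} \<union> {T..<T+m} = {..<T+m}" by auto
  ultimately show ?thesis by simp
qed

section \<open>The cone of an interval from which an outer wire is removed\<close>

context arrangement
begin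

definition nodes :: "nat \<Rightarrow> nat \<Rightarrow> nat set" where
  "nodes lo hi = {h a b | a b. lo \<le> a \<and> a < b \<and> b \<le> hi}"

text \<open>The only path through \<open>hi\<close> for a given \<open>k\<close> has the form
  \<open>x (h k hi) - x (h (k + 1) hi)\<close>, or just \<open>x (h k hi)\<close> when
  \<open>k + 1 = hi\<close>. Together these forms are one chain.\<close>

lemma dlast_cone:
  assumes dl: "dlast lo hi" and lo: "1 \<le> lo" "hi \<le> M" "lo < hi"
  shows "(\<forall>(k, bs)\<in>GW lo hi. val x k bs \<ge> 0) \<longleftrightarrow> (\<forall>(k, bs)\<in>GW lo (hi - 1). val x k bs \<ge> 0)
     \<and> (\<forall>a. lo \<le> a \<and> a + 1 < hi \<longrightarrow> x (h a hi) \<ge> x (h (a + 1) hi)) \<and> x (h (hi - 1) hi) \<ge> 0"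
    (is "?L \<longleftrightarrow> ?R")
proof
  assume L: ?L
  then have p: "val x k (if k + 1 = hi then [hi] else [hi, k + 1]) \<ge> 0" if "lo \<le> k" "k < hi" for k
    using dlast_path[OF dl lo(1,2) that] by blast
  have "x (h a hi) \<ge> x (h (a + 1) hi)" if "lo \<le> a" "a + 1 < hi" for a
    using p[of a] that sym[of hi "a + 1"] by auto
  moreover have "x (h (hi - 1) hi) \<ge> 0" using p[of "hi - 1"] lo by auto
  ultimately show ?R using L GW_mono[of lo lo "hi - 1" hi] by auto
next
  assume R: ?R
  show ?L
  proof clarify
    fix k bs assume g: "(k, bs) \<in> GW lo hi"
    show "val x k bs \<ge> 0"
    proof (cases "hi \<in> set bs")
      case True
      have "k < hi" "lo \<le> k" using g by (auto simp: GW_def)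
      then show ?thesis using dlast_class[OF dl lo(1,2) g True] R sym[of hi "k+1"] by auto
    next
      case False
      then show ?thesis using GW_avoid_hi[OF g] R by auto
    qed
  qed
qed

lemma alast_cone:
  assumes al: "alast lo hi" and lo: "1 \<le> lo" "hi \<le> M" "lo < hi"
  shows "(\<forall>(k, bs)\<in>GW lo hi. val x k bs \<ge> 0) \<longleftrightarrow> (\<forall>(k, bs)\<in>GW (lo + 1) hi. val x k bs \<ge> 0)
     \<and> (\<forall>a. lo < a \<and> a + 1 \<le> hi \<longrightarrow> x (h lo (a + 1)) \<ge> x (h lo a)) \<and> x (h lo (lo + 1)) \<ge> 0"
    (is "?L \<longleftrightarrow> ?R")
proof
  assume L: ?L
  then have p: "val x k (if k = lo then [k + 1] else [lo, k + 1]) \<ge> 0" if "lo \<le> k" "k < hi" for k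
    using alast_path[OF al lo(1,2) that] by blast
  have "x (h lo (a + 1)) \<ge> x (h lo a)" if "lo < a" "a + 1 \<le> hi" for a
    using p[of a] that sym[of lo a] by auto
  moreover have "x (h lo (lo + 1)) \<ge> 0" using p[of lo] lo by auto
  ultimately show ?R using L GW_mono[of lo "lo + 1" hi hi] by auto
next
  assume R: ?R
  show ?L
  proof clarify
    fix k bs assume g: "(k, bs) \<in> GW lo hi"
    show "val x k bs \<ge> 0"
    proof (cases "lo = k \<or> lo \<in> set bs")
      case True
      have "k < hi" "lo \<le> k" using g by (auto simp: GW_def)
      then show ?thesis using alast_class[OF al lo(1,2) g True] R sym[of k lo] by auto
    next
      case False
      then show ?thesis using GW_avoid_lo[OF g] R by auto
    qed
  qed
qed

lemma good_chains:
  "good d lo \<Longrightarrow> 1 \<le> lo \<Longrightarrow> lo + d \<le> M \<Longrightarrow>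
   \<exists>f. bij_betw f {..<tri (Suc d)} (nodes lo (lo + d)) \<and>
     (\<forall>x. (\<forall>(k, bs)\<in>GW lo (lo + d). val x k bs \<ge> 0) \<longleftrightarrow> chains f d x)"
proof (induction d arbitrary: lo)
  case 0
  have "nodes lo lo = {}" "GW lo lo = {}" by (auto simp: nodes_def GW_def)
  then show ?case by (auto simp: chains_def tri_def)
next
  case (Suc d)
  let ?hi = "lo + Suc d"
  have l: "1 \<le> lo" "?hi \<le> M" "lo < ?hi" using Suc.prems by auto
  have t: "tri (Suc (Suc d)) = tri (Suc d) + Suc d" by (rule tri_Suc)
  from Suc.prems(1) consider "dlast lo ?hi" "good d lo" | "alast lo ?hi" "good d (lo + 1)" by auto
  then show ?case
  proof cases
    case 1
    have le1: "lo + d \<le> M" using l by simp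
    obtain f where f: "bij_betw f {..<tri (Suc d)} (nodes lo (lo + d))"
      "\<And>x. (\<forall>(k, bs)\<in>GW lo (lo + d). val x k bs \<ge> 0) \<longleftrightarrow> chains f d x"
      using Suc.IH[OF 1(2)] l(1) le1 by blast
    \<comment> \<open>The new block lists the nodes of \<open>hi\<close> from \<open>lo\<close>
      upwards, the largest coordinate of the chain being the one at \<open>lo\<close>.\<close>
    define g where "g r = h (lo + r) ?hi" for r
    define F where "F = (\<lambda>j. if j < tri (Suc d) then f j else g (j - tri (Suc d)))"
    have "inj_on g {..<Suc d}"
    proof (rule inj_onI)
      fix r s assume "r \<in> {..<Suc d}" "s \<in> {..<Suc d}" "g r = g s"
      show "r = s"
      proof (rule ccontr)
        assume "r \<noteq> s"
        have "h ?hi (lo + r) \<noteq> h ?hi (lo + s)"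
          by (rule neq) (use l \<open>r \<in> _\<close> \<open>s \<in> _\<close> \<open>r \<noteq> s\<close> in auto)
        then show False using \<open>g r = g s\<close> sym[of ?hi "lo + r"] sym[of ?hi "lo + s"] by (simp add: g_def)
      qed
    qed
    then have bg: "bij_betw g {..<Suc d} (g ` {..<Suc d})" by (simp add: bij_betw_def)
    have "nodes lo (lo + d) \<inter> g ` {..<Suc d} = {}"
    proof (rule ccontr)
      assume "nodes lo (lo + d) \<inter> g ` {..<Suc d} \<noteq> {}"
      then obtain s where "s \<in> nodes lo (lo + d)" "s \<in> g ` {..<Suc d}" by auto
      then obtain a b r where ab: "lo \<le> a" "a < b" "b \<le> lo + d" "r < Suc d" "h a b = h (lo + r) ?hi"
        by (auto simp: nodes_def g_def)
      have "{a, b} = {lo + r, ?hi}" by (rule inj) (use ab l in auto)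
      then show False using ab by (auto simp: doubleton_eq_iff)
    qed
    from bij_betw_append[OF f(1) bg this] 
    have bF: "bij_betw F {..<tri (Suc (Suc d))} (nodes lo (lo + d) \<union> g ` {..<Suc d})"
      unfolding t F_def .
    have "nodes lo (lo + d) \<union> g ` {..<Suc d} = nodes lo ?hi"
    proof (intro set_eqI iffI)
      fix s assume "s \<in> nodes lo ?hi"
      then obtain a b where ab: "s = h a b" "lo \<le> a" "a < b" "b \<le> ?hi" by (auto simp: nodes_def)
      show "s \<in> nodes lo (lo + d) \<union> g ` {..<Suc d}"
      proof (cases "b = ?hi")
        case True
        then have "s = g (a - lo)" "a - lo < Suc d" using ab by (auto simp: g_def)
        then show ?thesis by auto
      next
        case False
        then have "b \<le> lo + d" using ab by auto
        then show ?thesis using ab unfolding nodes_def by blast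
      qed
    next
      fix s assume s: "s \<in> nodes lo (lo + d) \<union> g ` {..<Suc d}"
      show "s \<in> nodes lo ?hi"
      proof (cases "s \<in> nodes lo (lo + d)")
        case True
        then obtain a b where "s = h a b" "lo \<le> a" "a < b" "b \<le> lo + d" by (auto simp: nodes_def)
        moreover then have "b \<le> ?hi" by simp
        ultimately show ?thesis unfolding nodes_def by blast
      next
        case False
        then obtain r where "r < Suc d" "s = h (lo + r) ?hi" using s by (auto simp: g_def)
        moreover then have "lo + r < ?hi" "lo \<le> lo + r" by auto
        ultimately show ?thesis unfolding nodes_def by blast
      qed
    qed
    moreover have "(\<forall>(k, bs)\<in>GW lo ?hi. val x k bs \<ge> 0) \<longleftrightarrow> chains F (Suc d) x" for x
    proof -
      have "(\<forall>a. lo \<le> a \<and> a + 1 < ?hi \<longrightarrow> x (h a ?hi) \<ge> x (h (a + 1) ?hi)) \<longleftrightarrow> (\<forall>r<d. x (g r) \<ge> x (g (r + 1)))"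
      proof
        assume a: "\<forall>r<d. x (g r) \<ge> x (g (r + 1))"
        show "\<forall>a. lo \<le> a \<and> a + 1 < ?hi \<longrightarrow> x (h a ?hi) \<ge> x (h (a + 1) ?hi)"
        proof (intro allI impI)
          fix b assume b: "lo \<le> b \<and> b + 1 < ?hi"
          then have "b - lo < d" "lo + (b - lo) = b" "lo + (b - lo + 1) = b + 1" by auto
          then show "x (h b ?hi) \<ge> x (h (b + 1) ?hi)" using a[rule_format, of "b - lo"] unfolding g_def by simp
        qed
      qed (auto simp: g_def)
      moreover have "h (?hi - 1) ?hi = g d" "?hi - 1 = lo + d" by (simp_all add: g_def)
      ultimately show ?thesis
        unfolding chains_Suc[OF F_def] using dlast_cone[OF 1(1) l, of x] f(2)[of x] by (simp only:)
    qed
    ultimately show ?thesis using bF by (intro exI[of _ F]) simp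
  next
    case 2
    have le1: "1 \<le> lo + 1" "?hi \<le> M" and e: "lo + 1 + d = ?hi" using l by simp_all
    obtain f where f: "bij_betw f {..<tri (Suc d)} (nodes (lo + 1) ?hi)"
      "\<And>x. (\<forall>(k, bs)\<in>GW (lo + 1) ?hi. val x k bs \<ge> 0) \<longleftrightarrow> chains f d x"
      using Suc.IH[OF 2(2)] le1 unfolding e by blast
    \<comment> \<open>Along \<open>lo\<close> the largest coordinate of the chain is the one at the
      node with \<open>hi\<close>, hence the reversed enumeration.\<close>
    define g where "g r = h lo (?hi - r)" for r
    define F where "F = (\<lambda>j. if j < tri (Suc d) then f j else g (j - tri (Suc d)))"
    have "inj_on g {..<Suc d}"
    proof (rule inj_onI)
      fix r s assume "r \<in> {..<Suc d}" "s \<in> {..<Suc d}" "g r = g s"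
      show "r = s"
      proof (rule ccontr)
      assume "r \<noteq> s"
      have "h lo (?hi - r) \<noteq> h lo (?hi - s)"
        by (rule neq) (use l \<open>r \<in> _\<close> \<open>s \<in> _\<close> \<open>r \<noteq> s\<close> in auto)
      then show False using \<open>g r = g s\<close> by (simp add: g_def)
    qed
    qed
    then have bg: "bij_betw g {..<Suc d} (g ` {..<Suc d})" by (simp add: bij_betw_def)
    have "nodes (lo + 1) ?hi \<inter> g ` {..<Suc d} = {}"
    proof (rule ccontr)
      assume "nodes (lo + 1) ?hi \<inter> g ` {..<Suc d} \<noteq> {}"
      then obtain s where "s \<in> nodes (lo + 1) ?hi" "s \<in> g ` {..<Suc d}" by auto
      then obtain a b r where ab: "lo + 1 \<le> a" "a < b" "b \<le> ?hi" "r < Suc d" "h a b = h lo (?hi - r)"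
        by (auto simp: nodes_def g_def)
      have "{a, b} = {lo, ?hi - r}" by (rule inj) (use ab l in auto)
      then show False using ab by (auto simp: doubleton_eq_iff)
    qed
    from bij_betw_append[OF f(1) bg this] 
    have bF: "bij_betw F {..<tri (Suc (Suc d))} (nodes (lo + 1) ?hi \<union> g ` {..<Suc d})"
      unfolding t F_def .
    have "nodes (lo + 1) ?hi \<union> g ` {..<Suc d} = nodes lo ?hi"
    proof (intro set_eqI iffI)
      fix s assume "s \<in> nodes lo ?hi"
      then obtain a b where ab: "s = h a b" "lo \<le> a" "a < b" "b \<le> ?hi" by (auto simp: nodes_def)
      show "s \<in> nodes (lo + 1) ?hi \<union> g ` {..<Suc d}"
      proof (cases "a = lo")
        case True
        then have "s = g (?hi - b)" "?hi - b < Suc d" using ab by (auto simp: g_def)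
        then show ?thesis by blast
      next
        case False
        then have "lo + 1 \<le> a" using ab by auto
        then show ?thesis using ab unfolding nodes_def by blast
      qed
    next
      fix s assume s: "s \<in> nodes (lo + 1) ?hi \<union> g ` {..<Suc d}"
      show "s \<in> nodes lo ?hi"
      proof (cases "s \<in> nodes (lo + 1) ?hi")
        case True
        then obtain a b where "s = h a b" "lo + 1 \<le> a" "a < b" "b \<le> ?hi" by (auto simp: nodes_def)
        moreover then have "lo \<le> a" by simp
        ultimately show ?thesis unfolding nodes_def by blast
      next
        case False
        then obtain r where "r < Suc d" "s = h lo (?hi - r)" using s by (auto simp: g_def)
        moreover then have "lo < ?hi - r" "?hi - r \<le> ?hi" by auto
        ultimately show ?thesis unfolding nodes_def by blast
      qed
    qed
    moreover have "(\<forall>(k, bs)\<in>GW lo ?hi. val x k bs \<ge> 0) \<longleftrightarrow> chains F (Suc d) x" for x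
    proof -
      have "(\<forall>a. lo < a \<and> a + 1 \<le> ?hi \<longrightarrow> x (h lo (a + 1)) \<ge> x (h lo a)) \<longleftrightarrow> (\<forall>r<d. x (g r) \<ge> x (g (r + 1)))"
      proof
        assume a: "\<forall>r<d. x (g r) \<ge> x (g (r + 1))"
        show "\<forall>a. lo < a \<and> a + 1 \<le> ?hi \<longrightarrow> x (h lo (a + 1)) \<ge> x (h lo a)"
        proof (intro allI impI)
          fix b assume b: "lo < b \<and> b + 1 \<le> ?hi"
          then have "?hi - (b + 1) < d" "?hi - (?hi - (b + 1)) = b + 1" "?hi - (?hi - (b + 1) + 1) = b" by auto
          then show "x (h lo (b + 1)) \<ge> x (h lo b)" using a[rule_format, of "?hi - (b + 1)"] unfolding g_def by simp
        qed
      next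
        assume a: "\<forall>a. lo < a \<and> a + 1 \<le> ?hi \<longrightarrow> x (h lo (a + 1)) \<ge> x (h lo a)"
        show "\<forall>r<d. x (g r) \<ge> x (g (r + 1))"
        proof (intro allI impI)
          fix r assume r: "r < d"
          have "?hi - r = (?hi - (r + 1)) + 1" using r by auto
          moreover have "lo < ?hi - (r + 1)" using r by auto
          ultimately show "x (g r) \<ge> x (g (r + 1))" using a[rule_format, of "?hi - (r + 1)"] unfolding g_def by simp
        qed
      qed
      moreover have "h lo (lo + 1) = g d" by (simp add: g_def)
      ultimately show ?thesis
        unfolding chains_Suc[OF F_def] using alast_cone[OF 2(1) l, of x] f(2)[of x] by (simp only:)
    qed
    ultimately show ?thesis using bF by (intro exI[of _ F]) simp
  qed
qed

end

section \<open>Facets of polyhedral cones\<close>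

definition dual_cone :: "'a::euclidean_space set \<Rightarrow> 'a set" where
  "dual_cone V = {x. \<forall>a\<in>V. 0 \<le> a \<bullet> x}"

lemma card_facets_irredundant:
  fixes V :: "'a::euclidean_space set"
  assumes fin: "finite V" and x0: "\<And>a. a \<in> V \<Longrightarrow> 0 < a \<bullet> x0"
    and irr: "\<And>b. b \<in> V \<Longrightarrow> \<exists>z. b \<bullet> z < 0 \<and> (\<forall>a\<in>V - {b}. 0 \<le> a \<bullet> z)"
  shows "card {F. F facet_of dual_cone V} = card V"
proof -
  let ?S = "dual_cone V"
  define H where "H v = {x. - v \<bullet> x \<le> 0}" for v :: 'a
  obtain z where z: "\<And>b. b \<in> V \<Longrightarrow> b \<bullet> z b < 0" "\<And>b a. b \<in> V \<Longrightarrow> a \<in> V \<Longrightarrow> a \<noteq> b \<Longrightarrow> 0 \<le> a \<bullet> z b"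
  proof -
    have "\<forall>b\<in>V. \<exists>z. b \<bullet> z < 0 \<and> (\<forall>a\<in>V - {b}. 0 \<le> a \<bullet> z)" using irr by blast
    from bchoice[OF this] show ?thesis using that by blast
  qed
  have injH: "inj_on H V"
  proof (rule inj_onI)
    fix a b assume "a \<in> V" "b \<in> V" "H a = H b"
    moreover have "z b \<notin> H b" using z(1)[of b] \<open>b \<in> V\<close> by (simp add: H_def)
    moreover have "a \<noteq> b \<Longrightarrow> z b \<in> H a" using z(2)[of b a] \<open>a \<in> V\<close> \<open>b \<in> V\<close> by (simp add: H_def)
    ultimately show "a = b" by blast
  qed
  \<comment> \<open>The explicit description of facets expects the normal vector as a function of
    the half-space, so \<open>H\<close> has to be inverted.\<close>
  define g where "g = the_inv_into V H"
  have g: "g (H v) = v" if "v \<in> V" for v using the_inv_into_f_f[OF injH that] by (simp add: g_def)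
  have "open (\<Inter>a\<in>V. {x. 0 < a \<bullet> x})"
    using fin by (intro open_INT) (auto intro: open_halfspace_gt)
  moreover have "(\<Inter>a\<in>V. {x. 0 < a \<bullet> x}) \<subseteq> ?S" by (auto simp: dual_cone_def intro: less_imp_le)
  ultimately have "x0 \<in> interior ?S" using x0 by (intro interiorI) auto
  then have aff: "affine hull ?S = UNIV" by (intro affine_hull_nonempty_interior) auto
  have SH: "?S = affine hull ?S \<inter> \<Inter>(H ` V)" unfolding aff by (auto simp: dual_cone_def H_def)
  have facet: "C facet_of ?S \<longleftrightarrow> (\<exists>h. h \<in> H ` V \<and> C = ?S \<inter> {x. - g h \<bullet> x = 0})" for C
  proof (rule facet_of_polyhedron_explicit[OF _ SH])
    show "finite (H ` V)" using fin by simp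
    show "- g h \<noteq> 0 \<and> h = {x. - g h \<bullet> x \<le> 0}" if h: "h \<in> H ` V" for h
    proof -
      obtain v where v: "v \<in> V" "h = H v" using h by auto
      have "v \<noteq> 0" using x0[OF v(1)] by auto
      then show ?thesis using v g[OF v(1)] by (simp add: H_def)
    qed
    show "?S \<subset> affine hull ?S \<inter> \<Inter>F'" if F': "F' \<subset> H ` V" for F'
    proof -
      obtain v where v: "v \<in> V" "H v \<notin> F'" using F' by auto
      have "z v \<in> \<Inter>F'"
      proof
        fix h assume "h \<in> F'"
        then obtain a where "a \<in> V" "h = H a" "a \<noteq> v" using F' v by auto
        then show "z v \<in> h" using z(2)[of v a] v by (simp add: H_def)
      qed
      moreover have "z v \<notin> ?S" using z(1)[OF v(1)] v by (auto simp: dual_cone_def not_le)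
      moreover have "?S \<subseteq> \<Inter>(H ` V)" using SH by blast
      then have "?S \<subseteq> \<Inter>F'" using F' by blast
      ultimately show ?thesis unfolding aff by auto
    qed
  qed
  have "{F. F facet_of ?S} = (\<lambda>v. ?S \<inter> {x. v \<bullet> x = 0}) ` V"
  proof (intro set_eqI iffI)
    fix F assume "F \<in> {F. F facet_of ?S}"
    then obtain v where "v \<in> V" "F = ?S \<inter> {x. - g (H v) \<bullet> x = 0}" using facet by blast
    then show "F \<in> (\<lambda>v. ?S \<inter> {x. v \<bullet> x = 0}) ` V" using g by auto
  next
    fix F assume "F \<in> (\<lambda>v. ?S \<inter> {x. v \<bullet> x = 0}) ` V"
    then obtain v where v: "v \<in> V" "F = ?S \<inter> {x. v \<bullet> x = 0}" by blast
    then have "F = ?S \<inter> {x. - g (H v) \<bullet> x = 0}" using g by auto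
    then show "F \<in> {F. F facet_of ?S}" using facet v(1) by blast
  qed
  moreover have "inj_on (\<lambda>v. ?S \<inter> {x. v \<bullet> x = 0}) V"
  proof (rule inj_onI, rule ccontr)
    fix a b assume a: "a \<in> V" "b \<in> V" "?S \<inter> {x. a \<bullet> x = 0} = ?S \<inter> {x. b \<bullet> x = 0}" "a \<noteq> b"
    \<comment> \<open>the point where the segment from \<^term>\<open>x0\<close> to \<^term>\<open>z b\<close> leaves the cone lies on a single facet\<close>
    define y where "y = (- (b \<bullet> z b)) *\<^sub>R x0 + (b \<bullet> x0) *\<^sub>R z b"
    have p: "0 < - (b \<bullet> z b)" "0 < b \<bullet> x0" using z(1) x0 a by auto
    have cy_eq: "c \<bullet> y = (- (b \<bullet> z b)) * (c \<bullet> x0) + (b \<bullet> x0) * (c \<bullet> z b)" for c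
      unfolding y_def inner_right_distrib inner_scaleR_right by (rule refl)
    have by0: "b \<bullet> y = 0" unfolding cy_eq by simp
    have cy: "0 < c \<bullet> y" if "c \<in> V" "c \<noteq> b" for c
      unfolding cy_eq
      using mult_pos_pos[OF p(1) x0[OF that(1)]] mult_nonneg_nonneg[OF less_imp_le[OF p(2)] z(2)[OF a(2) that]]
      by linarith
    have "0 \<le> c \<bullet> y" if "c \<in> V" for c using by0 cy[OF that] by (cases "c = b") auto
    then have "y \<in> ?S" unfolding dual_cone_def by blast
    then have "a \<bullet> y = 0" using a(3) by0 by blast
    then show False using cy[of a] a by simp
  qed
  ultimately show ?thesis by (simp add: card_image)
qed

lemma dual_vector:
  fixes B :: "'a::euclidean_space set"
  assumes "independent B" "b \<in> B"
  shows "\<exists>z. b \<bullet> z = 1 \<and> (\<forall>a\<in>B. a \<noteq> b \<longrightarrow> a \<bullet> z = 0)"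
proof -
  obtain g :: "'a \<Rightarrow> real" where g: "linear g" "\<And>x. x \<in> B \<Longrightarrow> g x = (if x = b then 1 else 0)"
    using linear_independent_extend[OF assms(1), of "\<lambda>x. if x = b then 1 else 0"] by auto
  have "x \<bullet> adjoint g 1 = g x" for x using adjoint_works[OF g(1), of x 1] by simp
  then show ?thesis using g(2) assms(2) by (intro exI[of _ "adjoint g 1"]) auto
qed

lemma span_eq_UNIV_if_trivial_orthogonal:
  fixes V :: "'a::euclidean_space set"
  assumes "\<And>y. (\<And>a. a \<in> V \<Longrightarrow> a \<bullet> y = 0) \<Longrightarrow> y = 0"
  shows "span V = UNIV"
proof (rule ccontr)
  assume "span V \<noteq> UNIV"
  then obtain y where y: "y \<noteq> 0" "\<forall>x\<in>span V. y \<bullet> x = 0" using span_not_UNIV_orthogonal by blast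
  have "a \<bullet> y = 0" if "a \<in> V" for a
    using bspec[OF y(2) span_base[OF that]] by (simp only: inner_commute[of a y])
  then have "y = 0" by (rule assms)
  then show False using y(1) by contradiction
qed

text \<open>At most \<open>DIM('a)\<close> spanning vectors form a basis. The sum of the dual basis
  is an interior point, and the negated dual vectors violate one inequality each.\<close>

lemma card_facets_basis:
  fixes V :: "'a::euclidean_space set"
  assumes fin: "finite V" "card V \<le> DIM('a)" and orth: "\<And>y. (\<And>a. a \<in> V \<Longrightarrow> a \<bullet> y = 0) \<Longrightarrow> y = 0"
  shows "card {F. F facet_of dual_cone V} = DIM('a)"
proof -
  have sp: "span V = UNIV"
  proof (rule span_eq_UNIV_if_trivial_orthogonal)
    fix y assume "\<And>a. a \<in> V \<Longrightarrow> a \<bullet> y = 0"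
    then show "y = 0" by (rule orth)
  qed
  have ind: "independent V" by (rule card_le_dim_spanning[of V UNIV]) (use sp fin in simp_all)
  have "card V = dim (UNIV :: 'a set)" by (rule basis_card_eq_dim) (use sp ind in simp_all)
  then have c: "card V = DIM('a)" by simp
  have "\<forall>b\<in>V. \<exists>z. b \<bullet> z = 1 \<and> (\<forall>a\<in>V. a \<noteq> b \<longrightarrow> a \<bullet> z = 0)"
    using dual_vector[OF ind] by blast
  from bchoice[OF this] obtain z where "\<forall>b\<in>V. b \<bullet> z b = 1 \<and> (\<forall>a\<in>V. a \<noteq> b \<longrightarrow> a \<bullet> z b = 0)" ..
  then have z: "\<And>b. b \<in> V \<Longrightarrow> b \<bullet> z b = 1" "\<And>b a. b \<in> V \<Longrightarrow> a \<in> V \<Longrightarrow> a \<noteq> b \<Longrightarrow> a \<bullet> z b = 0"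
    by blast+
  have "card {F. F facet_of dual_cone V} = card V"
  proof (rule card_facets_irredundant[OF fin(1)])
    show "0 < a \<bullet> (\<Sum>b\<in>V. z b)" if a: "a \<in> V" for a
    proof -
      have "a \<bullet> (\<Sum>b\<in>V. z b) = (\<Sum>b\<in>V. if b = a then 1 else 0)"
        unfolding inner_sum_right using z a by (intro sum.cong) auto
      then show ?thesis using a fin by simp
    qed
    show "\<exists>y. b \<bullet> y < 0 \<and> (\<forall>a\<in>V - {b}. 0 \<le> a \<bullet> y)" if "b \<in> V" for b
      using z[OF that] by (intro exI[of _ "- z b"]) auto
  qed
  then show ?thesis using c by simp
qed

text \<open>A subfamily of least size that defines the same cone is irredundant, so it has as many
  members as the cone has facets. A vector orthogonal to it lies in the cone together with its
  negative, so it is 0, and the subfamily is a basis. The dual basis lies in the cone; testing a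
  member of \<open>V\<close> against it shows that the coefficients are nonnegative.\<close>

lemma simplicial_basis:
  fixes V :: "'a::euclidean_space set"
  assumes fin: "finite V" and x0: "\<And>a. a \<in> V \<Longrightarrow> 0 < a \<bullet> x0"
    and orth: "\<And>y. (\<And>a. a \<in> V \<Longrightarrow> a \<bullet> y = 0) \<Longrightarrow> y = 0"
    and card: "card {F. F facet_of dual_cone V} = DIM('a)"
  obtains B where "independent B" "B \<subseteq> V"
    "\<And>p. p \<in> V \<Longrightarrow> \<exists>c. (\<forall>b\<in>B. 0 \<le> c b) \<and> p = (\<Sum>b\<in>B. c b *\<^sub>R b)"
proof -
  have "\<exists>B. (B \<subseteq> V \<and> dual_cone B = dual_cone V)
      \<and> (\<forall>B'. B' \<subseteq> V \<and> dual_cone B' = dual_cone V \<longrightarrow> card B \<le> card B')"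
    by (rule ex_has_least_nat[of _ V]) simp
  then obtain B where B: "B \<subseteq> V" "dual_cone B = dual_cone V"
    and "\<forall>B'. B' \<subseteq> V \<and> dual_cone B' = dual_cone V \<longrightarrow> card B \<le> card B'" by (elim exE conjE)
  then have mi: "\<And>B'. B' \<subseteq> V \<Longrightarrow> dual_cone B' = dual_cone V \<Longrightarrow> card B \<le> card B'" by blast
  have fB: "finite B" using B fin finite_subset by auto
  have cB: "card B = DIM('a)"
  proof -
    have "card {F. F facet_of dual_cone B} = card B"
    proof (rule card_facets_irredundant[OF fB])
      show "0 < a \<bullet> x0" if "a \<in> B" for a using B(1) that by (intro x0) blast
      show "\<exists>z. b \<bullet> z < 0 \<and> (\<forall>a\<in>B - {b}. 0 \<le> a \<bullet> z)" if b: "b \<in> B" for b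
      proof -
        have "dual_cone (B - {b}) \<noteq> dual_cone V"
        proof
          assume "dual_cone (B - {b}) = dual_cone V"
          then have "card B \<le> card (B - {b})" using mi[of "B - {b}"] B(1) by blast
          then show False using card_Diff1_less[OF fB b] by simp
        qed
        moreover have "dual_cone B \<subseteq> dual_cone (B - {b})" unfolding dual_cone_def by blast
        ultimately obtain z where z: "z \<in> dual_cone (B - {b})" "z \<notin> dual_cone B"
          using B(2) by blast
        then have "\<not> 0 \<le> b \<bullet> z" unfolding dual_cone_def by blast
        then have "b \<bullet> z < 0 \<and> (\<forall>a\<in>B - {b}. 0 \<le> a \<bullet> z)" using z(1) unfolding dual_cone_def by simp
        then show ?thesis by blast
      qed
    qed
    then show ?thesis using card B by simp
  qed
  have sp: "span B = UNIV"
  proof (rule span_eq_UNIV_if_trivial_orthogonal)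
    fix y assume y: "\<And>a. a \<in> B \<Longrightarrow> a \<bullet> y = 0"
    then have "y \<in> dual_cone B" "- y \<in> dual_cone B" by (auto simp: dual_cone_def)
    then have "y \<in> dual_cone V" "- y \<in> dual_cone V" using B by auto
    then have "0 \<le> a \<bullet> y" "0 \<le> a \<bullet> (- y)" if "a \<in> V" for a using that unfolding dual_cone_def by blast+
    then have "a \<bullet> y = 0" if "a \<in> V" for a using that by fastforce
    then show "y = 0" by (rule orth)
  qed
  have ind: "independent B" by (rule card_le_dim_spanning[of B UNIV]) (use sp fB cB in simp_all)
  show ?thesis
  proof (rule that[OF ind B(1)])
    fix p assume p: "p \<in> V"
    have "p \<in> span B" using sp by simp
    then obtain c where c: "p = (\<Sum>b\<in>B. c b *\<^sub>R b)" unfolding span_finite[OF fB] by auto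
    have "0 \<le> c b" if b: "b \<in> B" for b
    proof -
      obtain z where z: "b \<bullet> z = 1" "\<forall>a\<in>B. a \<noteq> b \<longrightarrow> a \<bullet> z = 0" using dual_vector[OF ind b] by blast
      have "0 \<le> a \<bullet> z" if "a \<in> B" for a using z that by (cases "a = b") auto
      then have "z \<in> dual_cone B" unfolding dual_cone_def by blast
      then have "z \<in> dual_cone V" using B(2) by simp
      then have "0 \<le> p \<bullet> z" using p by (auto simp: dual_cone_def)
      also have "p \<bullet> z = (\<Sum>a\<in>B. if a = b then c a else 0)"
        unfolding c inner_sum_left using z by (intro sum.cong) auto
      also have "\<dots> = c b" using b fB by simp
      finally show ?thesis .
    qed
    then show "\<exists>c. (\<forall>b\<in>B. 0 \<le> c b) \<and> p = (\<Sum>b\<in>B. c b *\<^sub>R b)" using c by blast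
  qed
qed

lemma card_facets_affine_image:
  fixes f :: "'a::euclidean_space \<Rightarrow> 'b::euclidean_space"
  assumes "linear f" "inj f"
  shows "card {F. F facet_of (\<lambda>x. f x + v) ` S} = card {F. F facet_of S}"
proof -
  let ?g = "\<lambda>x. f x + v"
  have im: "?g ` T = (+) v ` f ` T" for T by (auto simp: image_iff add.commute)
  have fc: "?g ` F facet_of ?g ` S \<longleftrightarrow> F facet_of S" for F
    unfolding facet_of_def im using face_of_linear_image[OF assms] assms
    by (simp add: aff_dim_translation_eq)
  have "{F. F facet_of ?g ` S} = (`) ?g ` {F. F facet_of S}"
  proof (intro set_eqI iffI)
    fix F assume "F \<in> {F. F facet_of ?g ` S}"
    then have F: "F facet_of ?g ` S" by simp
    then have "F \<subseteq> ?g ` S" by (rule facet_of_imp_subset)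
    then obtain G where "F = ?g ` G" by (auto simp: subset_image_iff)
    then show "F \<in> (`) ?g ` {F. F facet_of S}" using F fc by auto
  qed (use fc in auto)
  moreover have "inj ?g" using assms(2) by (simp add: inj_def)
  then have "inj ((`) ?g)" by (simp add: inj_image_eq_iff inj_def)
  ultimately show ?thesis by (simp add: card_image inj_on_subset)
qed

section \<open>Coordinates and facets of the standard cone\<close>

lemma coord_bij: "bij_betw (coord :: nat \<Rightarrow> 'N::finite) {..<CARD('N)} UNIV"
proof -
  have "\<exists>f. bij_betw f {..<CARD('N)} (UNIV :: 'N set)"
    using ex_bij_betw_nat_finite[of "UNIV :: 'N set"] by (simp add: atLeast0LessThan)
  then show ?thesis unfolding coord_def by (rule someI_ex)
qed

lemma less_tri_Suc: "j < tri (Suc n) \<Longrightarrow> \<exists>k\<in>{1..n}. \<exists>r<k. j = tri k + r"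
proof (induction n)
  case (Suc n)
  show ?case
  proof (cases "j < tri (Suc n)")
    case True
    then obtain k r where "k \<in> {1..n}" "r < k" "j = tri k + r" using Suc.IH by auto
    then show ?thesis by (intro bexI[of _ k]) auto
  next
    case False
    then have "j = tri (Suc n) + (j - tri (Suc n))" "j - tri (Suc n) < Suc n"
      using Suc.prems by (auto simp: tri_Suc[of "Suc n"])
    then show ?thesis by (intro bexI[of _ "Suc n"]) auto
  qed
qed (simp add: tri_def)

lemma tri_Suc_eq: "tri (Suc n) = n * (n + 1) div 2"
  by (simp add: tri_def mult.commute)

lemma sum_card_tri: "(\<Sum>k\<in>{1..n}. k) = tri (Suc n)"
  by (induction n) (auto simp: tri_Suc, simp add: tri_def)

definition std_vec :: "nat \<Rightarrow> nat \<Rightarrow> real ^ 'N::finite" where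
  "std_vec k r = axis (coord (tri k + r)) 1 - (if r + 1 < k then axis (coord (tri k + r + 1)) 1 else 0)"

lemma std_vec_inner:
  "std_vec k r \<bullet> (x :: real ^ 'N::finite) = x $ coord (tri k + r) - (if r + 1 < k then x $ coord (tri k + r + 1) else 0)"
  by (simp add: std_vec_def inner_diff_left inner_axis' inner_axis)

lemma std_cone_dual: "std_cone n = dual_cone ((\<lambda>(k, r). std_vec k r) ` (SIGMA k:{1..n}. {..<k}))"
proof -
  have "x \<in> std_cone n \<longleftrightarrow> (\<forall>k\<in>{1..n}. \<forall>r<k. 0 \<le> std_vec k r \<bullet> (x :: real ^ 'N))" for x
  proof -
    have "(\<forall>r<k. 0 \<le> std_vec k r \<bullet> x) \<longleftrightarrow> (\<forall>r. r + 1 < k \<longrightarrow> x $ coord (tri k + r) \<ge> x $ coord (tri k + r + 1))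
      \<and> x $ coord (tri k + k - 1) \<ge> 0" (is "?L \<longleftrightarrow> ?R") if k: "k \<in> {1..n}" for k
    proof
      assume L: ?L
      have "0 \<le> std_vec k (k - 1) \<bullet> x" using L k by simp
      then have "x $ coord (tri k + k - 1) \<ge> 0" using k by (simp add: std_vec_inner)
      moreover have "x $ coord (tri k + r) \<ge> x $ coord (tri k + r + 1)" if "r + 1 < k" for r
        using L[rule_format, of r] that by (simp add: std_vec_inner)
      ultimately show ?R by blast
    next
      assume R: ?R
      show ?L
      proof (intro allI impI)
        fix r assume "r < k"
        then consider "r + 1 < k" | "r = k - 1" by linarith
        then show "0 \<le> std_vec k r \<bullet> x" using R k by cases (auto simp: std_vec_inner)
      qed
    qed
    then show ?thesis unfolding std_cone_def by blast
  qed
  then show ?thesis unfolding dual_cone_def by auto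
qed

lemma card_facets_std_cone:
  assumes N: "CARD('N::finite) = tri (Suc n)"
  shows "card {F. F facet_of (std_cone n :: (real ^ 'N) set)} = CARD('N)"
proof -
  let ?I = "SIGMA k:{1..n}. {..<k}"
  let ?V = "(\<lambda>(k, r). std_vec k r :: real ^ 'N) ` ?I"
  have fin: "finite ?V" by simp
  have "card ?V \<le> card ?I" by (intro card_image_le) simp
  also have "card ?I = CARD('N)" using N sum_card_tri[of n] by simp
  finally have c: "card ?V \<le> DIM(real ^ 'N)" by simp
  have "y = 0" if y: "\<And>a. a \<in> ?V \<Longrightarrow> a \<bullet> y = 0" for y
  proof -
    \<comment> \<open>Backwards through each block: its last inequality involves a single
      coordinate, the others the next one as well.\<close>
    have z: "y $ coord (tri k + r) = 0" if "k \<in> {1..n}" "r < k" for k r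
      using that(2)
    proof (induction "k - r" arbitrary: r rule: less_induct)
      case less
      have "std_vec k r \<bullet> y = 0" using less.prems \<open>k \<in> {1..n}\<close> by (intro y) (auto intro!: image_eqI[of _ _ "(k, r)"])
      then show ?case using less.hyps[of "r + 1"] less.prems
        by (cases "r + 1 < k") (auto simp: std_vec_inner)
    qed
    have "y $ i = 0" for i
    proof -
      obtain j where j: "j < CARD('N)" "i = coord j"
        using coord_bij[where 'N='N] unfolding bij_betw_def by (metis UNIV_I imageE lessThan_iff)
      then show ?thesis using less_tri_Suc[of j n] N z by auto
    qed
    then show "y = 0" by (simp add: vec_eq_iff)
  qed
  from card_facets_basis[OF fin c this] show ?thesis unfolding std_cone_dual by simp
qed

section \<open>Reduced words and contractions\<close>

lemma sw_involution: "sw i (sw i p) = p"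
  by (simp add: sw_def)

lemma sw_in: "1 \<le> i \<Longrightarrow> i < M \<Longrightarrow> p \<in> {1..M} \<Longrightarrow> sw i p \<in> {1..M}"
  by (auto simp: sw_def)

lemma wprod_simps [simp]: "wprod [] = id" "wprod (i # w) = sw i \<circ> wprod w"
  by (simp_all add: wprod_def)

lemma wprod_append: "wprod (u @ v) = wprod u \<circ> wprod v"
  by (induction u) (auto simp: comp_assoc)

lemma bij_sw: "1 \<le> i \<Longrightarrow> i < M \<Longrightarrow> bij_betw (sw i) {1..M} {1..M}"
  by (rule bij_betw_byWitness[where f' = "sw i"]) (auto simp: sw_def)

lemma bij_wprod: "set w \<subseteq> {1..M - 1} \<Longrightarrow> bij_betw (wprod w) {1..M} {1..M}"
proof (induction w)
  case (Cons i w)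
  have i: "1 \<le> i" "i < M" using Cons.prems by auto
  have "bij_betw (wprod w) {1..M} {1..M}" using Cons by simp
  from bij_betw_trans[OF this bij_sw[OF i]] show ?case unfolding wprod_simps .
qed simp

lemma wprod_fixed: "(\<And>i. i \<in> set w \<Longrightarrow> p \<noteq> i \<and> p \<noteq> i + 1) \<Longrightarrow> wprod w p = p"
  by (induction w) (auto simp: sw_def)

lemma wprod_take: "j \<le> length w \<Longrightarrow> wprod (take j w) p = wire_at w j p"
  by (induction j arbitrary: p) (auto simp: take_Suc_conv_app_nth wprod_append)

text \<open>The pairs of wires that cross at the successive letters.\<close>
fun pl :: "(nat \<Rightarrow> nat) \<Rightarrow> nat list \<Rightarrow> (nat \<times> nat) list" where
  "pl f [] = []"
| "pl f (i # w) = (f i, f (i + 1)) # pl (f \<circ> sw i) w"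

lemma pl_append: "pl f (u @ v) = pl f u @ pl (f \<circ> wprod u) v"
  by (induction u arbitrary: f) (auto simp: comp_assoc)

lemma length_pl [simp]: "length (pl f w) = length w"
  by (induction w arbitrary: f) auto

lemma nth_pl: "j < length w \<Longrightarrow> pl f w ! j = (f (wprod (take j w) (w ! j)), f (wprod (take j w) (w ! j + 1)))"
proof (induction w arbitrary: f j)
  case (Cons i w)
  then show ?case by (cases j) auto
qed simp

lemma pl_wires: "j < length w \<Longrightarrow> pl id w ! j = (lwire w j, rwire w j)"
  by (simp add: nth_pl wprod_take lwire_def rwire_def)

lemma pl_middle: "w = x @ i # y \<Longrightarrow> (wprod x i, wprod x (i + 1)) \<in> set (pl id w)"
  by (simp add: pl_append)

fun prec :: "'a \<Rightarrow> 'a \<Rightarrow> 'a list \<Rightarrow> bool" where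
  "prec p q [] \<longleftrightarrow> False"
| "prec p q (x # L) \<longleftrightarrow> x = p \<and> q \<in> set L \<or> prec p q L"

lemma prec_append: "prec p q (X @ Y) \<longleftrightarrow> prec p q X \<or> prec p q Y \<or> p \<in> set X \<and> q \<in> set Y"
  by (induction X) auto

lemma prec_filter: "P p \<Longrightarrow> P q \<Longrightarrow> prec p q (filter P L) \<longleftrightarrow> prec p q L"
  by (induction L) auto

lemma prec_map: "inj f \<Longrightarrow> prec (f p) (f q) (map f L) \<longleftrightarrow> prec p q L"
  by (induction L) (auto simp: inj_eq image_iff)

lemma prec_set: "prec p q L \<Longrightarrow> p \<in> set L \<and> q \<in> set L"
  by (induction L) auto

lemma prec_nth:
  assumes "distinct L" "i < length L" "j < length L"
  shows "prec (L ! i) (L ! j) L \<longleftrightarrow> i < j"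
  using assms
proof (induction L arbitrary: i j)
  case (Cons x L)
  have nx: "\<not> prec x q L" "\<not> prec p x L" for p q using prec_set[of _ _ L] Cons.prems by auto
  show ?case
    using Cons nx by (cases i; cases j) (auto simp: nth_mem)
qed simp

section \<open>Each pair of wires crosses exactly once\<close>

definition pairs :: "nat \<Rightarrow> (nat \<times> nat) set" where
  "pairs M = {(a, b). 1 \<le> a \<and> a < b \<and> b \<le> M}"

lemma card_pairs: "finite (pairs M)" "card (pairs M) = M * (M - 1) div 2"
proof -
  have e: "pairs M = prod.swap ` (SIGMA b:{1..M}. {1..<b})" by (auto simp: pairs_def image_iff)
  show "finite (pairs M)" unfolding e by simp
  have s: "(\<Sum>b\<in>{1..M}. b - 1) = M * (M - 1) div 2"
  proof (induction M)
    case (Suc M)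
    have "Suc M * M = M * (M - 1) + 2 * M" by (cases M) (auto simp: algebra_simps)
    then show ?case using Suc by simp
  qed simp
  have "card (pairs M) = card (SIGMA b:{1..M}. {1..<b})" unfolding e
    by (intro card_image) (auto simp: inj_on_def)
  then show "card (pairs M) = M * (M - 1) div 2" using s by simp
qed

text \<open>\<open>f\<close> assigns wires to positions, and the predicate says that wire
  \<open>a\<close> stands to the left of wire \<open>b\<close>.\<close>

definition before :: "nat \<Rightarrow> (nat \<Rightarrow> nat) \<Rightarrow> nat \<Rightarrow> nat \<Rightarrow> bool" where
  "before M f a b \<longleftrightarrow> (\<exists>p q. p \<in> {1..M} \<and> q \<in> {1..M} \<and> p < q \<and> f p = a \<and> f q = b)"

lemma before_step:
  assumes "before M f a b" "1 \<le> i" "i < M"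
  shows "before M (f \<circ> sw i) a b \<or> (f i, f (i + 1)) = (a, b)"
proof -
  obtain p q where pq: "p \<in> {1..M}" "q \<in> {1..M}" "p < q" "f p = a" "f q = b" using assms(1) by (auto simp: before_def)
  show ?thesis
  proof (cases "p = i \<and> q = i + 1")
    case False
    then have "sw i p < sw i q" using pq by (auto simp: sw_def)
    moreover have "sw i p \<in> {1..M}" "sw i q \<in> {1..M}" using sw_in[OF assms(2,3)] pq(1,2) by blast+
    moreover have "(f \<circ> sw i) (sw i p) = a" "(f \<circ> sw i) (sw i q) = b" using pq by (simp_all add: sw_involution)
    ultimately show ?thesis unfolding before_def by blast
  next
    case True
    then show ?thesis using pq by simp
  qed
qed

lemma before_asym:
  assumes "inj_on f {1..M}" "before M f a b" "before M f b a"
  shows False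
proof -
  obtain p q where pq: "p \<in> {1..M}" "q \<in> {1..M}" "p < q" "f p = a" "f q = b" using assms(2) by (auto simp: before_def)
  obtain r s where rs: "r \<in> {1..M}" "s \<in> {1..M}" "r < s" "f r = b" "f s = a" using assms(3) by (auto simp: before_def)
  have "p = s" by (rule inj_onD[OF assms(1)]) (simp_all only: pq rs)
  moreover have "q = r" by (rule inj_onD[OF assms(1)]) (simp_all only: pq rs)
  ultimately show False using pq(3) rs(3) by simp
qed

lemma before_trans:
  assumes "inj_on f {1..M}" "before M f a b" "before M f b c"
  shows "before M f a c"
proof -
  obtain p q where pq: "p \<in> {1..M}" "q \<in> {1..M}" "p < q" "f p = a" "f q = b" using assms(2) by (auto simp: before_def)
  obtain r s where rs: "r \<in> {1..M}" "s \<in> {1..M}" "r < s" "f r = b" "f s = c" using assms(3) by (auto simp: before_def)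
  have "q = r" by (rule inj_onD[OF assms(1)]) (simp_all only: pq rs)
  then have "p < s" using pq(3) rs(3) by simp
  then show ?thesis unfolding before_def using pq(1,4) rs(2,5) by blast
qed

text \<open>A letter changes the left-right order only of the pair that it crosses.\<close>

lemma pl_crossing:
  assumes "set v \<subseteq> {1..M - 1}" "before M f a b" "\<not> before M (f \<circ> wprod v) a b"
  shows "(a, b) \<in> set (pl f v)"
  using assms
proof (induction v arbitrary: f)
  case (Cons i v)
  have i: "1 \<le> i" "i < M" using Cons.prems by auto
  have c: "f \<circ> wprod (i # v) = (f \<circ> sw i) \<circ> wprod v" unfolding wprod_simps comp_assoc ..
  have v: "set v \<subseteq> {1..M - 1}" using Cons.prems by simp
  from before_step[OF Cons.prems(2) i] show ?case
  proof
    assume "before M (f \<circ> sw i) a b"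
    then have "(a, b) \<in> set (pl (f \<circ> sw i) v)"
      by (rule Cons.IH[OF v]) (use Cons.prems(3) in \<open>simp only: c not_False_eq_True\<close>)
    then show ?thesis unfolding pl.simps by simp
  qed simp
qed simp

lemma SigmaD:
  assumes "w \<in> Sigma M"
  shows "length w = M * (M - 1) div 2" "set w \<subseteq> {1..M - 1}" "\<And>p. p \<in> {1..M} \<Longrightarrow> wprod w p = M + 1 - p"
  using assms by (auto simp: Sigma_def)

text \<open>The reversal forces every pair to cross at least once, and the length of the word equals
  the number of pairs, so there is no room for a second crossing or for one with the larger wire on
  the left.\<close>

lemma Sigma_pl:
  assumes w: "w \<in> Sigma M"
  shows "set (pl id w) = pairs M" "distinct (pl id w)"
proof -
  note S = SigmaD[OF w]
  have sub: "pairs M \<subseteq> set (pl id w)"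
  proof
    fix p assume "p \<in> pairs M"
    then obtain a b where ab: "p = (a, b)" "1 \<le> a" "a < b" "b \<le> M" by (auto simp: pairs_def)
    have b1: "before M id a b" unfolding before_def using ab by (intro exI[of _ a] exI[of _ b]) auto
    have "M + 1 - b \<in> {1..M}" "M + 1 - a \<in> {1..M}" using ab by auto
    from S(3)[OF this(1)] S(3)[OF this(2)]
    have "wprod w (M + 1 - b) = b" "wprod w (M + 1 - a) = a" using ab by simp_all
    moreover have "M + 1 - b < M + 1 - a" using ab by simp
    ultimately have b2: "before M (wprod w) b a" unfolding before_def
      using \<open>M + 1 - b \<in> _\<close> \<open>M + 1 - a \<in> _\<close> by blast
    have inj: "inj_on (wprod w) {1..M}" using bij_wprod[OF S(2)] by (simp add: bij_betw_def)
    have "\<not> before M (id \<circ> wprod w) a b" unfolding id_comp using before_asym[OF inj _ b2] by (rule notI)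
    from pl_crossing[OF S(2) b1 this] show "p \<in> set (pl id w)" unfolding ab(1) .
  qed
  have c: "card (pairs M) = length (pl id w)" using card_pairs(2) S(1) by simp
  have le: "card (set (pl id w)) \<le> length (pl id w)" by (rule card_length)
  show e: "set (pl id w) = pairs M"
    by (rule card_seteq[OF _ sub, symmetric]) (use c le in simp_all)
  show "distinct (pl id w)" using c e by (intro card_distinct) simp
qed

lemma Sigma_letter:
  assumes "w \<in> Sigma M" "w = x @ i # y"
  shows "wprod x i < wprod x (i + 1)"
  using pl_middle[OF assms(2)] Sigma_pl(1)[OF assms(1)] by (auto simp: pairs_def)

text \<open>For \<open>a < b < c\<close>: the three nodes come in the order \<open>ab, ac, bc\<close>, not \<open>bc, ac, ab\<close>.\<close>
definition triple :: "nat list \<Rightarrow> nat \<Rightarrow> nat \<Rightarrow> nat \<Rightarrow> bool" where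
  "triple w a b c \<longleftrightarrow> prec (a, b) (b, c) (pl id w)"

definition node :: "nat list \<Rightarrow> nat \<Rightarrow> nat \<Rightarrow> nat" where
  "node w a b = (THE j. j < length w \<and> pl id w ! j = (min a b, max a b))"

lemma node:
  assumes w: "w \<in> Sigma M" and ab: "1 \<le> a" "a < b" "b \<le> M"
  shows "node w a b < length w" "pl id w ! node w a b = (a, b)"
    "\<And>j. j < length w \<Longrightarrow> pl id w ! j = (a, b) \<Longrightarrow> j = node w a b"
proof -
  have "(a, b) \<in> set (pl id w)" using Sigma_pl(1)[OF w] ab by (auto simp: pairs_def)
  then obtain j where j: "j < length w" "pl id w ! j = (a, b)" by (auto simp: in_set_conv_nth)
  have u: "i = j" if "i < length w" "pl id w ! i = (a, b)" for i
    using nth_eq_iff_index_eq[OF Sigma_pl(2)[OF w], of i j] that j by simp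
  have mm: "min a b = a" "max a b = b" using ab by simp_all
  have e: "node w a b = j" unfolding node_def mm
    by (rule the_equality) (use j u in blast)+
  show "node w a b < length w" "pl id w ! node w a b = (a, b)" unfolding e by (fact j)+
  show "i = node w a b" if "i < length w" "pl id w ! i = (a, b)" for i
    unfolding e by (rule u[OF that])
qed

lemma node_sym: "node w a b = node w b a"
  by (simp add: node_def min.commute max.commute)

lemma triple_node:
  assumes w: "w \<in> Sigma M" and ab: "1 \<le> a" "a < b" "b < c" "c \<le> M"
  shows "triple w a b c \<longleftrightarrow> node w a b < node w b c"
proof -
  have A: "b \<le> M" "1 \<le> b" using ab by simp_all
  note n1 = node(1,2)[OF w ab(1,2) A(1)] and n2 = node(1,2)[OF w A(2) ab(3,4)]
  have l: "length (pl id w) = length w" by simp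
  have "prec (pl id w ! node w a b) (pl id w ! node w b c) (pl id w) \<longleftrightarrow> node w a b < node w b c"
    by (rule prec_nth[OF Sigma_pl(2)[OF w]]) (simp_all only: l n1 n2)
  then show ?thesis unfolding triple_def n1 n2 .
qed

lemma before_node:
  assumes w: "w \<in> Sigma M" and ab: "1 \<le> a" "a < b" "b \<le> M" and t: "t \<le> length w"
  shows "if t \<le> node w a b then before M (wprod (take t w)) a b else before M (wprod (take t w)) b a"
  using t
proof (induction t)
  case 0
  have "a \<in> {1..M}" "b \<in> {1..M}" "id a = a" "id b = b" using ab by auto
  then have "before M id a b" unfolding before_def using ab(2) by blast
  then show ?case by simp
next
  case (Suc t)
  let ?f = "wprod (take t w)" and ?i = "w ! t"
  have "t < length w" using Suc.prems by simp
  then have "?i \<in> {1..M - 1}" using subsetD[OF SigmaD(2)[OF w] nth_mem] by blast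
  then have i: "1 \<le> ?i" "?i < M" by auto
  have n: "wprod (take (Suc t) w) = ?f \<circ> sw ?i" using Suc.prems by (simp add: take_Suc_conv_app_nth wprod_append)
  have p: "pl id w ! t = (?f ?i, ?f (?i + 1))" using nth_pl[of t w id] Suc.prems by simp
  have "pl id w ! t \<in> pairs M" using Sigma_pl(1)[OF w] nth_mem[of t "pl id w"] Suc.prems by simp
  then have np: "pl id w ! t \<noteq> (b, a)" using ab by (auto simp: pairs_def)
  have t: "t < length w" "t \<le> length w" using Suc.prems by simp_all
  consider "t < node w a b" | "t = node w a b" | "node w a b < t" by linarith
  then show ?case
  proof cases
    case 1
    have "(?f ?i, ?f (?i + 1)) \<noteq> (a, b)" using node(3)[OF w ab t(1)] 1 unfolding p by (metis less_irrefl)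
    moreover have "before M ?f a b" using Suc.IH[OF t(2)] 1 by simp
    ultimately have "before M (wprod (take (Suc t) w)) a b" using before_step[OF _ i] unfolding n by blast
    then show ?thesis using 1 by simp
  next
    case 2
    have fi: "?f ?i = a" "?f (?i + 1) = b" using node(2)[OF w ab] p 2 by simp_all
    have "(?f \<circ> sw ?i) ?i = b" "(?f \<circ> sw ?i) (?i + 1) = a" using fi by (simp_all add: sw_def)
    moreover have "?i \<in> {1..M}" "?i + 1 \<in> {1..M}" "?i < ?i + 1" using i by auto
    ultimately have "before M (?f \<circ> sw ?i) b a" unfolding before_def by blast
    then show ?thesis using 2 n by simp
  next
    case 3
    have "before M ?f b a" using Suc.IH[OF t(2)] 3 by simp
    then have "before M (wprod (take (Suc t) w)) b a" using before_step[OF _ i] np unfolding n p by blast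
    then show ?thesis using 3 by simp
  qed
qed

text \<open>If the node of \<open>a\<close> and \<open>c\<close> came after both others, the
  left-right order just before it would be cyclic; if it came before both, the order just after it
  would be.\<close>

lemma node_between:
  assumes w: "w \<in> Sigma M" and o: "1 \<le> a" "a < b" "b < c" "c \<le> M"
  shows "node w a b < node w a c \<and> node w a c < node w b c \<or> node w b c < node w a c \<and> node w a c < node w a b"
proof -
  have ne: "node w a b \<noteq> node w a c" "node w a c \<noteq> node w b c"
    using node(2)[OF w, of a b] node(2)[OF w, of a c] node(2)[OF w, of b c] o by auto
  have inj: "inj_on (wprod (take t w)) {1..M}" for t
    using bij_wprod[of "take t w" M] SigmaD(2)[OF w] set_take_subset[of t w] by (auto simp: bij_betw_def)
  have B: "before M (wprod (take t w)) x y" if "1 \<le> x" "x < y" "y \<le> M" "t \<le> node w x y" "t \<le> length w" for t x y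
    using before_node[OF w that(1-3,5)] that by simp
  have B': "before M (wprod (take t w)) y x" if "1 \<le> x" "x < y" "y \<le> M" "node w x y < t" "t \<le> length w" for t x y
    using before_node[OF w that(1-3,5)] that by simp
  have l: "node w a c < length w" using node(1)[OF w, of a c] o by simp
  have "\<not> (node w a b < node w a c \<and> node w b c < node w a c)"
  proof
    assume h: "node w a b < node w a c \<and> node w b c < node w a c"
    let ?t = "node w a c"
    have "before M (wprod (take ?t w)) c b" "before M (wprod (take ?t w)) b a" "before M (wprod (take ?t w)) a c"
      using B'[of b c ?t] B'[of a b ?t] B[of a c ?t] h o l by auto
    then show False using before_asym[OF inj] before_trans[OF inj] by blast
  qed
  moreover have "\<not> (node w a c < node w a b \<and> node w a c < node w b c)"
  proof
    assume h: "node w a c < node w a b \<and> node w a c < node w b c"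
    let ?t = "Suc (node w a c)"
    have "before M (wprod (take ?t w)) a b" "before M (wprod (take ?t w)) b c" "before M (wprod (take ?t w)) c a"
      using B[of a b ?t] B[of b c ?t] B'[of a c ?t] h o l by auto
    then show False using before_asym[OF inj] before_trans[OF inj] by blast
  qed
  ultimately show ?thesis using ne by linarith
qed

section \<open>Words up to commutation\<close>

lemma two_move_ctx: "two_move u v \<Longrightarrow> two_move (x @ u @ y) (x @ v @ y)"
proof -
  assume "two_move u v"
  then obtain s t a b where "u = s @ [a, b] @ t" "v = s @ [b, a] @ t" "b + 1 < a \<or> a + 1 < b"
    unfolding two_move_def by blast
  then have "x @ u @ y = (x @ s) @ [a, b] @ (t @ y)" "x @ v @ y = (x @ s) @ [b, a] @ (t @ y)" by simp_all
  then show ?thesis unfolding two_move_def using \<open>b + 1 < a \<or> a + 1 < b\<close> by blast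
qed

lemma comm_equiv_ctx: "comm_equiv u v \<Longrightarrow> comm_equiv (x @ u @ y) (x @ v @ y)"
  unfolding comm_equiv_def
proof (induction rule: rtranclp_induct)
  case (step b c)
  show ?case by (rule rtranclp.rtrancl_into_rtrancl[OF step(3) two_move_ctx[OF step(2)]])
qed simp

lemma comm_equiv_trans: "comm_equiv u v \<Longrightarrow> comm_equiv v w \<Longrightarrow> comm_equiv u w"
  unfolding comm_equiv_def by (rule rtranclp_trans)

lemma comm_move: "(\<And>b. b \<in> set v \<Longrightarrow> b + 1 < i \<or> i + 1 < b) \<Longrightarrow> comm_equiv (x @ v @ [i] @ y) (x @ [i] @ v @ y)"
proof (induction v arbitrary: x)
  case (Cons b v)
  have 1: "comm_equiv ((x @ [b]) @ v @ [i] @ y) ((x @ [b]) @ [i] @ v @ y)"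
    by (rule Cons.IH) (use Cons.prems in simp)
  have "b + 1 < i \<or> i + 1 < b" using Cons.prems[of b] by simp
  then have "two_move (x @ [b, i] @ (v @ y)) (x @ [i, b] @ (v @ y))" unfolding two_move_def by blast
  then have "comm_equiv (x @ [b, i] @ (v @ y)) (x @ [i, b] @ (v @ y))" unfolding comm_equiv_def by (rule r_into_rtranclp)
  from comm_equiv_trans[OF _ this] 1 show ?case by simp
qed (simp add: comm_equiv_def)

lemma sw_commute: "b + 1 < a \<or> a + 1 < b \<Longrightarrow> sw a (sw b p) = sw b (sw a p)"
  by (auto simp: sw_def)

text \<open>The two letters cross disjoint pairs of wires, whereas \<open>triple\<close> compares
  two pairs that share the wire \<open>b\<close>.\<close>

lemma two_move_Sigma:
  assumes "two_move u v" "u \<in> Sigma M"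
  shows "v \<in> Sigma M" "\<And>a b c. triple v a b c \<longleftrightarrow> triple u a b c"
proof -
  obtain x y i j where uv: "u = x @ [i, j] @ y" "v = x @ [j, i] @ y" and ij: "j + 1 < i \<or> i + 1 < j"
    using assms(1) unfolding two_move_def by blast
  have c: "sw i \<circ> sw j = sw j \<circ> sw i" using sw_commute[OF ij] by (simp add: fun_eq_iff)
  have e: "wprod u = wprod v" unfolding uv wprod_append by (simp add: fun_eq_iff sw_commute[OF ij])
  then show "v \<in> Sigma M" using assms(2) uv by (auto simp: Sigma_def)
  let ?g = "wprod x"
  let ?P = "(?g i, ?g (i + 1))" and ?Q = "(?g j, ?g (j + 1))"
  let ?R = "pl (?g \<circ> (sw i \<circ> sw j)) y"
  have l: "pl id u = pl id x @ [?P, ?Q] @ ?R" "pl id v = pl id x @ [?Q, ?P] @ ?R"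
    unfolding uv pl_append c using ij by (auto simp: sw_def comp_assoc c)
  have letters: "i \<in> {1..M-1}" "j \<in> {1..M-1}" "set x \<subseteq> {1..M-1}" using SigmaD(2)[OF assms(2)] uv by auto
  have inj: "inj_on ?g {1..M}" using bij_wprod[OF letters(3)] by (simp add: bij_betw_def)
  have "i \<in> {1..M}" "j \<in> {1..M}" "i + 1 \<in> {1..M}" "j + 1 \<in> {1..M}" using letters by auto
  then have "?g (i + 1) \<noteq> ?g j" "?g (j + 1) \<noteq> ?g i"
    using inj_on_eq_iff[OF inj, of "i+1" j] inj_on_eq_iff[OF inj, of "j+1" i] ij by auto
  then show "triple v a b c \<longleftrightarrow> triple u a b c" for a b c
    unfolding triple_def l prec_append by auto
qed

lemma comm_equiv_Sigma:
  assumes "comm_equiv u v" "u \<in> Sigma M"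
  shows "v \<in> Sigma M \<and> (\<forall>a b c. triple v a b c \<longleftrightarrow> triple u a b c)"
  using assms unfolding comm_equiv_def
proof (induction rule: rtranclp_induct)
  case (step y z)
  have y: "y \<in> Sigma M" "\<forall>a b c. triple y a b c \<longleftrightarrow> triple u a b c" using step(3,4) by blast+
  from two_move_Sigma[OF step(2) y(1)] show ?case using y(2) by simp
qed simp

lemma wprod_in:
  assumes "set x \<subseteq> {1..m}" "p \<in> {1..m + 1}"
  shows "wprod x p \<in> {1..m + 1}"
  using bij_wprod[of x "m + 1"] assms by (auto simp: bij_betw_def)

text \<open>Wire \<open>m + 1\<close> is followed through the prefixes; it is at position
  \<open>q\<close> once the letters from \<open>m\<close> down to \<open>q\<close> have moved it. A
  further letter moves it, or lies to its right and joins \<open>v\<close>, or lies to its left and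
  commutes back to \<open>u\<close>. The letter \<open>q\<close> cannot occur, since the largest
  wire is never the left one at a crossing.\<close>

lemma decD_exists:
  assumes w: "w \<in> Sigma (m + 1)"
  shows "\<exists>u v. comm_equiv w (u @ Dword m @ v)"
proof -
  have st: "\<exists>q u v. q \<in> {1..m + 1} \<and> wprod x q = m + 1 \<and> comm_equiv x (u @ rev [q..<m + 1] @ v) \<and> (\<forall>b\<in>set v. q < b)"
    if "w = x @ y" for x y
    using that
  proof (induction x arbitrary: y rule: rev_induct)
    case Nil
    show ?case by (intro exI[of _ "m + 1"] exI[of _ "[]"]) (auto simp: comm_equiv_def)
  next
    case (snoc i x)
    then obtain q u v where q: "q \<in> {1..m + 1}" "wprod x q = m + 1"
      "comm_equiv x (u @ rev [q..<m + 1] @ v)" "\<forall>b\<in>set v. q < b" by (metis append.assoc)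
    have wx: "w = x @ i # y" using snoc.prems by simp
    have i: "i \<in> {1..m}" "set x \<subseteq> {1..m}" using SigmaD(2)[OF w] wx by auto
    have "i \<noteq> q"
      using Sigma_letter[OF w wx] wprod_in[OF i(2), of "i + 1"] i(1) q(2) by auto
    have xi: "wprod (x @ [i]) p = wprod x (sw i p)" for p by (simp add: wprod_append)
    have c: "comm_equiv (x @ [i]) (u @ rev [q..<m + 1] @ v @ [i])"
      using comm_equiv_ctx[OF q(3), of "[]" "[i]"] by simp
    consider "i + 1 = q" | "q < i" | "i + 1 < q" using \<open>i \<noteq> q\<close> by linarith
    then show ?case
    proof cases
      case 1
      have "comm_equiv ((u @ rev [q..<m + 1]) @ v @ [i] @ []) ((u @ rev [q..<m + 1]) @ [i] @ v @ [])"
        by (rule comm_move) (use q(4) 1 in auto)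
      moreover have "[i..<m + 1] = i # [q..<m + 1]" using 1 i by (simp add: upt_conv_Cons)
      ultimately have "comm_equiv (x @ [i]) (u @ rev [i..<m + 1] @ v)" using comm_equiv_trans[OF c] by simp
      moreover have "wprod (x @ [i]) i = m + 1" unfolding xi using q(2) 1 by (simp add: sw_def)
      moreover have "\<forall>b\<in>set v. i < b" using q(4) 1 by auto
      moreover have "i \<in> {1..m + 1}" using i by auto
      ultimately show ?thesis by blast
    next
      case 2
      have "wprod (x @ [i]) q = m + 1" unfolding xi using q(2) 2 by (simp add: sw_def)
      moreover have "\<forall>b\<in>set (v @ [i]). q < b" using q(4) 2 by auto
      ultimately show ?thesis using c q(1) by blast
    next
      case 3
      have "comm_equiv (u @ (rev [q..<m + 1] @ v) @ [i] @ []) (u @ [i] @ (rev [q..<m + 1] @ v) @ [])"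
        by (rule comm_move) (use q(4) 3 in auto)
      then have "comm_equiv (x @ [i]) ((u @ [i]) @ rev [q..<m + 1] @ v)" using comm_equiv_trans[OF c] by simp
      moreover have "wprod (x @ [i]) q = m + 1" unfolding xi using q(2) 3 by (simp add: sw_def)
      ultimately show ?thesis using q(1,4) by blast
    qed
  qed
  have "w = w @ []" by simp
  from st[OF this] obtain q u v where q: "q \<in> {1..m + 1}" "wprod w q = m + 1" "comm_equiv w (u @ rev [q..<m + 1] @ v)" by blast
  have "q = 1" using SigmaD(3)[OF w q(1)] q(1,2) by auto
  then show ?thesis using q(3) unfolding Dword_def by blast
qed

text \<open>The same with wire 1, which is never the right one at a crossing and so only moves to
  the right.\<close>

lemma decA_exists:
  assumes w: "w \<in> Sigma (m + 1)"
  shows "\<exists>u v. comm_equiv w (u @ Aword m @ v)"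
proof -
  have st: "\<exists>q u v. q \<in> {1..m + 1} \<and> wprod x q = 1 \<and> comm_equiv x (u @ [1..<q] @ v) \<and> (\<forall>b\<in>set v. b + 1 < q)"
    if "w = x @ y" for x y
    using that
  proof (induction x arbitrary: y rule: rev_induct)
    case Nil
    show ?case by (intro exI[of _ 1] exI[of _ "[]"]) (auto simp: comm_equiv_def)
  next
    case (snoc i x)
    then obtain q u v where q: "q \<in> {1..m + 1}" "wprod x q = 1"
      "comm_equiv x (u @ [1..<q] @ v)" "\<forall>b\<in>set v. b + 1 < q" by (metis append.assoc)
    have wx: "w = x @ i # y" using snoc.prems by simp
    have i: "i \<in> {1..m}" "set x \<subseteq> {1..m}" using SigmaD(2)[OF w] wx by auto
    have "i + 1 \<noteq> q"
      using Sigma_letter[OF w wx] wprod_in[OF i(2), of i] i(1) q(2) by auto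
    have xi: "wprod (x @ [i]) p = wprod x (sw i p)" for p by (simp add: wprod_append)
    have c: "comm_equiv (x @ [i]) (u @ [1..<q] @ v @ [i])"
      using comm_equiv_ctx[OF q(3), of "[]" "[i]"] by simp
    consider "i = q" | "i + 1 < q" | "q < i" using \<open>i + 1 \<noteq> q\<close> by linarith
    then show ?case
    proof cases
      case 1
      have "comm_equiv ((u @ [1..<q]) @ v @ [i] @ []) ((u @ [1..<q]) @ [i] @ v @ [])"
        by (rule comm_move) (use q(4) 1 in auto)
      moreover have "[1..<i + 1] = [1..<q] @ [i]" using 1 i by simp
      ultimately have "comm_equiv (x @ [i]) (u @ [1..<i + 1] @ v)" using comm_equiv_trans[OF c] by simp
      moreover have "wprod (x @ [i]) (i + 1) = 1" unfolding xi using q(2) 1 by (simp add: sw_def)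
      moreover have "\<forall>b\<in>set v. b + 1 < i + 1" using q(4) 1 by auto
      moreover have "i + 1 \<in> {1..m + 1}" using i by auto
      ultimately show ?thesis by blast
    next
      case 2
      have "wprod (x @ [i]) q = 1" unfolding xi using q(2) 2 by (simp add: sw_def)
      moreover have "\<forall>b\<in>set (v @ [i]). b + 1 < q" using q(4) 2 by auto
      ultimately show ?thesis using c q(1) by blast
    next
      case 3
      have "comm_equiv (u @ ([1..<q] @ v) @ [i] @ []) (u @ [i] @ ([1..<q] @ v) @ [])"
        by (rule comm_move) (use q(4) 3 in auto)
      then have "comm_equiv (x @ [i]) ((u @ [i]) @ [1..<q] @ v)" using comm_equiv_trans[OF c] by simp
      moreover have "wprod (x @ [i]) q = 1" unfolding xi using q(2) 3 by (simp add: sw_def)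
      ultimately show ?thesis using q(1,4) by blast
    qed
  qed
  have "w = w @ []" by simp
  from st[OF this] obtain q u v where q: "q \<in> {1..m + 1}" "wprod w q = 1" "comm_equiv w (u @ [1..<q] @ v)" by blast
  have "q = m + 1" using SigmaD(3)[OF w q(1)] q(1,2) by auto
  then show ?thesis using q(3) unfolding Aword_def by blast
qed

lemma decD_spec: "w \<in> Sigma (m + 1) \<Longrightarrow> comm_equiv w (fst (decD m w) @ Dword m @ snd (decD m w))"
  unfolding decD_def using someI_ex[of "\<lambda>(u, v). comm_equiv w (u @ Dword m @ v)"] decD_exists[of w m]
  by (auto simp: case_prod_unfold)

lemma decA_spec: "w \<in> Sigma (m + 1) \<Longrightarrow> comm_equiv w (fst (decA m w) @ Aword m @ snd (decA m w))"
  unfolding decA_def using someI_ex[of "\<lambda>(u, v). comm_equiv w (u @ Aword m @ v)"] decA_exists[of w m]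
  by (auto simp: case_prod_unfold)

section \<open>Contractions of words in decomposed form\<close>

lemma pl_Dword: "pl f (rev [q..<Suc m]) = map (\<lambda>p. (f p, f (Suc m))) (rev [q..<Suc m])"
proof (induction m arbitrary: f)
  case 0
  then show ?case by (cases "q = 0") auto
next
  case (Suc m)
  show ?case
  proof (cases "q \<le> Suc m")
    case True
    then have r: "rev [q..<Suc (Suc m)] = Suc m # rev [q..<Suc m]" by simp
    have "map (\<lambda>p. ((f \<circ> sw (Suc m)) p, (f \<circ> sw (Suc m)) (Suc m))) (rev [q..<Suc m])
        = map (\<lambda>p. (f p, f (Suc (Suc m)))) (rev [q..<Suc m])"
      by (intro map_cong refl) (auto simp: sw_def)
    then show ?thesis unfolding r pl.simps Suc.IH list.map by (simp only: Suc_eq_plus1)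
  qed simp
qed

lemma wprod_Dword: "wprod (rev [1..<Suc m]) 1 = Suc m" "p \<in> {1..m} \<Longrightarrow> wprod (rev [1..<Suc m]) (Suc p) = p"
proof (induction m arbitrary: p)
  case (Suc m)
  have r: "rev [1..<Suc (Suc m)] = Suc m # rev [1..<Suc m]" by simp
  { case 1 show ?case unfolding r wprod_simps o_apply Suc.IH(1) by (simp add: sw_def) }
  { case 2
    show ?case
    proof (cases "p = Suc m")
      case True
      have "wprod (rev [1..<Suc m]) (Suc p) = Suc p" by (rule wprod_fixed) (use True in auto)
      then show ?thesis unfolding r wprod_simps o_apply using True by (simp add: sw_def)
    next
      case False
      then have "p \<in> {1..m}" using 2 by auto
      from Suc.IH(2)[OF this] show ?thesis unfolding r wprod_simps o_apply using \<open>p \<in> {1..m}\<close> by (simp add: sw_def)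
    qed }
qed simp_all

lemma wprod_Aword: "wprod [1..<Suc m] (Suc m) = 1" "p \<in> {1..m} \<Longrightarrow> wprod [1..<Suc m] p = Suc p"
proof (induction m arbitrary: p)
  case (Suc m)
  have r: "[1..<Suc (Suc m)] = [1..<Suc m] @ [Suc m]" by simp
  have s: "wprod [1..<Suc (Suc m)] p = wprod [1..<Suc m] (sw (Suc m) p)" for p unfolding r wprod_append by simp
  { case 1 show ?case unfolding s using Suc.IH(1) by (simp add: sw_def) }
  { case 2
    show ?case
    proof (cases "p = Suc m")
      case True
      have "wprod [1..<Suc m] (Suc p) = Suc p" by (rule wprod_fixed) (use True in auto)
      then show ?thesis unfolding s using True by (simp add: sw_def)
    next
      case False
      then have "p \<in> {1..m}" using 2 by auto
      from Suc.IH(2)[OF this] show ?thesis unfolding s using \<open>p \<in> {1..m}\<close> by (simp add: sw_def)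
    qed }
qed simp_all

lemma pl_Aword: "pl f [1..<Suc m] = map (\<lambda>p. (f 1, f (Suc p))) [1..<Suc m]"
proof (induction m)
  case (Suc m)
  have r: "[1..<Suc (Suc m)] = [1..<Suc m] @ [Suc m]" by simp
  have "wprod [1..<Suc m] (Suc (Suc m)) = Suc (Suc m)" by (rule wprod_fixed) auto
  then have "pl (f \<circ> wprod [1..<Suc m]) [Suc m] = [(f 1, f (Suc (Suc m)))]" using wprod_Aword(1)[of m] by simp
  then show ?case unfolding r pl_append Suc.IH by simp
qed simp

lemma wprod_shift: "wprod (map (\<lambda>i. i + s) v) (p + s) = wprod v p + s"
  by (induction v) (auto simp: sw_def)

text \<open>Positions and names shift separately. Deleting the largest wire keeps the names
  (\<open>G = id\<close>) and shifts positions only after its passage; deleting wire 1 renames the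
  wires (\<open>G = Suc\<close>) and shifts positions only before its passage.\<close>

lemma pl_shift:
  assumes "set v \<subseteq> {1..m - 1}" "\<And>p. p \<in> {1..m} \<Longrightarrow> g' (p + s) = G (g p)"
  shows "pl g' (map (\<lambda>i. i + s) v) = map (map_prod G G) (pl g v)"
  using assms
proof (induction v arbitrary: g' g)
  case (Cons i v)
  have i: "1 \<le> i" "i < m" and v: "set v \<subseteq> {1..m - 1}" using Cons.prems(1) by auto
  have "pl (g' \<circ> sw (i + s)) (map (\<lambda>i. i + s) v) = map (map_prod G G) (pl (g \<circ> sw i) v)"
  proof (rule Cons.IH[OF v])
    fix p assume p: "p \<in> {1..m}"
    have "sw (i + s) (p + s) = sw i p + s" by (simp add: sw_def)
    then show "(g' \<circ> sw (i + s)) (p + s) = G ((g \<circ> sw i) p)" using Cons.prems(2)[OF sw_in[OF i p]] by simp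
  qed
  moreover have "g' (i + s) = G (g i)" "g' (i + 1 + s) = G (g (i + 1))"
    using Cons.prems(2)[of i] Cons.prems(2)[of "i + 1"] i by simp_all
  ultimately show ?case by (simp add: add.commute add.left_commute)
qed simp

lemma minus_one_plus_one:
  fixes v :: "nat list"
  assumes "\<And>i. i \<in> set v \<Longrightarrow> 1 \<le> i"
  shows "map (\<lambda>i. i + 1) (map (\<lambda>x. x - 1) v) = v"
proof -
  have "map (\<lambda>i. i + 1) (map (\<lambda>x. x - 1) v) = map (\<lambda>x. x) v" unfolding map_map
  proof (rule map_cong[OF refl])
    fix i assume "i \<in> set v"
    from assms[OF this] show "((\<lambda>i. i + 1) \<circ> (\<lambda>x. x - 1)) i = i" by simp
  qed
  then show ?thesis by simp
qed

lemma prec_asym: "distinct L \<Longrightarrow> prec p q L \<Longrightarrow> \<not> prec q p L"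
  by (induction L) (auto dest: prec_set)

lemma Sigma_Suc_length: "length w = Suc m * m div 2 \<Longrightarrow> length w = l + m \<Longrightarrow> l = m * (m - 1) div 2"
proof -
  have "Suc m * m = m * (m - 1) + 2 * m" by (cases m) (auto simp: algebra_simps)
  then show "length w = Suc m * m div 2 \<Longrightarrow> length w = l + m \<Longrightarrow> l = m * (m - 1) div 2" by simp
qed

text \<open>The factor \<open>Dword m\<close> is the whole passage of wire \<open>m + 1\<close> from
  the right end to the left end. Hence the list of crossings of \<open>w'\<close> is that of
  \<open>w\<close> without the pairs containing \<open>m + 1\<close>, and \<open>v\<close> consists
  of the crossings below this wire.\<close>

lemma Dword_form:
  assumes w: "w \<in> Sigma (m + 1)" "w = u @ Dword m @ v" and m: "1 \<le> m"
  defines "w' \<equiv> u @ map (\<lambda>x. x - 1) v"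
  shows "w' \<in> Sigma m"
    and "\<And>a b c. 1 \<le> a \<Longrightarrow> a < b \<Longrightarrow> b < c \<Longrightarrow> c \<le> m \<Longrightarrow> triple w' a b c \<longleftrightarrow> triple w a b c"
    and "v = [] \<longleftrightarrow> (\<forall>a b. 1 \<le> a \<and> a < b \<and> b < m + 1 \<longrightarrow> triple w a b (m + 1))"
proof -
  have D: "Dword m = rev [1..<Suc m]" by (simp add: Dword_def)
  have L: "set u \<subseteq> {1..m}" "set v \<subseteq> {1..m}" using SigmaD(2)[OF w(1)] w(2) by auto
  have incr: "x < y" if "(x, y) \<in> set (pl id w)" for x y
    using that Sigma_pl(1)[OF w(1)] by (auto simp: pairs_def)
  have bu: "bij_betw (wprod u) {1..m + 1} {1..m + 1}" using bij_wprod[of u "m + 1"] L by simp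
  have plD: "pl id w = pl id u @ map (\<lambda>p. (wprod u p, wprod u (Suc m))) (rev [1..<Suc m]) @ pl (wprod u \<circ> wprod (Dword m)) v"
    unfolding w(2) pl_append D pl_Dword by (simp add: comp_assoc)
  \<comment> \<open>The wire that enters \<open>Dword m\<close> on the right crosses every other
    wire as the right one, so it is the largest. But the last letter \<open>m\<close> of
    \<open>u\<close> would have put there the smaller of the two wires it crosses.\<close>
  have mu: "m \<notin> set u"
  proof
    assume "m \<in> set u"
    then obtain u1 u2 where u: "u = u1 @ m # u2" "m \<notin> set u2" by (meson split_list_last)
    have f: "wprod u2 (Suc m) = Suc m"
    proof (rule wprod_fixed)
      fix i assume i: "i \<in> set u2"
      then have "i \<noteq> m" "i \<le> m" using u L(1) by auto
      then show "Suc m \<noteq> i \<and> Suc m \<noteq> i + 1" by simp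
    qed
    have x: "wprod u (Suc m) = wprod u1 m" unfolding u(1) wprod_append by (simp add: f sw_def)
    have "w = u1 @ m # (u2 @ Dword m @ v)" using w(2) u(1) by simp
    from Sigma_letter[OF w(1) this] have lt: "wprod u1 m < wprod u1 (m + 1)" .
    have "wprod u1 (m + 1) \<in> {1..m + 1}" using wprod_in[of u1 m "m + 1"] u(1) L(1) by auto
    then obtain p where p: "p \<in> {1..m + 1}" "wprod u p = wprod u1 (m + 1)"
      using bu unfolding bij_betw_def by (metis imageE)
    have "p \<noteq> Suc m" using p(2) x lt by auto
    then have "p \<in> set (rev [1..<Suc m])" using p(1) by auto
    then have "(wprod u p, wprod u (Suc m)) \<in> set (map (\<lambda>p. (wprod u p, wprod u (Suc m))) (rev [1..<Suc m]))"
      unfolding set_map by (rule imageI)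
    then have "(wprod u p, wprod u (Suc m)) \<in> set (pl id w)" unfolding plD set_append by blast
    then show False using incr lt p(2) x by fastforce
  qed
  have uL: "set u \<subseteq> {1..m - 1}"
  proof
    fix i assume "i \<in> set u"
    then have "i \<noteq> m" "i \<in> {1..m}" using mu L(1) by auto
    then show "i \<in> {1..m - 1}" by auto
  qed
  have fm: "wprod u (Suc m) = Suc m" by (rule wprod_fixed) (use uL in fastforce)
  \<comment> \<open>After \<open>Dword m\<close> the wire \<open>m + 1\<close> is in position 1; an
    initial occurrence of the letter 1 would make it the left wire of a crossing.\<close>
  have v1: "1 \<notin> set v"
  proof
    assume "1 \<in> set v"
    then obtain v1 v2 where v: "v = v1 @ 1 # v2" "1 \<notin> set v1" by (meson split_list_first)
    have f: "wprod v1 1 = 1"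
    proof (rule wprod_fixed)
      fix i assume i: "i \<in> set v1"
      then have "i \<noteq> 1" "1 \<le> i" using v L(2) by auto
      then show "1 \<noteq> i \<and> 1 \<noteq> i + 1" by simp
    qed
    let ?x = "u @ Dword m @ v1"
    have "w = ?x @ 1 # v2" using w(2) v(1) by simp
    from Sigma_letter[OF w(1) this] have lt: "wprod ?x 1 < wprod ?x (1 + 1)" .
    have "wprod ?x 1 = wprod u (wprod (Dword m) (wprod v1 1))" by (simp add: wprod_append)
    also have "\<dots> = Suc m" unfolding f D wprod_Dword(1) fm ..
    finally have e: "wprod ?x 1 = Suc m" .
    have "set ?x \<subseteq> {1..m}" using L v(1) m by (auto simp: Dword_def)
    from wprod_in[OF this, of "1 + 1"] have "wprod ?x (1 + 1) \<le> m + 1" using m by auto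
    then show False using lt e by simp
  qed
  let ?v = "map (\<lambda>x. x - 1) v"
  have vg: "2 \<le> i \<and> i \<le> m" if "i \<in> set v" for i
  proof -
    have "i \<noteq> 1" "i \<in> {1..m}" using v1 L(2) that by auto
    then show ?thesis by auto
  qed
  have vs: "v = map (\<lambda>i. i + 1) ?v" by (rule minus_one_plus_one[symmetric]) (use vg in force)
  have vL: "set ?v \<subseteq> {1..m - 1}" using vg by force
  have wv: "wprod v (p + 1) = wprod ?v p + 1" for p
    using wprod_shift[of 1 ?v p] unfolding vs[symmetric] .
  have g: "(wprod u \<circ> wprod (Dword m)) (p + 1) = id (wprod u p)" if "p \<in> {1..m}" for p
    using wprod_Dword(2)[OF that] by (simp add: D)
  have "pl (wprod u \<circ> wprod (Dword m)) (map (\<lambda>i. i + 1) ?v) = map (map_prod id id) (pl (wprod u) ?v)"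
    by (rule pl_shift[OF vL]) (rule g)
  then have pv: "pl (wprod u \<circ> wprod (Dword m)) v = pl (wprod u) ?v"
    unfolding vs[symmetric] prod.map_id0 list.map_id .
  show S: "w' \<in> Sigma m"
  proof -
    have len: "length w = length w' + m" unfolding w(2) w'_def by (simp add: Dword_def)
    have "length w = Suc m * m div 2" using SigmaD(1)[OF w(1)] by simp
    from Sigma_Suc_length[OF this len] have 1: "length w' = m * (m - 1) div 2" .
    have 2: "set w' \<subseteq> {1..m - 1}" unfolding w'_def using uL vL by auto
    have "wprod w' p = m + 1 - p" if p: "p \<in> {1..m}" for p
    proof -
      have q: "wprod ?v p \<in> {1..m}" using wprod_in[of ?v "m - 1" p] vL p m by simp
      have "m + 1 + 1 - (p + 1) = wprod w (p + 1)" using SigmaD(3)[OF w(1), of "p + 1"] p by simp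
      also have "\<dots> = wprod u (wprod (Dword m) (wprod ?v p + 1))" unfolding w(2) wprod_append by (simp only: o_apply wv)
      also have "\<dots> = wprod u (wprod ?v p)" using g[OF q] by simp
      also have "\<dots> = wprod w' p" unfolding w'_def wprod_append by simp
      finally show ?thesis by simp
    qed
    then show ?thesis using 1 2 by (simp add: Sigma_def)
  qed
  have plw': "pl id w' = pl id u @ pl (wprod u) ?v" unfolding w'_def pl_append by simp
  have pw: "set (pl id w') = pairs m" by (rule Sigma_pl(1)[OF S])
  let ?M = "map (\<lambda>p. (wprod u p, Suc m)) (rev [1..<Suc m])"
  have plw: "pl id w = pl id u @ ?M @ pl (wprod u) ?v" unfolding plD pv fm ..
  have small: "y \<noteq> Suc m" if "(x, y) \<in> set (pl id u) \<union> set (pl (wprod u) ?v)" for x y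
  proof -
    have "(x, y) \<in> pairs m" using that unfolding pw[symmetric] plw' set_append .
    then show ?thesis by (simp add: pairs_def)
  qed
  have fil: "filter (\<lambda>(x, y). y \<noteq> Suc m) (pl id w) = pl id w'"
  proof -
    have "filter (\<lambda>(x, y). y \<noteq> Suc m) (pl id u) = pl id u" "filter (\<lambda>(x, y). y \<noteq> Suc m) (pl (wprod u) ?v) = pl (wprod u) ?v"
      by (rule filter_True, use small in blast)+
    moreover have "filter (\<lambda>(x, y). y \<noteq> Suc m) ?M = []" by (rule filter_False) auto
    ultimately show ?thesis unfolding plw plw' filter_append by simp
  qed
  show "triple w' a b c \<longleftrightarrow> triple w a b c" if "1 \<le> a" "a < b" "b < c" "c \<le> m" for a b c
    unfolding triple_def fil[symmetric] by (rule prec_filter) (use that in auto)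
  have inM: "(b, Suc m) \<in> set ?M" if b: "1 \<le> b" "b \<le> m" for b
  proof -
    have "b \<in> {1..m + 1}" using b by simp
    then obtain p where p: "p \<in> {1..m + 1}" "wprod u p = b" using bu unfolding bij_betw_def by (metis imageE)
    have "p \<noteq> Suc m" using p(2) fm b by auto
    then have "p \<in> set (rev [1..<Suc m])" using p(1) by auto
    then show ?thesis using p(2) by force
  qed
  have dis: "distinct (pl id w)" by (rule Sigma_pl(2)[OF w(1)])
  show "v = [] \<longleftrightarrow> (\<forall>a b. 1 \<le> a \<and> a < b \<and> b < m + 1 \<longrightarrow> triple w a b (m + 1))"
  proof
    assume v: "v = []"
    show "\<forall>a b. 1 \<le> a \<and> a < b \<and> b < m + 1 \<longrightarrow> triple w a b (m + 1)"
    proof (intro allI impI)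
      fix a b assume ab: "1 \<le> a \<and> a < b \<and> b < m + 1"
      have "(a, b) \<in> set (pl id u)" using pw ab v unfolding plw' by (auto simp: pairs_def)
      moreover have "1 \<le> b" "b \<le> m" using ab by simp_all
      then have "(b, Suc m) \<in> set (?M @ pl (wprod u) ?v)" unfolding set_append using inM by blast
      ultimately have "prec (a, b) (b, Suc m) (pl id w)" unfolding plw prec_append[of _ _ "pl id u"] by blast
      then show "triple w a b (m + 1)" unfolding triple_def by simp
    qed
  next
    assume a: "\<forall>a b. 1 \<le> a \<and> a < b \<and> b < m + 1 \<longrightarrow> triple w a b (m + 1)"
    show "v = []"
    proof (rule ccontr)
      assume "v \<noteq> []"
      then have "pl (wprod u) ?v \<noteq> []" by (metis length_0_conv length_map length_pl)
      \<comment> \<open>Any crossing in \<open>v\<close> comes after the whole passage of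
        \<open>m + 1\<close>, in particular after the node of \<open>y\<close> and
        \<open>m + 1\<close>.\<close>
      then obtain x y where xy: "(x, y) \<in> set (pl (wprod u) ?v)" by (metis last_in_set surj_pair)
      then have "(x, y) \<in> pairs m" using pw unfolding plw' by auto
      then have o: "1 \<le> x" "x < y" "y \<le> m" by (auto simp: pairs_def)
      have "prec (x, y) (y, Suc m) (pl id w)" using a o unfolding triple_def by simp
      moreover have "(y, Suc m) \<in> set ?M" by (rule inM) (use o in simp_all)
      then have n: "(x, y) \<notin> set (pl id u)" "(x, y) \<notin> set ?M" "(y, Suc m) \<notin> set (pl (wprod u) ?v)"
        using dis xy unfolding plw distinct_append set_append by blast+
      then have "\<not> prec (x, y) (y, Suc m) (pl id u)" "\<not> prec (x, y) (y, Suc m) ?M" "\<not> prec (x, y) (y, Suc m) (pl (wprod u) ?v)"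
        using prec_set[of "(x, y)" "(y, Suc m)"] by blast+
      ultimately show False unfolding plw prec_append using n by blast
    qed
  qed
qed

text \<open>The mirror image for the passage of wire 1 from left to right. The remaining wires are
  renamed, so crossings of \<open>w'\<close> correspond to those of \<open>w\<close> under
  \<open>Suc\<close> on both entries.\<close>

lemma Aword_form:
  assumes w: "w \<in> Sigma (m + 1)" "w = u @ Aword m @ v" and m: "1 \<le> m"
  defines "w' \<equiv> map (\<lambda>x. x - 1) u @ v"
  shows "w' \<in> Sigma m"
    and "\<And>a b c. 1 \<le> a \<Longrightarrow> a < b \<Longrightarrow> b < c \<Longrightarrow> c \<le> m \<Longrightarrow> triple w' a b c \<longleftrightarrow> triple w (a + 1) (b + 1) (c + 1)"
    and "v = [] \<longleftrightarrow> (\<forall>b c. 1 < b \<and> b < c \<and> c \<le> m + 1 \<longrightarrow> \<not> triple w 1 b c)"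
proof -
  have D: "Aword m = [1..<Suc m]" by (simp add: Aword_def)
  have L: "set u \<subseteq> {1..m}" "set v \<subseteq> {1..m}" using SigmaD(2)[OF w(1)] w(2) by auto
  have incr: "x < y" if "(x, y) \<in> set (pl id w)" for x y
    using that Sigma_pl(1)[OF w(1)] by (auto simp: pairs_def)
  have bu: "bij_betw (wprod u) {1..m + 1} {1..m + 1}" using bij_wprod[of u "m + 1"] L by simp
  have plD: "pl id w = pl id u @ map (\<lambda>p. (wprod u 1, wprod u (Suc p))) [1..<Suc m] @ pl (wprod u \<circ> wprod (Aword m)) v"
    unfolding w(2) pl_append D pl_Aword by (simp add: comp_assoc)
  have mu: "1 \<notin> set u"
  proof
    assume "1 \<in> set u"
    then obtain u1 u2 where u: "u = u1 @ 1 # u2" "1 \<notin> set u2" by (meson split_list_last)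
    have f: "wprod u2 1 = 1"
    proof (rule wprod_fixed)
      fix i assume i: "i \<in> set u2"
      then have "i \<noteq> 1" "1 \<le> i" using u L(1) by auto
      then show "1 \<noteq> i \<and> 1 \<noteq> i + 1" by simp
    qed
    have x: "wprod u 1 = wprod u1 (1 + 1)" unfolding u(1) wprod_append by (simp add: f[unfolded One_nat_def] sw_def)
    have "w = u1 @ 1 # (u2 @ Aword m @ v)" using w(2) u(1) by simp
    from Sigma_letter[OF w(1) this] have lt: "wprod u1 1 < wprod u1 (1 + 1)" .
    have "wprod u1 1 \<in> {1..m + 1}" using wprod_in[of u1 m 1] u(1) L(1) by auto
    then obtain p where p: "p \<in> {1..m + 1}" "wprod u p = wprod u1 1"
      using bu unfolding bij_betw_def by (metis imageE)
    have "p \<noteq> 1" using p(2) x lt by auto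
    then have "p - 1 \<in> set [1..<Suc m]" "Suc (p - 1) = p" using p(1) by auto
    then have "(\<lambda>p. (wprod u 1, wprod u (Suc p))) (p - 1) \<in> set (map (\<lambda>p. (wprod u 1, wprod u (Suc p))) [1..<Suc m])"
      unfolding set_map by (intro imageI)
    then have "(wprod u 1, wprod u p) \<in> set (pl id w)" unfolding plD set_append using \<open>Suc (p - 1) = p\<close> by simp
    then show False using incr lt p(2) x by fastforce
  qed
  have ug: "2 \<le> i \<and> i \<le> m" if "i \<in> set u" for i
  proof -
    have "i \<noteq> 1" "i \<in> {1..m}" using mu L(1) that by auto
    then show ?thesis by auto
  qed
  have fm: "wprod u 1 = 1" by (rule wprod_fixed) (use ug in fastforce)
  have v1: "m \<notin> set v"
  proof
    assume "m \<in> set v"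
    then obtain v1 v2 where v: "v = v1 @ m # v2" "m \<notin> set v1" by (meson split_list_first)
    have f: "wprod v1 (Suc m) = Suc m"
    proof (rule wprod_fixed)
      fix i assume i: "i \<in> set v1"
      then have "i \<noteq> m" "i \<le> m" using v L(2) by auto
      then show "Suc m \<noteq> i \<and> Suc m \<noteq> i + 1" by simp
    qed
    let ?x = "u @ Aword m @ v1"
    have "w = ?x @ m # v2" using w(2) v(1) by simp
    from Sigma_letter[OF w(1) this] have lt: "wprod ?x m < wprod ?x (Suc m)" by simp
    have "wprod ?x (Suc m) = wprod u (wprod (Aword m) (wprod v1 (Suc m)))" by (simp add: wprod_append)
    also have "\<dots> = 1" unfolding f D wprod_Aword(1) fm ..
    finally have e: "wprod ?x (Suc m) = 1" .
    have "set ?x \<subseteq> {1..m}" using L v(1) m by (auto simp: Aword_def)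
    from wprod_in[OF this, of m] have "1 \<le> wprod ?x m" using m by auto
    then show False using lt e by simp
  qed
  let ?u = "map (\<lambda>x. x - 1) u"
  have us: "u = map (\<lambda>i. i + 1) ?u" by (rule minus_one_plus_one[symmetric]) (use ug in force)
  have uL: "set ?u \<subseteq> {1..m - 1}" using ug by force
  have vL: "set v \<subseteq> {1..m - 1}"
  proof
    fix i assume "i \<in> set v"
    then have "i \<noteq> m" "i \<in> {1..m}" using v1 L(2) by auto
    then show "i \<in> {1..m - 1}" by auto
  qed
  have wu: "wprod u (p + 1) = wprod ?u p + 1" for p
    using wprod_shift[of 1 ?u p] unfolding us[symmetric] .
  have g: "(wprod u \<circ> wprod (Aword m)) (p + 0) = Suc (wprod ?u p)" if "p \<in> {1..m}" for p
    using wprod_Aword(2)[OF that] wu[of p] by (simp add: D)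
  have pu: "pl id u = map (map_prod Suc Suc) (pl id ?u)"
    using pl_shift[of ?u m id 1 Suc id, OF uL] unfolding us[symmetric] by simp
  have pv: "pl (wprod u \<circ> wprod (Aword m)) v = map (map_prod Suc Suc) (pl (wprod ?u) v)"
    using pl_shift[of v m "wprod u \<circ> wprod (Aword m)" 0 Suc "wprod ?u", OF vL g] by simp
  show S: "w' \<in> Sigma m"
  proof -
    have len: "length w = length w' + m" unfolding w(2) w'_def by (simp add: Aword_def)
    have "length w = Suc m * m div 2" using SigmaD(1)[OF w(1)] by simp
    from Sigma_Suc_length[OF this len] have 1: "length w' = m * (m - 1) div 2" .
    have 2: "set w' \<subseteq> {1..m - 1}" unfolding w'_def using uL vL by auto
    have "wprod w' p = m + 1 - p" if p: "p \<in> {1..m}" for p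
    proof -
      have q: "wprod v p \<in> {1..m}" using wprod_in[of v "m - 1" p] vL p m by simp
      have "m + 1 + 1 - p = wprod w p" using SigmaD(3)[OF w(1), of p] p by simp
      also have "\<dots> = wprod u (wprod (Aword m) (wprod v p))" unfolding w(2) wprod_append by simp
      also have "\<dots> = Suc (wprod ?u (wprod v p))" using g[OF q] by simp
      also have "\<dots> = Suc (wprod w' p)" unfolding w'_def wprod_append by simp
      finally show ?thesis by simp
    qed
    then show ?thesis using 1 2 by (simp add: Sigma_def)
  qed
  have plw': "pl id w' = pl id ?u @ pl (wprod ?u) v" unfolding w'_def pl_append by simp
  have pw: "set (pl id w') = pairs m" by (rule Sigma_pl(1)[OF S])
  let ?M = "map (\<lambda>p. (1 :: nat, wprod u (Suc p))) [1..<Suc m]"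
  let ?s = "map_prod Suc Suc :: nat \<times> nat \<Rightarrow> nat \<times> nat"
  have plw: "pl id w = map ?s (pl id ?u) @ ?M @ map ?s (pl (wprod ?u) v)" unfolding plD pu pv fm ..
  have small: "(\<lambda>(x, y). x \<noteq> 1) p" if "p \<in> set (map ?s (pl id ?u)) \<union> set (map ?s (pl (wprod ?u) v))" for p
  proof -
    have "p \<in> ?s ` pairs m" using that unfolding pw[symmetric] plw' set_append set_map image_Un .
    then show ?thesis by (auto simp: pairs_def)
  qed
  have fil: "filter (\<lambda>(x, y). x \<noteq> 1) (pl id w) = map ?s (pl id w')"
  proof -
    have f1: "filter (\<lambda>(x, y). x \<noteq> 1) (map ?s (pl id ?u)) = map ?s (pl id ?u)"
      by (intro filter_True ballI small UnI1)
    have f2: "filter (\<lambda>(x, y). x \<noteq> 1) (map ?s (pl (wprod ?u) v)) = map ?s (pl (wprod ?u) v)"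
      by (intro filter_True ballI small UnI2)
    have f3: "filter (\<lambda>(x, y). x \<noteq> 1) ?M = []" by (rule filter_False) auto
    show ?thesis unfolding plw plw' filter_append map_append f1 f2 f3 append_Nil ..
  qed
  have injs: "inj ?s" by (simp add: prod.inj_map)
  show "triple w' a b c \<longleftrightarrow> triple w (a + 1) (b + 1) (c + 1)" if "1 \<le> a" "a < b" "b < c" "c \<le> m" for a b c
  proof -
    have "triple w' a b c \<longleftrightarrow> prec (?s (a, b)) (?s (b, c)) (map ?s (pl id w'))"
      unfolding triple_def by (rule prec_map[OF injs, symmetric])
    also have "\<dots> \<longleftrightarrow> prec (?s (a, b)) (?s (b, c)) (pl id w)"
      unfolding fil[symmetric] by (rule prec_filter) (use that in auto)
    finally show ?thesis unfolding triple_def by simp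
  qed
  have inM: "(1, b) \<in> set ?M" if b: "1 < b" "b \<le> m + 1" for b
  proof -
    have "b \<in> {1..m + 1}" using b by simp
    then obtain p where p: "p \<in> {1..m + 1}" "wprod u p = b" using bu unfolding bij_betw_def by (metis imageE)
    have "p \<noteq> 1" using p(2) fm b by auto
    then have "p - 1 \<in> set [1..<Suc m]" "Suc (p - 1) = p" using p(1) by auto
    then show ?thesis using p(2) by force
  qed
  have dis: "distinct (pl id w)" by (rule Sigma_pl(2)[OF w(1)])
  have no: "\<not> (prec (1, b) (b, c) (pl id w))"
    if "(1, b) \<in> set ?M" "(b, c) \<in> set (map ?s (pl id ?u))" for b c
  proof -
    have "prec (b, c) (1, b) (pl id w)" unfolding plw prec_append set_append
      by (intro disjI2 conjI UnI1) (rule that(2), rule that(1))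
    then show ?thesis by (rule prec_asym[OF dis])
  qed
  show "v = [] \<longleftrightarrow> (\<forall>b c. 1 < b \<and> b < c \<and> c \<le> m + 1 \<longrightarrow> \<not> triple w 1 b c)"
  proof
    assume v: "v = []"
    show "\<forall>b c. 1 < b \<and> b < c \<and> c \<le> m + 1 \<longrightarrow> \<not> triple w 1 b c"
    proof (intro allI impI)
      fix b c assume bc: "1 < b \<and> b < c \<and> c \<le> m + 1"
      have "(b - 1, c - 1) \<in> pairs m" using bc by (auto simp: pairs_def)
      then have "(b - 1, c - 1) \<in> set (pl id ?u)" unfolding pw[symmetric] plw' v by simp
      then have "?s (b - 1, c - 1) \<in> set (map ?s (pl id ?u))" unfolding set_map by (rule imageI)
      then have "(b, c) \<in> set (map ?s (pl id ?u))" using bc by simp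
      moreover have "(1, b) \<in> set ?M" by (rule inM) (use bc in simp_all)
      ultimately show "\<not> triple w 1 b c" unfolding triple_def using no by blast
    qed
  next
    assume a: "\<forall>b c. 1 < b \<and> b < c \<and> c \<le> m + 1 \<longrightarrow> \<not> triple w 1 b c"
    show "v = []"
    proof (rule ccontr)
      assume "v \<noteq> []"
      then have "pl (wprod ?u) v \<noteq> []" by (metis length_0_conv length_pl)
      then obtain x y where xy: "(x, y) \<in> set (pl (wprod ?u) v)" by (metis last_in_set surj_pair)
      then have "(x, y) \<in> pairs m" using pw unfolding plw' by auto
      then have o: "1 \<le> x" "x < y" "y \<le> m" by (auto simp: pairs_def)
      have "?s (x, y) \<in> set (map ?s (pl (wprod ?u) v))" unfolding set_map using xy by (rule imageI)
      then have "(Suc x, Suc y) \<in> set (map ?s (pl (wprod ?u) v))" by simp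
      moreover have "(1, Suc x) \<in> set ?M" by (rule inM) (use o in simp_all)
      ultimately have "prec (1, Suc x) (Suc x, Suc y) (pl id w)" unfolding plw prec_append by blast
      then show False using a o unfolding triple_def by auto
    qed
  qed
qed

text \<open>The choice of a decomposition is immaterial because everything is expressed by
  \<open>triple\<close>, which is invariant under 2-moves.\<close>

lemma contr_spec:
  assumes w: "w \<in> Sigma (m + 1)" and m: "1 \<le> m"
  shows "contr s m w \<in> Sigma m"
    and "\<And>a b c. 1 \<le> a \<Longrightarrow> a < b \<Longrightarrow> b < c \<Longrightarrow> c \<le> m \<Longrightarrow> triple (contr s m w) a b c \<longleftrightarrow>
      (case s of D \<Rightarrow> triple w a b c | A \<Rightarrow> triple w (a + 1) (b + 1) (c + 1))"
    and "ind s m w = 0 \<longleftrightarrow> (case s of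
      D \<Rightarrow> \<forall>a b. 1 \<le> a \<and> a < b \<and> b < m + 1 \<longrightarrow> triple w a b (m + 1)
    | A \<Rightarrow> \<forall>b c. 1 < b \<and> b < c \<and> c \<le> m + 1 \<longrightarrow> \<not> triple w 1 b c)"
proof -
  have "contr s m w \<in> Sigma m \<and> (\<forall>a b c. 1 \<le> a \<and> a < b \<and> b < c \<and> c \<le> m \<longrightarrow> (triple (contr s m w) a b c \<longleftrightarrow>
      (case s of D \<Rightarrow> triple w a b c | A \<Rightarrow> triple w (a + 1) (b + 1) (c + 1))))
    \<and> (ind s m w = 0 \<longleftrightarrow> (case s of
      D \<Rightarrow> \<forall>a b. 1 \<le> a \<and> a < b \<and> b < m + 1 \<longrightarrow> triple w a b (m + 1)
    | A \<Rightarrow> \<forall>b c. 1 < b \<and> b < c \<and> c \<le> m + 1 \<longrightarrow> \<not> triple w 1 b c))"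
  proof (cases s)
    case D
    note e = comm_equiv_Sigma[OF decD_spec[OF w] w]
    show ?thesis using Dword_form[OF conjunct1[OF e] refl m] conjunct2[OF e] D by (simp add: contr_def ind_def)
  next
    case A
    note e = comm_equiv_Sigma[OF decA_spec[OF w] w]
    show ?thesis using Aword_form[OF conjunct1[OF e] refl m] conjunct2[OF e] A by (simp add: contr_def ind_def)
  qed
  then show "contr s m w \<in> Sigma m"
    "\<And>a b c. 1 \<le> a \<Longrightarrow> a < b \<Longrightarrow> b < c \<Longrightarrow> c \<le> m \<Longrightarrow> triple (contr s m w) a b c \<longleftrightarrow>
      (case s of D \<Rightarrow> triple w a b c | A \<Rightarrow> triple w (a + 1) (b + 1) (c + 1))"
    "ind s m w = 0 \<longleftrightarrow> (case s of
      D \<Rightarrow> \<forall>a b. 1 \<le> a \<and> a < b \<and> b < m + 1 \<longrightarrow> triple w a b (m + 1)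
    | A \<Rightarrow> \<forall>b c. 1 < b \<and> b < c \<and> c \<le> m + 1 \<longrightarrow> \<not> triple w 1 b c)"
    by blast+
qed

section \<open>Vanishing indices as a condition on triples\<close>

fun goodT :: "(nat \<Rightarrow> nat \<Rightarrow> nat \<Rightarrow> bool) \<Rightarrow> nat \<Rightarrow> nat \<Rightarrow> bool" where
  "goodT T 0 lo \<longleftrightarrow> True"
| "goodT T (Suc d) lo \<longleftrightarrow>
     (\<forall>a b. lo \<le> a \<and> a < b \<and> b < lo + Suc d \<longrightarrow> T a b (lo + Suc d)) \<and> goodT T d lo
   \<or> (\<forall>b c. lo < b \<and> b < c \<and> c \<le> lo + Suc d \<longrightarrow> \<not> T lo b c) \<and> goodT T d (lo + 1)"

text \<open>\<open>contr A\<close> renumbers the wires from 1, while intervals keep the original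
  names; \<open>s\<close> accounts for the difference.\<close>

lemma goodT_shift:
  assumes "\<And>a b c. lo \<le> a \<Longrightarrow> a < b \<Longrightarrow> b < c \<Longrightarrow> c \<le> lo + d \<Longrightarrow> T' a b c \<longleftrightarrow> T (a + s) (b + s) (c + s)"
  shows "goodT T' d lo \<longleftrightarrow> goodT T d (lo + s)"
  using assms
proof (induction d arbitrary: lo)
  case (Suc d)
  have "goodT T' d lo \<longleftrightarrow> goodT T d (lo + s)" "goodT T' d (lo + 1) \<longleftrightarrow> goodT T d (lo + 1 + s)"
    by (rule Suc.IH; rule Suc.prems; simp)+
  moreover have "(\<forall>a b. lo \<le> a \<and> a < b \<and> b < lo + Suc d \<longrightarrow> T' a b (lo + Suc d)) \<longleftrightarrow>
    (\<forall>a b. lo + s \<le> a \<and> a < b \<and> b < lo + s + Suc d \<longrightarrow> T a b (lo + s + Suc d))" (is "?L \<longleftrightarrow> ?R")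
  proof
    assume L: ?L
    show ?R
    proof (intro allI impI)
      fix a b assume ab: "lo + s \<le> a \<and> a < b \<and> b < lo + s + Suc d"
      then have "lo \<le> a - s \<and> a - s < b - s \<and> b - s < lo + Suc d" by auto
      then have "T' (a - s) (b - s) (lo + Suc d)" using L by blast
      moreover have "lo \<le> a - s" "a - s < b - s" "b - s < lo + Suc d" "a - s + s = a" "b - s + s = b"
        using ab by auto
      ultimately have "T a b (lo + Suc d + s)" using Suc.prems[of "a - s" "b - s" "lo + Suc d"] by simp
      moreover have "lo + Suc d + s = lo + s + Suc d" by simp
      ultimately show "T a b (lo + s + Suc d)" by (simp only:)
    qed
  next
    assume R: ?R
    show ?L
    proof (intro allI impI)
      fix a b assume ab: "lo \<le> a \<and> a < b \<and> b < lo + Suc d"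
      then have "T (a + s) (b + s) (lo + s + Suc d)" using R by auto
      then show "T' a b (lo + Suc d)" using Suc.prems[of a b "lo + Suc d"] ab by (simp add: ac_simps)
    qed
  qed
  moreover have "(\<forall>b c. lo < b \<and> b < c \<and> c \<le> lo + Suc d \<longrightarrow> \<not> T' lo b c) \<longleftrightarrow>
    (\<forall>b c. lo + s < b \<and> b < c \<and> c \<le> lo + s + Suc d \<longrightarrow> \<not> T (lo + s) b c)" (is "?L \<longleftrightarrow> ?R")
  proof
    assume L: ?L
    show ?R
    proof (intro allI impI)
      fix b c assume bc: "lo + s < b \<and> b < c \<and> c \<le> lo + s + Suc d"
      then have "lo < b - s \<and> b - s < c - s \<and> c - s \<le> lo + Suc d" by auto
      then have "\<not> T' lo (b - s) (c - s)" using L by blast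
      moreover have "lo < b - s" "b - s < c - s" "c - s \<le> lo + Suc d" "b - s + s = b" "c - s + s = c" using bc by auto
      ultimately show "\<not> T (lo + s) b c" using Suc.prems[of lo "b - s" "c - s"] by simp
    qed
  next
    assume R: ?R
    show ?L
    proof (intro allI impI)
      fix b c assume bc: "lo < b \<and> b < c \<and> c \<le> lo + Suc d"
      then have "\<not> T (lo + s) (b + s) (c + s)" using R by auto
      then show "\<not> T' lo b c" using Suc.prems[of lo b c] bc by auto
    qed
  qed
  ultimately show ?case unfolding goodT.simps by (simp only: ac_simps)
qed simp

lemma citer_Suc_front: "citer \<sigma> (Suc m) (Suc r) w = citer \<sigma> m r (contr (\<sigma> (Suc m)) (Suc m) w)"
  by (induction r) auto

lemma citer_cong: "(\<And>k. k \<le> m \<Longrightarrow> \<sigma> k = \<tau> k) \<Longrightarrow> citer \<sigma> m r w = citer \<tau> m r w"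
  by (induction r) auto

theorem ind_sequence_iff_goodT:
  "w \<in> Sigma (m + 1) \<Longrightarrow>
   (\<exists>\<sigma> :: nat \<Rightarrow> AD. \<forall>k\<in>{1..m}. ind (\<sigma> k) k (citer \<sigma> m (m - k) w) = 0) \<longleftrightarrow> goodT (triple w) m 1"
proof (induction m arbitrary: w)
  case (Suc m)
  have w: "w \<in> Sigma (Suc m + 1)" "1 \<le> Suc m" using Suc.prems by simp_all
  let ?P = "\<lambda>m w \<sigma>. \<forall>k\<in>{1..m}. ind (\<sigma> k) k (citer \<sigma> m (m - k) w) = 0"
  have step: "?P (Suc m) w \<sigma> \<longleftrightarrow> ind (\<sigma> (Suc m)) (Suc m) w = 0 \<and> ?P m (contr (\<sigma> (Suc m)) (Suc m) w) \<sigma>" for \<sigma>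
  proof -
    have "{1..Suc m} = insert (Suc m) {1..m}" by auto
    moreover have "citer \<sigma> (Suc m) (Suc m - k) w = citer \<sigma> m (m - k) (contr (\<sigma> (Suc m)) (Suc m) w)" if "k \<in> {1..m}" for k
      using citer_Suc_front[of \<sigma> m "m - k" w] that by (simp add: Suc_diff_le)
    ultimately show ?thesis by simp
  qed
  have "(\<exists>\<sigma>. ?P (Suc m) w \<sigma>) \<longleftrightarrow> (\<exists>s. ind s (Suc m) w = 0 \<and> (\<exists>\<sigma>. ?P m (contr s (Suc m) w) \<sigma>))"
  proof
    assume "\<exists>\<sigma>. ?P (Suc m) w \<sigma>"
    then show "\<exists>s. ind s (Suc m) w = 0 \<and> (\<exists>\<sigma>. ?P m (contr s (Suc m) w) \<sigma>)" unfolding step by blast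
  next
    assume "\<exists>s. ind s (Suc m) w = 0 \<and> (\<exists>\<sigma>. ?P m (contr s (Suc m) w) \<sigma>)"
    then obtain s \<sigma> where s: "ind s (Suc m) w = 0" "?P m (contr s (Suc m) w) \<sigma>" by blast
    \<comment> \<open>For \<open>m\<close> the iteration reads the sequence only up to
      \<open>m\<close>, so its value at \<open>Suc m\<close> is free.\<close>
    let ?\<tau> = "\<sigma>(Suc m := s)"
    have "?P m (contr s (Suc m) w) ?\<tau>"
    proof
      fix k assume k: "k \<in> {1..m}"
      have "citer ?\<tau> m (m - k) (contr s (Suc m) w) = citer \<sigma> m (m - k) (contr s (Suc m) w)"
        by (rule citer_cong) simp
      then show "ind (?\<tau> k) k (citer ?\<tau> m (m - k) (contr s (Suc m) w)) = 0" using s(2) k by simp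
    qed
    moreover have e: "?\<tau> (Suc m) = s" by simp
    ultimately have "?P (Suc m) w ?\<tau>" unfolding step e using s(1) by blast
    then show "\<exists>\<sigma>. ?P (Suc m) w \<sigma>" by (intro exI[of _ ?\<tau>])
  qed
  also have "\<dots> \<longleftrightarrow> (\<exists>s. ind s (Suc m) w = 0 \<and> goodT (triple (contr s (Suc m) w)) m 1)"
    using Suc.IH contr_spec(1)[OF w] by simp
  also have "\<dots> \<longleftrightarrow> ind D (Suc m) w = 0 \<and> goodT (triple w) m 1 \<or> ind A (Suc m) w = 0 \<and> goodT (triple w) m (1 + 1)"
  proof -
    have "goodT (triple (contr D (Suc m) w)) m 1 \<longleftrightarrow> goodT (triple w) m (1 + 0)"
      by (rule goodT_shift) (use contr_spec(2)[OF w, of _ _ _ D] in simp)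
    moreover have "goodT (triple (contr A (Suc m) w)) m 1 \<longleftrightarrow> goodT (triple w) m (1 + 1)"
      by (rule goodT_shift) (use contr_spec(2)[OF w, of _ _ _ A] in simp)
    moreover have "(\<exists>s. Q s) \<longleftrightarrow> Q D \<or> Q A" for Q :: "AD \<Rightarrow> bool" by (metis AD.exhaust)
    ultimately show ?thesis by simp
  qed
  also have "\<dots> \<longleftrightarrow> goodT (triple w) (Suc m) 1"
    using contr_spec(3)[OF w, of D] contr_spec(3)[OF w, of A] by simp
  finally show ?case .
qed simp

section \<open>Rigorous paths as walks\<close>

lemma node_nth:
  assumes w: "w \<in> Sigma M" and ab: "a \<in> {1..M}" "b \<in> {1..M}" "a \<noteq> b"
  shows "node w a b < length w" "pl id w ! node w a b = (min a b, max a b)"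
proof -
  have "node w a b < length w \<and> pl id w ! node w a b = (min a b, max a b)"
  proof (cases "a < b")
    case True
    have "1 \<le> a" "b \<le> M" using ab by simp_all
    from node(1,2)[OF w this(1) True this(2)] show ?thesis using True by simp
  next
    case False
    then have "b < a" "1 \<le> b" "a \<le> M" using ab by simp_all
    from node(1,2)[OF w this(2,1,3)] show ?thesis using \<open>b < a\<close> by (simp add: node_sym[of w a b])
  qed
  then show "node w a b < length w" "pl id w ! node w a b = (min a b, max a b)" by simp_all
qed

locale reduced_word =
  fixes w :: "nat list" and M n :: nat
  assumes w: "w \<in> Sigma M" and M: "M = n + 1"
begin

sublocale arrangement "node w" "M" "length w"
proof
  show "node w a b = node w b a" for a b by (rule node_sym)
  show "{a, b} = {c, d}" if "a \<in> {1..M}" "b \<in> {1..M}" "c \<in> {1..M}" "d \<in> {1..M}" "a \<noteq> b" "c \<noteq> d"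
    "node w a b = node w c d" for a b c d
  proof -
    have "(min a b, max a b) = (min c d, max c d)"
      using node_nth(2)[OF w that(1,2,5)] node_nth(2)[OF w that(3,4,6)] that(7) by simp
    then show ?thesis by (auto simp: min_def max_def split: if_splits)
  qed
  show "node w a b < length w" if "a \<in> {1..M}" "b \<in> {1..M}" "a \<noteq> b" for a b
    by (rule node_nth(1)[OF w that])
  show "node w a b < node w a c \<and> node w a c < node w b c \<or> node w b c < node w a c \<and> node w a c < node w a b"
    if "1 \<le> a" "a < b" "b < c" "c \<le> M" for a b c
    by (rule node_between[OF w that])
qed

abbreviation "wires \<equiv> {1..M}"

lemma lwire_rwire:
  assumes "j < length w"
  shows "lwire w j \<in> wires" "rwire w j \<in> wires" "lwire w j < rwire w j" "j = node w (lwire w j) (rwire w j)"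
proof -
  have "(lwire w j, rwire w j) \<in> set (pl id w)" using pl_wires[OF assms] nth_mem[of j "pl id w"] assms by simp
  then have p: "1 \<le> lwire w j" "lwire w j < rwire w j" "rwire w j \<le> M"
    using Sigma_pl(1)[OF w] by (auto simp: pairs_def)
  then show "lwire w j \<in> wires" "rwire w j \<in> wires" "lwire w j < rwire w j" by simp_all
  show "j = node w (lwire w j) (rwire w j)" by (rule node(3)[OF w p assms pl_wires[OF assms]])
qed

lemma on_nodeE:
  assumes "on_node w a j"
  obtains "a \<in> wires" "other w j a \<in> wires" "other w j a \<noteq> a" "j = node w a (other w j a)"
proof -
  have j: "j < length w" using assms by (simp add: on_node_def)
  note l = lwire_rwire[OF j]
  show ?thesis
  proof (cases "a = lwire w j")
    case True
    then show ?thesis using that l by (simp add: other_def)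
  next
    case False
    then have "a = rwire w j" using assms by (simp add: on_node_def)
    then show ?thesis using that l False node_sym[of w a "lwire w j"] by (simp add: other_def)
  qed
qed

lemma on_node_node:
  assumes "a \<in> wires" "c \<in> wires" "a \<noteq> c"
  shows "on_node w a (node w a c)" "other w (node w a c) a = c"
proof -
  let ?j = "node w a c"
  have j: "?j < length w" by (rule lt[OF assms])
  have "{a, c} = {lwire w ?j, rwire w ?j}"
    by (rule inj) (use assms lwire_rwire[OF j] in auto)
  then have e: "a = lwire w ?j \<and> c = rwire w ?j \<or> a = rwire w ?j \<and> c = lwire w ?j" by (auto simp: doubleton_eq_iff)
  then show "on_node w a ?j" using j by (auto simp: on_node_def)
  show "other w ?j a = c" using e lwire_rwire(3)[OF j] by (auto simp: other_def)
qed

lemma on_node_iff: "on_node w a j \<longleftrightarrow> a \<in> wires \<and> (\<exists>c\<in>wires. c \<noteq> a \<and> j = node w a c)"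
proof
  assume "on_node w a j"
  then show "a \<in> wires \<and> (\<exists>c\<in>wires. c \<noteq> a \<and> j = node w a c)" by (rule on_nodeE) blast
next
  assume "a \<in> wires \<and> (\<exists>c\<in>wires. c \<noteq> a \<and> j = node w a c)"
  then obtain c where "a \<in> wires" "c \<in> wires" "c \<noteq> a" "j = node w a c" by blast
  then show "on_node w a j" using on_node_node(1)[of a c] by simp
qed

text \<open>One relation for both orientations: from \<open>t\<close>, the height \<open>s\<close>
  is reached later when following wire \<open>a\<close> in its direction.\<close>

definition beyond :: "nat \<Rightarrow> nat \<Rightarrow> nat \<Rightarrow> nat \<Rightarrow> bool" where
  "beyond k a t s \<longleftrightarrow> (if a \<le> k then s < t else t < s)"

lemma next_on_None: "next_on w k a t = None \<Longrightarrow> on_node w a i \<Longrightarrow> \<not> beyond k a t i"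
  by (auto simp: next_on_def upw_def next_up_def next_down_def beyond_def split: if_splits)

lemma next_on_Some:
  assumes "next_on w k a t = Some j"
  shows "on_node w a j" "beyond k a t j" "\<And>i. on_node w a i \<Longrightarrow> beyond k a t i \<Longrightarrow> i = j \<or> beyond k a j i"
proof -
  have "on_node w a j \<and> beyond k a t j \<and> (\<forall>i. on_node w a i \<and> beyond k a t i \<longrightarrow> i = j \<or> beyond k a j i)"
  proof (cases "a \<le> k")
    case True
    let ?Q = "\<lambda>j'. j' < t \<and> on_node w a j'"
    have "\<exists>j'. ?Q j'" and j: "j = Greatest ?Q"
      using assms True by (auto simp: next_on_def upw_def next_up_def split: if_splits)
    then obtain i where i: "?Q i" by blast
    have b: "\<And>y. ?Q y \<Longrightarrow> y \<le> t" by simp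
    have "?Q j" unfolding j by (rule GreatestI_nat[of ?Q, OF i b])
    moreover have "i \<le> j" if "?Q i" for i unfolding j by (rule Greatest_le_nat[of ?Q, OF that b])
    ultimately show ?thesis using True by (auto simp: beyond_def le_less)
  next
    case False
    let ?Q = "\<lambda>j'. t < j' \<and> on_node w a j'"
    have "\<exists>j'. ?Q j'" and j: "j = Least ?Q"
      using assms False by (auto simp: next_on_def upw_def next_down_def split: if_splits)
    then obtain i where i: "?Q i" by blast
    have "?Q j" unfolding j by (rule LeastI[of ?Q, OF i])
    moreover have "j \<le> i" if "?Q i" for i unfolding j by (rule Least_le[of ?Q, OF that])
    ultimately show ?thesis using False by (auto simp: beyond_def le_less)
  qed
  then show "on_node w a j" "beyond k a t j" "\<And>i. on_node w a i \<Longrightarrow> beyond k a t i \<Longrightarrow> i = j \<or> beyond k a j i" by blast+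
qed

lemma seg_beyond: "seg k a t t' = {s. (\<exists>c\<in>wires. c \<noteq> a \<and> s = node w a c) \<and> beyond k a t s \<and> (s = t' \<or> beyond k a s t')}"
  unfolding seg_def beyond_def by (auto; metis le_less)

lemma seg_next:
  assumes a: "a \<in> wires" and nx: "next_on w k a t = Some j" and t': "j = t' \<or> beyond k a j t'"
  shows "seg k a t t' = insert j (seg k a j t')"
proof -
  note N = next_on_Some[OF nx]
  have on: "(\<exists>c\<in>wires. c \<noteq> a \<and> s = node w a c) \<longleftrightarrow> on_node w a s" for s using on_node_iff a by blast
  have tr: "beyond k a t j \<Longrightarrow> beyond k a j s \<Longrightarrow> beyond k a t s" for s by (auto simp: beyond_def split: if_splits)
  have mem: "s \<in> seg k a u t' \<longleftrightarrow> on_node w a s \<and> beyond k a u s \<and> (s = t' \<or> beyond k a s t')" for s u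
    unfolding seg_beyond on by simp
  show ?thesis
  proof (intro set_eqI iffI)
    fix s assume "s \<in> seg k a t t'"
    then have s: "on_node w a s" "beyond k a t s" "s = t' \<or> beyond k a s t'" unfolding mem by simp_all
    from N(3)[OF s(1,2)] show "s \<in> insert j (seg k a j t')" unfolding insert_iff mem using s by simp
  next
    fix s assume "s \<in> insert j (seg k a j t')"
    then show "s \<in> seg k a t t'" unfolding insert_iff mem
    proof
      assume "s = j"
      then show "on_node w a s \<and> beyond k a t s \<and> (s = t' \<or> beyond k a s t')" using N(1,2) t' by simp
    next
      assume s: "on_node w a s \<and> beyond k a j s \<and> (s = t' \<or> beyond k a s t')"
      then show "on_node w a s \<and> beyond k a t s \<and> (s = t' \<or> beyond k a s t')" using tr[OF N(2), of s] by simp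
    qed
  qed
qed

lemma beyond_asym: "beyond k a s t \<Longrightarrow> \<not> beyond k a t s"
  by (simp add: beyond_def split: if_splits)

lemma beyond_irrefl: "\<not> beyond k a t t"
  by (simp add: beyond_def)

lemma seg_refl: "seg k a t t = {}"
proof (rule equals0I)
  fix s assume "s \<in> seg k a t t"
  then have s: "beyond k a t s \<and> (s = t \<or> beyond k a s t)" unfolding seg_beyond mem_Collect_eq by (rule conjunct2)
  from conjunct2[OF s] show False
  proof
    assume "s = t"
    then show False using conjunct1[OF s] beyond_irrefl by simp
  next
    assume "beyond k a s t"
    then show False using beyond_asym[OF conjunct1[OF s]] by contradiction
  qed
qed

lemma not_in_seg_start: "t \<notin> seg k a t t'"
proof
  assume "t \<in> seg k a t t'"
  then have "beyond k a t t" unfolding seg_beyond mem_Collect_eq by (elim conjE)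
  then show False using beyond_irrefl by contradiction
qed

lemma walk_Cons: "walk k a t (b # bs) \<longleftrightarrow> b \<in> wires \<and> b \<noteq> a \<and> beyond k a t (node w a b)
  \<and> (\<forall>c\<in>wires. c \<noteq> a \<longrightarrow> beyond k a t (node w a c) \<longrightarrow> beyond k a (node w a c) (node w a b) \<longrightarrow> \<not> forb k a c)
  \<and> walk k b (node w a b) bs"
  by (auto simp: beyond_def)

text \<open>A walk does not record straight nodes, so putting one in front leaves the list of
  switches as it is and only enlarges the visited set.\<close>

lemma straight_step:
  assumes a: "a \<in> wires" and nx: "next_on w k a t = Some j" and wk: "walk k a j bs"
    and f: "\<not> forb k a (other w j a)"
  shows "walk k a t bs" "vis k a t bs = insert j (vis k a j bs)"
    "nod k a t bs \<longleftrightarrow> nod k a j bs \<and> j \<notin> vis k a j bs"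
proof -
  note N = next_on_Some[OF nx]
  have jn: "j = node w a (other w j a)" "other w j a \<in> wires" "other w j a \<noteq> a" using N(1) by (auto elim: on_nodeE)
  have jN: "j < length w" using N(1) by (simp add: on_node_def)
  have "walk k a t bs \<and> vis k a t bs = insert j (vis k a j bs) \<and> (nod k a t bs \<longleftrightarrow> nod k a j bs \<and> j \<notin> vis k a j bs)"
  proof (cases bs)
    case Nil
    then have ak: "a = k + 1" using wk by simp
    then have "seg k a t (length w) = insert j (seg k a j (length w))"
      by (intro seg_next[OF a nx]) (use jN in \<open>simp add: beyond_def\<close>)
    then show ?thesis using Nil wk not_in_seg_start by simp
  next
    case (Cons b bs')
    let ?s = "node w a b"
    have W: "b \<in> wires" "b \<noteq> a" "beyond k a j ?s" "walk k b ?s bs'"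
      and nf: "\<And>c. c \<in> wires \<Longrightarrow> c \<noteq> a \<Longrightarrow> beyond k a j (node w a c) \<Longrightarrow> beyond k a (node w a c) ?s \<Longrightarrow> \<not> forb k a c"
      using wk unfolding Cons walk_Cons by blast+
    have bt: "beyond k a t ?s" using N(2) W(3) by (auto simp: beyond_def split: if_splits)
    have "\<not> forb k a c" if c: "c \<in> wires" "c \<noteq> a" "beyond k a t (node w a c)" "beyond k a (node w a c) ?s" for c
    proof (cases "node w a c = j")
      case True
      then have "c = other w j a" using on_node_node(2)[OF a c(1)] c(2) by simp
      then show ?thesis using f by simp
    next
      case False
      have "on_node w a (node w a c)" using on_node_node(1)[OF a c(1)] c(2) by simp
      from N(3)[OF this c(3)] False have "beyond k a j (node w a c)" by simp
      then show ?thesis using nf c by blast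
    qed
    then have wt: "walk k a t bs" unfolding Cons walk_Cons using W bt by blast
    have sg: "seg k a t ?s = insert j (seg k a j ?s)" by (rule seg_next[OF a nx]) (use W in simp)
    have js: "j \<notin> seg k a j ?s" by (rule not_in_seg_start)
    have d: "insert j (seg k a j ?s) \<inter> V = {} \<longleftrightarrow> seg k a j ?s \<inter> V = {} \<and> j \<notin> V" for V by (simp add: conj_commute)
    show ?thesis unfolding Cons vis.simps nod.simps sg d using wt[unfolded Cons] js by (simp add: conj_ac)
  qed
  then show "walk k a t bs" "vis k a t bs = insert j (vis k a j bs)"
    "nod k a t bs \<longleftrightarrow> nod k a j bs \<and> j \<notin> vis k a j bs" by blast+
qed

lemma switch_step:
  assumes a: "a \<in> wires" and nx: "next_on w k a t = Some (node w a b)" and b: "b \<in> wires" "b \<noteq> a"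
    and wk: "walk k b (node w a b) bs"
  shows "walk k a t (b # bs)" "vis k a t (b # bs) = insert (node w a b) (vis k b (node w a b) bs)"
    "nod k a t (b # bs) \<longleftrightarrow> nod k b (node w a b) bs \<and> node w a b \<notin> vis k b (node w a b) bs"
proof -
  note N = next_on_Some[OF nx]
  have no: False if "c \<in> wires" "c \<noteq> a" "beyond k a t (node w a c)" "beyond k a (node w a c) (node w a b)" for c
  proof -
    have "on_node w a (node w a c)" using on_node_node(1)[OF a that(1)] that(2) by simp
    from N(3)[OF this that(3)] show False using that(4) by (auto simp: beyond_def split: if_splits)
  qed
  show "walk k a t (b # bs)" unfolding walk_Cons using b N(2) wk no by blast
  have "seg k a t (node w a b) = {node w a b}" using seg_next[OF a nx, of "node w a b"] seg_refl by simp
  then show "vis k a t (b # bs) = insert (node w a b) (vis k b (node w a b) bs)"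
    "nod k a t (b # bs) \<longleftrightarrow> nod k b (node w a b) bs \<and> node w a b \<notin> vis k b (node w a b) bs" by auto
qed

section \<open>Rigorous paths read node by node\<close>

fun steps :: "nat \<Rightarrow> nat \<Rightarrow> nat \<Rightarrow> (nat \<times> nat \<times> nat) list \<Rightarrow> bool" where
  "steps k a t [] \<longleftrightarrow> a = k + 1 \<and> next_on w k a t = None"
| "steps k a t ((j, a', b) # P) \<longleftrightarrow> next_on w k a t = Some j \<and> a' = a \<and> on_node w a j \<and> on_node w b j
     \<and> (a = b \<longrightarrow> \<not> forb k a (other w j a)) \<and> steps k b j P"

definition psum :: "(nat \<Rightarrow> real) \<Rightarrow> (nat \<times> nat \<times> nat) list \<Rightarrow> real" where
  "psum x P = (\<Sum>s\<leftarrow>P. step_coeff s * x (fst s))"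

lemma psum_simps: "psum x [] = 0"
  "psum x ((j, a, b) # P) = (if a < b then x j else if b < a then - x j else 0) + psum x P"
  by (simp_all add: psum_def step_coeff_def)

lemma steps_walk:
  "steps k a t P \<Longrightarrow> a \<in> wires \<Longrightarrow>
   \<exists>bs. walk k a t bs \<and> (\<forall>x. val x a bs = psum x P) \<and> vis k a t bs = fst ` set P \<and> (nod k a t bs \<longleftrightarrow> distinct (map fst P))"
proof (induction P arbitrary: a t)
  case Nil
  have "seg k a t (length w) = {}"
    using next_on_None[of k a t] Nil on_node_iff unfolding seg_beyond by auto
  then show ?case using Nil by (intro exI[of _ "[]"]) (simp add: psum_simps)
next
  case (Cons s P)
  obtain j a' b where s: "s = (j, a', b)" by (cases s) auto
  have S: "next_on w k a t = Some j" "a' = a" "on_node w b j" "a = b \<longrightarrow> \<not> forb k a (other w j a)" "steps k b j P"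
    using Cons.prems(1) unfolding s by simp_all
  have bW: "b \<in> wires" using S(3) by (rule on_nodeE)
  obtain bs where bs: "walk k b j bs" "\<forall>x. val x b bs = psum x P" "vis k b j bs = fst ` set P"
    "nod k b j bs \<longleftrightarrow> distinct (map fst P)" using Cons.IH[OF S(5) bW] by blast
  show ?case
  proof (cases "a = b")
    case True
    have f: "\<not> forb k a (other w j a)" and bs1: "walk k a j bs" using S(4) bs(1) True by simp_all
    note st = straight_step[OF Cons.prems(2) S(1) bs1 f]
    show ?thesis
      by (rule exI[of _ bs]) (use st bs True S(2) in \<open>auto simp: s psum_simps simp del: vis.simps nod.simps walk.simps\<close>)
  next
    case False
    have "on_node w a j" using next_on_Some(1)[OF S(1)] .
    then have "j = node w a b"
    proof (rule on_nodeE)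
      assume o: "other w j a \<in> wires" "j = node w a (other w j a)" "other w j a \<noteq> a"
      have "b = other w j a"
        using S(3) \<open>on_node w a j\<close> False by (auto simp: other_def on_node_def)
      then show ?thesis using o by simp
    qed
    then have nx: "next_on w k a t = Some (node w a b)" and wk: "walk k b (node w a b) bs" and j: "j = node w a b"
      using S(1) bs(1) by simp_all
    note st = switch_step[OF Cons.prems(2) nx bW False[symmetric] wk]
    have vv: "val x a (b # bs) = psum x (s # P)" for x
      using bs(2) False S(2) unfolding s j by (simp add: psum_simps)
    show ?thesis
      by (intro exI[of _ "b # bs"] conjI allI vv)
        (use st bs j in \<open>auto simp: s simp del: vis.simps nod.simps walk.simps\<close>)
  qed
qed

text \<open>The straight nodes have to be restored one at a time: an induction on the switches, and
  within a segment one on the distance still available in the direction of travel.\<close>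

lemma walk_steps:
  "a \<in> wires \<Longrightarrow> t \<le> length w \<Longrightarrow> walk k a t bs \<Longrightarrow> nod k a t bs \<Longrightarrow>
   \<exists>P. steps k a t P \<and> (\<forall>x. val x a bs = psum x P) \<and> vis k a t bs = fst ` set P \<and> distinct (map fst P)"
proof (induction bs arbitrary: a t)
  case Nil
  then show ?case
  proof (induction "length w - t" arbitrary: t rule: less_induct)
    case less
    have ak: "a = k + 1" using less.prems by simp
    show ?case
    proof (cases "next_on w k a t")
      case None
      have "seg k a t (length w) = {}"
        using next_on_None[OF None] on_node_iff less.prems(1) unfolding seg_beyond by auto
      then show ?thesis using None ak by (intro exI[of _ "[]"]) (simp add: psum_simps)
    next
      case (Some j)
      note N = next_on_Some[OF Some]
      have j: "j < length w" "t < j" using N(1,2) ak by (auto simp: on_node_def beyond_def)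
      \<comment> \<open>On the final wire \<open>k + 1\<close> nothing is forbidden, since no wire
        lies strictly between \<open>k\<close> and \<open>k + 1\<close>.\<close>
      have f: "\<not> forb k a (other w j a)" using ak by (auto simp: forb_def)
      have wk: "walk k a j []" "nod k a j []" using ak by simp_all
      have "length w - j < length w - t" "j \<le> length w" using j by simp_all
      from less.hyps[OF this(1) less.prems(1) this(2) wk] obtain P where
        P: "steps k a j P" "\<forall>x. val x a [] = psum x P" "vis k a j [] = fst ` set P" "distinct (map fst P)" by blast
      note st = straight_step[OF less.prems(1) Some wk(1) f]
      have nj: "j \<notin> vis k a j []" using not_in_seg_start by simp
      show ?thesis
        by (intro exI[of _ "(j, a, a) # P"] conjI allI)
          (use P st(2) nj N(1) Some f in \<open>simp_all add: psum_simps del: vis.simps\<close>)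
    qed
  qed
next
  case (Cons b bs)
  note outer = Cons.IH
  from Cons.prems show ?case
  proof (induction "if a \<le> k then t else length w - t" arbitrary: t rule: less_induct)
    case less
    let ?s = "node w a b"
    have W: "b \<in> wires" "b \<noteq> a" "beyond k a t ?s" "walk k b ?s bs"
      and nf: "\<And>c. c \<in> wires \<Longrightarrow> c \<noteq> a \<Longrightarrow> beyond k a t (node w a c) \<Longrightarrow> beyond k a (node w a c) ?s \<Longrightarrow> \<not> forb k a c"
      using less.prems(3) unfolding walk_Cons by blast+
    have on: "on_node w a ?s" using on_node_node(1)[OF less.prems(1) W(1)] W(2) by simp
    have sN: "?s < length w" using on by (simp add: on_node_def)
    show ?case
    proof (cases "next_on w k a t")
      case None
      then show ?thesis using next_on_None[OF None on] W(3) by simp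
    next
      case (Some j)
      note N = next_on_Some[OF Some]
      have jN: "j < length w" using N(1) by (simp add: on_node_def)
      show ?thesis
      proof (cases "j = ?s")
        case True
        then have nx: "next_on w k a t = Some ?s" using Some by simp
        note st = switch_step[OF less.prems(1) nx W(1,2,4)]
        have nd: "nod k b ?s bs" "?s \<notin> vis k b ?s bs" using st(3) less.prems(4) by blast+
        from outer[OF W(1) less_imp_le[OF sN] W(4) nd(1)] obtain P where
          P: "steps k b ?s P" "\<forall>x. val x b bs = psum x P" "vis k b ?s bs = fst ` set P" "distinct (map fst P)" by blast
        have "on_node w b ?s" using on_node_node(1)[OF W(1) less.prems(1) W(2)] node_sym[of w a b] by simp
        then have "steps k a t ((?s, a, b) # P)" using P(1) nx on W(2) by simp
        moreover have "val x a (b # bs) = psum x ((?s, a, b) # P)" for x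
          using P(2) W(2) by (simp add: psum_simps)
        moreover have "vis k a t (b # bs) = fst ` set ((?s, a, b) # P)" using st(2) P(3) by simp
        moreover have "distinct (map fst ((?s, a, b) # P))" using P(3,4) nd(2) by simp
        ultimately show ?thesis by blast
      next
        case False
        have js: "beyond k a j ?s" using N(3)[OF on W(3)] False by simp
        have oc: "other w j a \<in> wires" "other w j a \<noteq> a" "j = node w a (other w j a)" using N(1) by (auto elim: on_nodeE)
        have f: "\<not> forb k a (other w j a)" using nf[OF oc(1,2)] N(2) js oc(3) by simp
        have tr: "beyond k a t s" if "beyond k a j s" for s using N(2) that by (auto simp: beyond_def split: if_splits)
        have wk: "walk k a j (b # bs)" unfolding walk_Cons using W js nf tr by blast
        note st = straight_step[OF less.prems(1) Some wk f]
        have nd: "nod k a j (b # bs)" "j \<notin> vis k a j (b # bs)" using st(3) less.prems(4) by blast+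
        have m: "(if a \<le> k then j else length w - j) < (if a \<le> k then t else length w - t)"
          using N(2) jN by (auto simp: beyond_def split: if_splits)
        from less.hyps[OF m less.prems(1) less_imp_le[OF jN] wk nd(1)] obtain P where
          P: "steps k a j P" "\<forall>x. val x a (b # bs) = psum x P" "vis k a j (b # bs) = fst ` set P" "distinct (map fst P)" by blast
        have "steps k a t ((j, a, a) # P)" using P(1) Some N(1) f by simp
        moreover have "val x a (b # bs) = psum x ((j, a, a) # P)" for x
          using P(2) by (simp add: psum_simps del: val.simps)
        moreover have "vis k a t (b # bs) = fst ` set ((j, a, a) # P)" using st(2) P(3) by simp
        moreover have "distinct (map fst ((j, a, a) # P))" using P(3,4) nd(2) by simp
        ultimately show ?thesis by blast
      qed
    qed
  qed
qed

lemma forb_upw: "forb k a c \<longleftrightarrow> (\<not> upw k a \<and> \<not> upw k c \<and> c < a) \<or> (upw k a \<and> upw k c \<and> a < c)"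
  by (auto simp: forb_def upw_def)

lemma all_less_Suc_shift: "(\<forall>r. Suc r < Suc (Suc m) \<longrightarrow> Q r) \<longleftrightarrow> Q 0 \<and> (\<forall>r. Suc r < Suc m \<longrightarrow> Q (Suc r))"
  by (metis Suc_less_eq Suc_mono not0_implies_Suc zero_less_Suc)

lemma steps_nth:
  "P \<noteq> [] \<Longrightarrow> steps k a t P \<longleftrightarrow> next_on w k a t = Some (fst (hd P)) \<and> fst (snd (hd P)) = a
   \<and> (\<forall>r < length P. case P ! r of (j, a, b) \<Rightarrow> on_node w a j \<and> on_node w b j \<and> (a = b \<longrightarrow> \<not> forb k a (other w j a)))
   \<and> (\<forall>r. Suc r < length P \<longrightarrow> next_on w k (snd (snd (P ! r))) (fst (P ! r)) = Some (fst (P ! Suc r))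
        \<and> fst (snd (P ! Suc r)) = snd (snd (P ! r)))
   \<and> snd (snd (last P)) = k + 1 \<and> next_on w k (k + 1) (fst (last P)) = None"
proof (induction P arbitrary: a t)
  case (Cons s P)
  obtain j a' b where s: "s = (j, a', b)" by (cases s) auto
  show ?case
  proof (cases P)
    case Nil
    then show ?thesis unfolding s by auto
  next
    case (Cons s' P')
    have ne: "P \<noteq> []" using Cons by simp
    show ?thesis
      unfolding s steps.simps Cons.IH[OF ne]
      unfolding Cons list.size add_Suc_right add_0_right all_less_Suc_shift All_less_Suc2
      by auto
  qed
qed simp

lemma rigorous_steps: "rigorous w k P \<longleftrightarrow> distinct (map fst P) \<and> steps k k (length w) P"
proof (cases "P = []")
  case True
  then show ?thesis by (simp add: rigorous_def)
next
  case False
  have nu: "next_on w k k t = next_up w k t" for t by (simp add: next_on_def upw_def)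
  show ?thesis
    using False by (simp only: rigorous_def steps_nth[OF False] forb_upw nu simp_thms conj_ac)
qed

lemma walk_wires: "walk k a t bs \<Longrightarrow> set bs \<subseteq> wires"
  by (induction bs arbitrary: a t) auto

lemma string_cone_walks:
  "string_cone n w = {x :: real ^ 'N. \<forall>(k, bs)\<in>GW 1 M. 0 \<le> val (\<lambda>j. x $ coord j) k bs}"
proof (intro set_eqI iffI)
  fix x :: "real ^ 'N" assume "x \<in> string_cone n w"
  then have x: "0 \<le> psum (\<lambda>j. x $ coord j) P" if "k \<in> {1..n}" "rigorous w k P" for k P
    using that unfolding string_cone_def psum_def GP_def by blast
  have "0 \<le> val (\<lambda>j. x $ coord j) k bs" if g: "(k, bs) \<in> GW 1 M" for k bs
  proof -
    have k': "1 \<le> k" "k < M" "walk k k (length w) bs" "nod k k (length w) bs" using g by (auto simp: GW_def)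
    then have k: "k \<in> {1..n}" "k \<in> wires" "walk k k (length w) bs" "nod k k (length w) bs" using M by simp_all
    from walk_steps[OF k(2) order_refl k(3,4)] obtain P where
      P: "steps k k (length w) P" "\<forall>x. val x k bs = psum x P" "distinct (map fst P)" by blast
    then have "rigorous w k P" by (simp add: rigorous_steps)
    from x[OF k(1) this] P(2) show ?thesis by simp
  qed
  then show "x \<in> {x. \<forall>(k, bs)\<in>GW 1 M. 0 \<le> val (\<lambda>j. x $ coord j) k bs}" by blast
next
  fix x :: "real ^ 'N" assume x: "x \<in> {x. \<forall>(k, bs)\<in>GW 1 M. 0 \<le> val (\<lambda>j. x $ coord j) k bs}"
  have "0 \<le> psum (\<lambda>j. x $ coord j) P" if k: "k \<in> {1..n}" and r: "rigorous w k P" for k P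
  proof -
    have st: "steps k k (length w) P" "distinct (map fst P)" using r by (simp_all add: rigorous_steps)
    have "k \<in> wires" using k M by simp
    from steps_walk[OF st(1) this] obtain bs where
      bs: "walk k k (length w) bs" "\<forall>x. val x k bs = psum x P" "nod k k (length w) bs" using st(2) by blast
    have "1 \<le> k" "k < M" using k M by simp_all
    then have "(k, bs) \<in> GW 1 M" using bs(1,3) walk_wires[OF bs(1)] by (auto simp: GW_def)
    with x have "0 \<le> val (\<lambda>j. x $ coord j) k bs" by blast
    then show ?thesis using bs(2) by simp
  qed
  then show "x \<in> string_cone n w" unfolding string_cone_def psum_def GP_def by blast
qed

lemma good_goodT: "1 \<le> lo \<Longrightarrow> lo + d \<le> M \<Longrightarrow> good d lo \<longleftrightarrow> goodT (triple w) d lo"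
proof (induction d arbitrary: lo)
  case (Suc d)
  let ?hi = "lo + Suc d"
  have T: "triple w a b c \<longleftrightarrow> node w a b < node w b c" if "lo \<le> a" "a < b" "b < c" "c \<le> ?hi" for a b c
    by (rule triple_node[OF w]) (use that Suc.prems in auto)
  have "dlast lo ?hi \<longleftrightarrow> (\<forall>a b. lo \<le> a \<and> a < b \<and> b < ?hi \<longrightarrow> triple w a b ?hi)"
    unfolding dlast_def
  proof (intro all_cong1 imp_cong refl)
    fix a b assume "lo \<le> a \<and> a < b \<and> b < ?hi"
    then show "node w a b < node w b ?hi \<longleftrightarrow> triple w a b ?hi" using T[of a b ?hi] by simp
  qed
  moreover have "alast lo ?hi \<longleftrightarrow> (\<forall>b c. lo < b \<and> b < c \<and> c \<le> ?hi \<longrightarrow> \<not> triple w lo b c)"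
    unfolding alast_def
  proof (intro all_cong1 imp_cong refl)
    fix b c assume o: "lo < b \<and> b < c \<and> c \<le> ?hi"
    have "node w b lo \<noteq> node w b c" by (rule neq) (use o Suc.prems in auto)
    then show "node w b c < node w lo b \<longleftrightarrow> \<not> triple w lo b c" using T[of lo b c] o node_sym[of w b lo] by auto
  qed
  ultimately show ?case using Suc.IH[of lo] Suc.IH[of "lo + 1"] Suc.prems by simp
qed simp

lemma nodes_all: "nodes 1 M = {..<length w}"
proof (intro set_eqI iffI)
  fix j assume "j \<in> nodes 1 M"
  then obtain a b where "j = node w a b" "1 \<le> a" "a < b" "b \<le> M" by (auto simp: nodes_def)
  then show "j \<in> {..<length w}" using lt[of a b] by simp
next
  fix j assume "j \<in> {..<length w}"
  then have "j < length w" by simp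
  note l = lwire_rwire[OF this]
  then have "1 \<le> lwire w j" "rwire w j \<le> M" by simp_all
  then have "\<exists>a b. j = node w a b \<and> 1 \<le> a \<and> a < b \<and> b \<le> M"
    using l(3,4) by (intro exI[of _ "lwire w j"] exI[of _ "rwire w j"] conjI)
  then show "j \<in> nodes 1 M" unfolding nodes_def by simp
qed

end

theorem mainTheorem2:
  fixes n :: nat and w :: "nat list"
  assumes "n \<ge> 1" and "CARD('N::finite) = n * (n + 1) div 2" and "w \<in> Sigma (n + 1)"
  shows "(simplicial (n * (n + 1) div 2) (string_cone n w :: (real ^ 'N) set)
            \<longleftrightarrow> (\<exists>\<sigma> :: nat \<Rightarrow> AD. \<forall>k\<in>{1..n}. ind (\<sigma> k) k (citer \<sigma> n (n - k) w) = 0))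
       \<and> ((\<exists>\<sigma> :: nat \<Rightarrow> AD. \<forall>k\<in>{1..n}. ind (\<sigma> k) k (citer \<sigma> n (n - k) w) = 0)
            \<longleftrightarrow> unimod_equiv (string_cone n w :: (real ^ 'N) set) (std_cone n))"
proof -
  let ?C = "string_cone n w :: (real ^ 'N) set"
  define M where "M = n + 1"
  have wM: "w \<in> Sigma M" using assms(3) unfolding M_def .
  interpret reduced_word w M n by unfold_locales (use wM M_def in auto)
  have N: "CARD('N) = length w" using SigmaD(1)[OF wM] assms(2) unfolding M_def by (simp add: mult.commute)
  have Nt: "CARD('N) = tri (Suc n)" using assms(2) tri_Suc_eq by simp
  let ?e = "\<lambda>j. axis (coord j) 1 :: real ^ 'N"
  have coord: "bij_betw (coord :: nat \<Rightarrow> 'N) {..<length w} UNIV" using coord_bij[where 'N='N] unfolding N .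
  interpret arrangement_basis "node w" M "length w" ?e
  proof
    fix i j assume ij: "i < length w" "j < length w"
    have "(coord i :: 'N) = coord j \<longleftrightarrow> i = j" using coord ij by (auto simp: bij_betw_def inj_on_def)
    then show "?e i \<bullet> ?e j = (if i = j then 1 else 0)" by (simp add: inner_axis_axis)
  qed
  have ex: "?e j \<bullet> x = x $ coord j" for j and x :: "real ^ 'N" by (simp add: inner_axis')
  have val: "pvec k bs \<bullet> x = val (\<lambda>j. x $ coord j) k bs" for k bs x
    unfolding inner_vec ex ..
  have Cwalk: "?C = {x. \<forall>(k, bs)\<in>GW 1 M. 0 \<le> val (\<lambda>j. x $ coord j) k bs}" by (rule string_cone_walks)
  have C: "?C = dual_cone (GV 1 M)" unfolding Cwalk dual_cone_def GV_def by (auto simp: val)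
  have T: "(\<exists>\<sigma> :: nat \<Rightarrow> AD. \<forall>k\<in>{1..n}. ind (\<sigma> k) k (citer \<sigma> n (n - k) w) = 0) \<longleftrightarrow> good n 1"
    unfolding ind_sequence_iff_goodT[OF assms(3)] using good_goodT[of 1 n] M_def by simp
  have "good n 1" if S: "simplicial (n * (n + 1) div 2) ?C"
  proof -
    have fin: "finite (GV 1 M)" unfolding GV_def by (rule finite_imageI[OF finite_GW]) simp_all
    have pos: "0 < p \<bullet> gsum" if "p \<in> GV 1 M" for p using inner_gsum[OF that] by simp
    have orth: "y = 0" if y: "\<And>p. p \<in> GV 1 M \<Longrightarrow> p \<bullet> y = 0" for y
    proof -
      have "y $ i = 0" for i
      proof -
        have "i \<in> coord ` {..<length w}" using coord unfolding bij_betw_def by simp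
        then obtain j where j: "j < length w" "i = coord j" by auto
        note l = lwire_rwire[OF j(1)]
        have e: "1 + n = M" unfolding M_def by simp
        have "?e (node w (lwire w j) (rwire w j)) \<bullet> y = 0"
          using GV_orthogonal[of 1 n y "lwire w j" "rwire w j"] y l unfolding e by simp
        then show ?thesis using l(4) j(2) ex by simp
      qed
      then show ?thesis by (simp add: vec_eq_iff)
    qed
    have "card {F. F facet_of dual_cone (GV 1 M)} = DIM(real ^ 'N)"
      using S assms(2) unfolding simplicial_def C by simp
    from fin pos _ this show ?thesis
    proof (rule simplicial_basis)
      show "y = 0" if "\<And>p. p \<in> GV 1 M \<Longrightarrow> p \<bullet> y = 0" for y using that by (rule orth)
      fix B assume B: "independent B" "B \<subseteq> GV 1 M"
        "\<And>p. p \<in> GV 1 M \<Longrightarrow> \<exists>c. (\<forall>b\<in>B. 0 \<le> c b) \<and> p = (\<Sum>b\<in>B. c b *\<^sub>R b)"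
      interpret arrangement_simplicial "node w" M "length w" ?e B
        by unfold_locales (rule B(1), rule B(2), erule B(3))
      have "1 + n = M" unfolding M_def by simp
      then show ?thesis using good_if_closed[of 1 n] closed_all by simp
    qed
  qed
  moreover have "unimod_equiv ?C (std_cone n)" if g: "good n 1"
  proof -
    have e: "1 + n = M" "(1 :: nat) \<le> 1" "M \<le> M" unfolding M_def by simp_all
    obtain f where f: "bij_betw f {..<tri (Suc n)} (nodes 1 M)"
      "\<And>x. (\<forall>(k, bs)\<in>GW 1 M. val x k bs \<ge> 0) \<longleftrightarrow> chains f n x"
      using good_chains[OF g e(2)] unfolding e(1) by auto
    have f': "bij_betw f {..<length w} {..<length w}" using f(1) Nt N unfolding nodes_all by simp
    let ?c = "coord :: nat \<Rightarrow> 'N"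
    \<comment> \<open>Transports \<open>f\<close> from node numbers to coordinate indices. The
      unimodular map is a mere permutation of coordinates, with translation 0.\<close>
    define p where "p = ?c \<circ> f \<circ> the_inv_into {..<length w} ?c"
    have bp: "bij p" unfolding p_def
      using bij_betw_trans[OF bij_betw_trans[OF bij_betw_the_inv_into[OF coord] f'] coord] by (simp add: comp_assoc)
    have pc: "p (?c i) = ?c (f i)" if "i < length w" for i
      unfolding p_def using coord that by (simp add: bij_betw_def the_inv_into_f_f)
    define P :: "real ^ 'N ^ 'N" where "P = (\<chi> a b. if b = p a then 1 else 0)"
    define Q :: "real ^ 'N ^ 'N" where "Q = (\<chi> a b. if a = p b then 1 else 0)"
    have Pv: "(P *v x) $ a = x $ p a" for x a
      unfolding P_def matrix_vector_mult_def by (simp add: if_distrib[of "\<lambda>c. c * _"] cong: if_cong)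
    have PQ: "P ** Q = mat 1"
      using bp unfolding P_def Q_def matrix_matrix_mult_def mat_def
      by (simp add: vec_eq_iff if_distrib[of "\<lambda>c. c * _"] bij_def inj_eq cong: if_cong)
    then have QP: "Q ** P = mat 1" by (simp add: matrix_left_right_inverse)
    have ints: "int_matrix P" "int_matrix Q" by (simp_all add: int_matrix_def P_def Q_def)
    have std: "y \<in> std_cone n \<longleftrightarrow> chains id n (\<lambda>j. y $ coord j)" for y :: "real ^ 'N"
      by (simp add: std_cone_def chains_def)
    have mem: "P *v x \<in> std_cone n \<longleftrightarrow> x \<in> ?C" for x
    proof -
      have "P *v x \<in> std_cone n \<longleftrightarrow> chains id n (\<lambda>j. x $ p (coord j))" unfolding std Pv ..
      also have "\<dots> \<longleftrightarrow> chains f n (\<lambda>j. x $ coord j)"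
        by (rule chains_cong) (use pc Nt N in simp)
      also have "\<dots> \<longleftrightarrow> x \<in> ?C" unfolding f(2)[symmetric] Cwalk by simp
      finally show ?thesis .
    qed
    have im: "(\<lambda>x. P *v x + 0) ` ?C = std_cone n"
    proof (intro set_eqI iffI)
      fix y :: "real ^ 'N" assume y: "y \<in> std_cone n"
      have "P *v (Q *v y) = y" using PQ by (simp add: matrix_vector_mul_assoc)
      then show "y \<in> (\<lambda>x. P *v x + 0) ` ?C" using mem[of "Q *v y"] y by (intro image_eqI[of _ _ "Q *v y"]) simp_all
    qed (use mem in auto)
    show ?thesis unfolding unimod_equiv_def
      by (rule exI[of _ P], rule exI[of _ 0], intro conjI exI[of _ Q] ints PQ QP im) simp
  qed
  moreover have "simplicial (n * (n + 1) div 2) ?C" if U: "unimod_equiv ?C (std_cone n)"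
  proof -
    obtain P Q :: "real ^ 'N ^ 'N" and v :: "real ^ 'N" where PQ: "Q ** P = mat 1" "(\<lambda>x. P *v x + v) ` ?C = std_cone n"
      using U unfolding unimod_equiv_def by blast
    have "inj ((*v) P)"
      by (rule inj_on_inverseI[of _ "(*v) Q"]) (simp add: matrix_vector_mul_assoc PQ)
    \<comment> \<open>An injective affine map preserves the number of facets, which is known for the
      standard cone.\<close>
    from card_facets_affine_image[OF matrix_vector_mul_linear this, of v ?C]
    have "card {F. F facet_of ?C} = CARD('N)" unfolding PQ(2) card_facets_std_cone[OF Nt] by simp
    then show ?thesis unfolding simplicial_def assms(2) by simp
  qed
  ultimately show ?thesis unfolding T by blast
qed

end
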